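(* Let $\alpha>1$ and $\mu\in\mathbb{R}$. Let $\phi\le\mu$ be a nontrivial (i.e. nonconstant), $2\pi$-periodic, even solution of $$\tfrac12(\mu-\phi)^2=\tfrac12\mu^2-L\phi,$$ which is nonincreasing on $[0,\pi]$. If $\phi$ attains its maximum at $\phi(0)=\mu$, then the following hold: (i) $\phi\in C^\infty(\mathbb{T}\setminus\{0\})$ and $\phi$ is strictly decreasing on $(0,\pi)$. (ii) $\phi\in C^{1-}(\mathbb{T})$, that is, $\phi$ is Lipschitz continuous. (iii) $\phi$ is precisely Lipschitz continuous at $x=0$, that is, there exist constants $c_1,c_2>0$ such that $$c_1|x|\le\mu-\phi(x)\le c_2|x|$$ for $|x|\ll1$ (i.e. for all $|x|$ sufficiently small).
   Context: $\mathbb{T}=[-\pi,\pi]$, and functions on $\mathbb{T}$ are identified with $2\pi$-periodic functions on $\mathbb{R}$. $L$ is the Fourier multiplier operator with symbol $m(\xi)=(1+\xi^2)^{-\alpha/2}$: $Lf=K*f$ with $K=\mathcal{F}^{-1}(m)$, i.e. $K(x)=\frac1{2\pi}\int_{\mathbb{R}}m(\xi)e^{ix\xi}\,d\xi$; on $2\pi$-periodic functions it multiplies the $n$-th Fourier coefficient by $m(n)$. A solution is a real-valued bounded function satisfying the equation pointwise. *)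

theory Defs
  imports "HOL-Analysis.Analysis"
begin

text \<open>
  Functions on the circle \<open>\<real>/2\<pi>\<int>\<close> are represented by \<open>2\<pi>\<close>-periodic functions on \<open>\<real>\<close>.
\<close>

definition symbol :: "real \<Rightarrow> real \<Rightarrow> real" where
  "symbol \<alpha> \<xi> = (1 + \<xi>\<^sup>2) powr (- \<alpha> / 2)"

definition inv_fourier :: "(real \<Rightarrow> real) \<Rightarrow> real \<Rightarrow> complex" where
  "inv_fourier m x =
     1 / (2 * of_real pi) * (LINT \<xi>|lborel. of_real (m \<xi>) * exp (\<i> * of_real (x * \<xi>)))"

text \<open>
  For \<open>\<alpha> > 1\<close> the symbol is integrable, so the integral defining the kernel converges
  absolutely.
\<close>

definition kernel :: "real \<Rightarrow> real \<Rightarrow> complex" where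
  "kernel \<alpha> = inv_fourier (symbol \<alpha>)"

definition convolve :: "(real \<Rightarrow> complex) \<Rightarrow> (real \<Rightarrow> complex) \<Rightarrow> real \<Rightarrow> complex" where
  "convolve g f x = (LINT y|lborel. g (x - y) * f y)"

text \<open>
  The kernel is an integrable function on \<open>\<real>\<close>, so the convolution is a genuine integral for
  every bounded Borel measurable argument.
\<close>

definition L_op :: "real \<Rightarrow> (real \<Rightarrow> real) \<Rightarrow> real \<Rightarrow> complex" where
  "L_op \<alpha> f = convolve (kernel \<alpha>) (\<lambda>y. of_real (f y))"

text \<open>
  The kernel is defined by a complex integral, so the equation is read in \<open>\<complex>\<close>; this adds no
  condition, since the symbol is even and the kernel is hence real-valued.  Measurability is not
  listed separately; it is automatic for \<open>2\<pi>\<close>-periodic even functions that are monotone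
  on \<open>[0, \<pi>]\<close>.
\<close>

definition is_solution :: "real \<Rightarrow> real \<Rightarrow> (real \<Rightarrow> real) \<Rightarrow> bool" where
  "is_solution \<alpha> \<mu> \<phi> \<longleftrightarrow> bounded (range \<phi>) \<and>
     (\<forall>x. complex_of_real (1 / 2 * (\<mu> - \<phi> x)\<^sup>2) = complex_of_real (1 / 2 * \<mu>\<^sup>2) - L_op \<alpha> \<phi> x)"

text \<open>Intended for open sets \<open>S\<close>, where the iterated two-sided derivatives make sense.\<close>

definition C_infinity_on :: "real set \<Rightarrow> (real \<Rightarrow> real) \<Rightarrow> bool" where
  "C_infinity_on S f \<longleftrightarrow> (\<forall>k. \<forall>x\<in>S. (deriv ^^ k) f differentiable at x)"

end

theory Submission
  imports Defs "HOL-Probability.Probability" "HOL-Real_Asymp.Real_Asymp"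
begin

text \<open>
  Put \<open>u = \<mu> - \<phi> \<ge> 0\<close>. Subtracting the equation at \<open>0\<close> from the equation at \<open>x\<close> gives
  \<open>u(x)\<^sup>2 = 2 (L u(x) - L u(0))\<close>, so everything follows from mapping properties of \<open>L\<close>.

  For \<open>1 < \<alpha> \<le> 2\<close> the symbol is a superposition of resolvents \<open>2 s / (s\<^sup>2 + \<xi>\<^sup>2)\<close>, \<open>s \<ge> 1\<close>, with respect to
  a finite measure, so by Fourier inversion the kernel is a superposition of the functions
  \<open>exp (- s \<bar>x\<bar>)\<close>. For larger \<open>\<alpha>\<close> write \<open>\<alpha> = n \<beta>\<close> with \<open>1 < \<beta> \<le> 2\<close>; then \<open>L\<close> is the \<open>n\<close>-fold
  iterate of the operator for \<open>\<beta>\<close>.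

  All estimates reduce to a single exponential: the derivative of \<open>exp (- s \<bar>\<cdot>\<bar>) * u\<close> at \<open>x\<close> is the integral of
  \<open>s exp (- s z) (u(x + z) - u(x - z))\<close> over \<open>z > 0\<close>. It is positive on \<open>(0, \<pi>)\<close> and at least \<open>c x\<close> near \<open>0\<close>,
  which yields strict monotonicity and \<open>u(x) \<ge> c \<bar>x\<bar>\<close>. If \<open>u(y) \<le> M (\<bar>y\<bar> + \<epsilon>)\<close>, it is at most
  \<open>4 M (x + \<epsilon>)\<close>, uniformly in \<open>s\<close>; this self-improves to \<open>u(x) \<le> C \<bar>x\<bar>\<close>, and dividing
  \<open>(u(x) - u(z)) (u(x) + u(z)) = 2 (L u(x) - L u(z))\<close> by \<open>u(x) + u(z)\<close> gives the Lipschitz bound.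
  Away from \<open>2 \<pi> \<int>\<close> the function \<open>u\<close> is the square root of a positive function with one more derivative than \<open>u\<close>.
\<close>

section \<open>Functions of class C^k on open sets\<close>

fun Ck :: "nat \<Rightarrow> real set \<Rightarrow> (real \<Rightarrow> real) \<Rightarrow> bool" where
  "Ck 0 S f \<longleftrightarrow> continuous_on S f"
| "Ck (Suc k) S f \<longleftrightarrow> (\<forall>x\<in>S. f differentiable at x) \<and> Ck k S (deriv f)"

lemma Ck_cong:
  assumes "open S" "\<And>x. x \<in> S \<Longrightarrow> f x = g x"
  shows "Ck k S f \<longleftrightarrow> Ck k S g"
  using assms(2)
proof (induction k arbitrary: f g)
  case 0
  then show ?case by (simp cong: continuous_on_cong)
next
  case (Suc k)
  have ev: "\<forall>\<^sub>F y in nhds x. f y = g y" if "x \<in> S" for x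
    using eventually_nhds_in_open[OF assms(1) that] by (rule eventually_mono) (use Suc.prems in auto)
  have "f differentiable at x \<longleftrightarrow> g differentiable at x" if "x \<in> S" for x
    unfolding real_differentiable_def using DERIV_cong_ev[OF refl ev[OF that] refl] by blast
  moreover have "deriv f x = deriv g x" if "x \<in> S" for x
    by (intro deriv_cong_ev ev that refl)
  ultimately show ?case using Suc.IH[of "deriv f" "deriv g"] by auto
qed

lemma Ck_subset: "Ck k S f \<Longrightarrow> T \<subseteq> S \<Longrightarrow> Ck k T f"
  by (induction k arbitrary: f) (auto intro: continuous_on_subset)

lemma Ck_local:
  assumes "\<And>x. x \<in> S \<Longrightarrow> \<exists>U. open U \<and> x \<in> U \<and> Ck k U f"
  shows "Ck k S f"
  using assms
proof (induction k arbitrary: f)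
  case 0
  have "isCont f x" if x: "x \<in> S" for x
    using 0[OF x] by (auto simp: continuous_on_eq_continuous_at)
  then show ?case
    by (simp add: continuous_at_imp_continuous_on)
next
  case (Suc k)
  have "\<And>x. x \<in> S \<Longrightarrow> \<exists>U. open U \<and> x \<in> U \<and> Ck k U (deriv f)"
    using Suc.prems unfolding Ck.simps by blast
  then have "Ck k S (deriv f)" by (rule Suc.IH)
  moreover have "f differentiable at x" if "x \<in> S" for x
    using Suc.prems[OF that] by auto
  ultimately show ?case by simp
qed

lemma Ck_SucI:
  assumes "open S" "\<And>x. x \<in> S \<Longrightarrow> (f has_real_derivative f' x) (at x)" "Ck k S f'"
  shows "Ck (Suc k) S f"
proof -
  have "Ck k S (deriv f)"
    using Ck_cong[OF assms(1), of f' "deriv f" k] assms(2,3) by (metis DERIV_imp_deriv)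
  with assms(2) show ?thesis by (auto simp: real_differentiable_def)
qed

lemma Ck_continuous_on: "Ck k S f \<Longrightarrow> continuous_on S f"
proof (cases k)
  case (Suc j)
  assume "Ck k S f"
  then have "\<forall>x\<in>S. f differentiable at x" unfolding Suc by simp
  then show ?thesis
    by (intro continuous_at_imp_continuous_on ballI differentiable_imp_continuous_within) blast
qed simp

lemma Ck_Suc_imp: "Ck (Suc k) S f \<Longrightarrow> Ck k S f"
proof (induction k arbitrary: f)
  case 0
  then show ?case using Ck_continuous_on[OF 0] by simp
next
  case (Suc k)
  have "\<forall>x\<in>S. f differentiable at x" "Ck (Suc k) S (deriv f)"
    using Suc.prems unfolding Ck.simps(2)[of "Suc k"] by blast+
  with Suc.IH[of "deriv f"] show ?case unfolding Ck.simps(2)[of k] by blast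
qed

lemma DERIV_deriv_of_Ck: "Ck (Suc k) S f \<Longrightarrow> x \<in> S \<Longrightarrow> (f has_real_derivative deriv f x) (at x)"
  by (simp add: DERIV_deriv_iff_real_differentiable)

lemma Ck_add:
  assumes "open S" shows "Ck k S f \<Longrightarrow> Ck k S g \<Longrightarrow> Ck k S (\<lambda>x. f x + g x)"
proof (induction k arbitrary: f g)
  case 0
  then show ?case by (auto intro: continuous_intros)
next
  case (Suc k)
  show ?case
  proof (rule Ck_SucI[where f' = "\<lambda>x. deriv f x + deriv g x"])
    show "Ck k S (\<lambda>x. deriv f x + deriv g x)" by (rule Suc.IH) (use Suc.prems in auto)
  qed (use assms Suc.prems in \<open>auto intro!: DERIV_add DERIV_deriv_of_Ck\<close>)
qed

lemma Ck_mult: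
  assumes "open S" shows "Ck k S f \<Longrightarrow> Ck k S g \<Longrightarrow> Ck k S (\<lambda>x. f x * g x)"
proof (induction k arbitrary: f g)
  case 0
  then show ?case by (auto intro: continuous_intros)
next
  case (Suc k)
  have "Ck k S (deriv f)" "Ck k S (deriv g)" using Suc.prems by simp_all
  then have "Ck k S (\<lambda>x. deriv f x * g x + deriv g x * f x)"
    using Suc.prems[THEN Ck_Suc_imp] by (intro Ck_add[OF assms] Suc.IH)
  then show ?case
    by (rule Ck_SucI[OF assms, rotated]) (rule DERIV_mult DERIV_deriv_of_Ck Suc.prems | assumption)+
qed

lemma Ck_const: "Ck k S (\<lambda>x. c)"
  by (induction k arbitrary: c) (auto simp: fun_eq_iff)

lemma Ck_affine: "open S \<Longrightarrow> Ck k S f \<Longrightarrow> Ck k S (\<lambda>x. a + b * f x)"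
  by (intro Ck_add Ck_mult Ck_const)

lemma Ck_inverse:
  assumes "open S" "\<And>x. x \<in> S \<Longrightarrow> f x \<noteq> 0" shows "Ck k S f \<Longrightarrow> Ck k S (\<lambda>x. inverse (f x))"
proof (induction k)
  case 0
  then show ?case using assms by (auto intro!: continuous_intros)
next
  case (Suc k)
  have "Ck k S (\<lambda>x. inverse (f x) * inverse (f x))"
    using Suc.IH[OF Ck_Suc_imp[OF Suc.prems]] by (intro Ck_mult[OF assms(1)])
  from Ck_affine[OF assms(1) Ck_mult[OF assms(1) this, of "deriv f"], of 0 "-1"] Suc.prems
  have "Ck k S (\<lambda>x. - (inverse (f x) * inverse (f x) * deriv f x))" by simp
  then show ?case
    using assms Suc.prems
    by (intro Ck_SucI[where f' = "\<lambda>x. - (inverse (f x) * inverse (f x) * deriv f x)"] assms)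
       (auto intro!: derivative_eq_intros simp: DERIV_deriv_iff_real_differentiable)
qed

lemma Ck_sqrt:
  assumes "open S" "\<And>x. x \<in> S \<Longrightarrow> f x > 0" shows "Ck k S f \<Longrightarrow> Ck k S (\<lambda>x. sqrt (f x))"
proof (induction k)
  case 0
  then show ?case by (auto intro!: continuous_intros)
next
  case (Suc k)
  have "Ck k S (\<lambda>x. sqrt (f x))"
    by (rule Suc.IH[OF Ck_Suc_imp[OF Suc.prems]])
  then have "Ck k S (\<lambda>x. inverse (sqrt (f x)))"
    by (rule Ck_inverse[OF assms(1), rotated]) (use assms in force)
  from Ck_affine[OF assms(1) Ck_mult[OF assms(1) this, of "deriv f"], of 0 "1/2"] Suc.prems
  have *: "Ck k S (\<lambda>x. 1/2 * (inverse (sqrt (f x)) * deriv f x))" by simp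
  have "((\<lambda>x. sqrt (f x)) has_real_derivative 1/2 * (inverse (sqrt (f x)) * deriv f x)) (at x)" if "x \<in> S" for x
    by (rule DERIV_cong[OF DERIV_chain2[OF DERIV_real_sqrt DERIV_deriv_of_Ck]])
       (use assms Suc.prems that in \<open>auto simp: field_simps\<close>)
  then show ?case
    using * by (intro Ck_SucI[where f' = "\<lambda>x. 1/2 * (inverse (sqrt (f x)) * deriv f x)"] assms)
qed

lemma Ck_uminus_arg:
  assumes "open S" shows "Ck k S f \<Longrightarrow> Ck k (uminus ` S) (\<lambda>x. f (- x))"
proof (induction k arbitrary: f)
  case 0
  then show ?case 
    by (auto intro!: continuous_on_compose2[of S f] continuous_intros)
next
  case (Suc k)
  have op: "open (uminus ` S)" using assms by (rule open_negations)
  have "Ck k (uminus ` S) (\<lambda>x. -1 * deriv f (- x))"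
    using Suc.prems by (intro Ck_mult[OF op] Ck_const Suc.IH) simp
  show ?case
  proof (rule Ck_SucI[OF op _ \<open>Ck k _ _\<close>])
    fix x assume "x \<in> uminus ` S"
    then have "- x \<in> S" by auto
    then show "((\<lambda>x. f (- x)) has_real_derivative -1 * deriv f (- x)) (at x)"
      using DERIV_chain2[OF DERIV_deriv_of_Ck[OF Suc.prems] DERIV_minus[OF DERIV_ident]] by simp
  qed
qed

lemma C_infinity_onI:
  assumes "\<And>k. Ck k S f"
  shows "C_infinity_on S f"
proof -
  have "Ck k S g \<Longrightarrow> j < k \<Longrightarrow> x \<in> S \<Longrightarrow> (deriv ^^ j) g differentiable at x" for k j x g
  proof (induction k arbitrary: j g)
    case (Suc k)
    then show ?case
      by (cases j) (auto simp del: funpow.simps simp: funpow_Suc_right)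
  qed simp
  with assms show ?thesis unfolding C_infinity_on_def by (meson lessI)
qed

section \<open>One-sided exponential convolution\<close>

lemma integrable_mult_bounded_right:
  fixes f g :: "'a \<Rightarrow> 'b :: {real_normed_algebra, banach, second_countable_topology}"
  assumes f: "integrable M f" and [measurable]: "g \<in> borel_measurable M"
    and B: "\<And>x. x \<in> space M \<Longrightarrow> norm (g x) \<le> B"
  shows "integrable M (\<lambda>x. f x * g x)"
proof (rule Bochner_Integration.integrable_bound[of _ "\<lambda>x. B * norm (f x)"])
  have [measurable]: "f \<in> borel_measurable M" using f by simp
  show "(\<lambda>x. f x * g x) \<in> borel_measurable M" by measurable
  show "integrable M (\<lambda>x. B * norm (f x))" using f by simp
  show "AE x in M. norm (f x * g x) \<le> norm (B * norm (f x))"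
  proof (rule AE_I2)
    fix x assume "x \<in> space M"
    then have "norm (f x * g x) \<le> norm (f x) * B"
      using B by (meson mult_left_mono norm_ge_zero norm_mult_ineq order_trans)
    then show "norm (f x * g x) \<le> norm (B * norm (f x))" by (simp add: mult.commute)
  qed
qed

lemma norm_integral_le_integral:
  fixes f :: "'a \<Rightarrow> 'b :: {banach, second_countable_topology}"
  assumes "integrable M f" "integrable M g" "\<And>x. x \<in> space M \<Longrightarrow> norm (f x) \<le> g x"
  shows "norm (integral\<^sup>L M f) \<le> integral\<^sup>L M g"
  by (rule order_trans[OF integral_norm_bound]) (intro integral_mono integrable_norm assms)

definition expker :: "real \<Rightarrow> real \<Rightarrow> real" where
  "expker s z = indicator {0..} z * exp (- s * z)"

lemma expker_measurable [measurable]: "expker s \<in> borel_measurable borel"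
  unfolding expker_def by measurable

lemma expker_nonneg [simp]: "0 \<le> expker s z" by (simp add: expker_def)

lemma has_bochner_integral_expker:
  assumes s: "s > 0" shows "has_bochner_integral lborel (expker s) (1 / s)"
proof -
  have "(\<integral>\<^sup>+x. ennreal (exp (-s * x)) * indicator {0..} x \<partial>lborel) = ennreal (0 - (- exp (-s * 0) / s))"
    by (rule nn_integral_FTC_atLeast, measurable)
       (use s in \<open>auto intro!: derivative_eq_intros, real_asymp\<close>)
  also have "(\<integral>\<^sup>+x. ennreal (exp (-s * x)) * indicator {0..} x \<partial>lborel) = (\<integral>\<^sup>+x. ennreal (expker s x) \<partial>lborel)"
    by (intro nn_integral_cong) (auto simp: expker_def split: split_indicator)
  finally show ?thesis
    by (intro has_bochner_integral_nn_integral) (use s in auto)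
qed

lemma has_bochner_integral_expker_times:
  assumes s: "s > 0" shows "has_bochner_integral lborel (\<lambda>z. expker s z * z) (1 / s\<^sup>2)"
proof -
  have "(\<integral>\<^sup>+x. ennreal (exp (-s * x) * x) * indicator {0..} x \<partial>lborel)
      = ennreal (0 - (- exp (-s * 0) * (s * 0 + 1) / s\<^sup>2))"
  proof (rule nn_integral_FTC_atLeast)
    show "((\<lambda>x. - exp (-s * x) * (s * x + 1) / s\<^sup>2) has_real_derivative exp (-s * x) * x) (at x)" for x
      using s by (auto intro!: derivative_eq_intros simp: field_simps power2_eq_square)
    show "((\<lambda>x. - exp (-s * x) * (s * x + 1) / s\<^sup>2) \<longlongrightarrow> 0) at_top"
      using s by real_asymp
  qed auto
  also have "(\<integral>\<^sup>+x. ennreal (exp (-s * x) * x) * indicator {0..} x \<partial>lborel) = (\<integral>\<^sup>+x. ennreal (expker s x * x) \<partial>lborel)"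
    by (intro nn_integral_cong) (auto simp: expker_def split: split_indicator)
  finally show ?thesis
    by (intro has_bochner_integral_nn_integral) (use s in \<open>auto simp: expker_def split: split_indicator\<close>)
qed

lemma
  assumes "s > 0"
  shows integrable_expker: "integrable lborel (expker s)"
    and integral_expker: "integral\<^sup>L lborel (expker s) = 1 / s"
    and integrable_expker_times: "integrable lborel (\<lambda>z. expker s z * z)"
    and integral_expker_times: "(\<integral>z. expker s z * z \<partial>lborel) = 1 / s\<^sup>2"
  using has_bochner_integral_expker[OF assms] has_bochner_integral_expker_times[OF assms]
  by (simp_all add: has_bochner_integral_iff)

definition expconv :: "real \<Rightarrow> (real \<Rightarrow> real) \<Rightarrow> real \<Rightarrow> real" where
  "expconv s u x = (\<integral>z. expker s z * u (x - z) \<partial>lborel)"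

lemma expker_mult_bounded_integrable:
  assumes "s > 0" and [measurable]: "u \<in> borel_measurable borel" and "\<And>z. \<bar>u z\<bar> \<le> B"
  shows "integrable lborel (\<lambda>z. expker s z * u z)"
  by (rule integrable_mult_bounded_right[OF integrable_expker]) (use assms in auto)

lemma expker_mult_bounded_abs_le:
  assumes "s > 0" and [measurable]: "u \<in> borel_measurable borel" and "\<And>z. \<bar>u z\<bar> \<le> B"
  shows "\<bar>\<integral>z. expker s z * u z \<partial>lborel\<bar> \<le> B / s"
proof -
  have "norm (\<integral>z. expker s z * u z \<partial>lborel) \<le> (\<integral>z. expker s z * B \<partial>lborel)"
    using assms
    by (intro norm_integral_le_integral expker_mult_bounded_integrable[of _ _ B]
              expker_mult_bounded_integrable[of _ _ "\<bar>B\<bar>"])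
       (auto simp: abs_mult intro!: mult_left_mono)
  also have "\<dots> = B / s" using assms integral_expker[of s] by simp
  finally show ?thesis by simp
qed

lemma expconv_abs_le:
  assumes "s > 0" and [measurable]: "u \<in> borel_measurable borel" and "\<And>z. \<bar>u z\<bar> \<le> B"
  shows "\<bar>expconv s u x\<bar> \<le> B / s"
  unfolding expconv_def by (rule expker_mult_bounded_abs_le) (use assms in auto)

lemma expconv_altdef:
  fixes s x :: real
  shows "expconv s u x = (\<integral>w. indicator {..x} w * exp (- s * (x - w)) * u w \<partial>lborel)"
  unfolding expconv_def
  by (subst lborel_integral_real_affine[where c = "-1" and t = x])
     (auto simp: expker_def intro!: Bochner_Integration.integral_cong split: split_indicator)

lemma expconv_integrable_altdef:
  fixes s x :: real
  assumes "s > 0" and [measurable]: "u \<in> borel_measurable borel" and "\<And>z. \<bar>u z\<bar> \<le> B"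
  shows "integrable lborel (\<lambda>w. indicator {..x} w * exp (- s * (x - w)) * u w)"
proof -
  have "integrable lborel (\<lambda>w. expker s (x + (-1) * w) * u (x - (x + (-1) * w)))"
    by (rule lborel_integrable_real_affine[OF expker_mult_bounded_integrable[OF assms(1), of "\<lambda>z. u (x - z)" B]])
       (use assms in auto)
  also have "(\<lambda>w. expker s (x + (-1) * w) * u (x - (x + (-1) * w)))
      = (\<lambda>w. indicator {..x} w * exp (- s * (x - w)) * u w)"
    by (auto simp: expker_def fun_eq_iff split: split_indicator)
  finally show ?thesis .
qed

lemma expconv_shift:
  assumes "s > 0" and [measurable]: "u \<in> borel_measurable borel" and "\<And>z. \<bar>u z\<bar> \<le> B" and "x \<le> y"
  shows "expconv s u y = exp (- s * (y - x)) * expconv s u x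
           + (\<integral>w. indicator {x..y} w * (exp (- s * (y - w)) * u w) \<partial>lborel)"
    and "integrable lborel (\<lambda>w. indicator {x..y} w * (exp (- s * (y - w)) * u w))"
proof -
  let ?f = "\<lambda>w. exp (- s * (y - w)) * u w"
  have i: "integrable lborel (\<lambda>w. indicator {..y} w * ?f w)"
    using expconv_integrable_altdef[OF assms(1-3), of y] by (simp add: mult.assoc)
  have eq1: "indicator A w * ?f w = indicator A w * (indicator {..y} w * ?f w)" if "A \<subseteq> {..y}" for A w
    using that by (auto split: split_indicator)
  show i2: "integrable lborel (\<lambda>w. indicator {x..y} w * ?f w)"
    using integrable_mult_indicator[OF _ i, of "{x..y}"] by (subst eq1) (auto simp: mult_ac)
  have i1: "integrable lborel (\<lambda>w. indicator {..x} w * ?f w)"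
    using integrable_mult_indicator[OF _ i, of "{..x}"] assms(4) by (subst eq1) (auto simp: mult_ac)
  have "expconv s u y = (\<integral>w. indicator {..y} w * ?f w \<partial>lborel)"
    unfolding expconv_altdef by (simp add: mult.assoc)
  also have "\<dots> = (\<integral>w. indicator {..x} w * ?f w + indicator {x..y} w * ?f w \<partial>lborel)"
  proof (rule integral_cong_AE)
    show "AE w in lborel. indicator {..y} w * ?f w = indicator {..x} w * ?f w + indicator {x..y} w * ?f w"
      using AE_lborel_singleton[of x]
      by eventually_elim (use assms(4) in \<open>auto split: split_indicator\<close>)
  qed measurable
  also have "\<dots> = (\<integral>w. indicator {..x} w * ?f w \<partial>lborel) + (\<integral>w. indicator {x..y} w * ?f w \<partial>lborel)"
    by (rule Bochner_Integration.integral_add[OF i1 i2])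
  also have "(\<integral>w. indicator {..x} w * ?f w \<partial>lborel)
      = (\<integral>w. exp (- s * (y - x)) * (indicator {..x} w * exp (- s * (x - w)) * u w) \<partial>lborel)"
    by (intro Bochner_Integration.integral_cong)
       (auto simp: exp_add[symmetric] algebra_simps split: split_indicator)
  also have "\<dots> = exp (- s * (y - x)) * expconv s u x"
    unfolding expconv_altdef by simp
  finally show "expconv s u y = exp (- s * (y - x)) * expconv s u x + (\<integral>w. indicator {x..y} w * ?f w \<partial>lborel)" .
qed

lemma expconv_lipschitz:
  assumes "s > 0" and [measurable]: "u \<in> borel_measurable borel" and B: "\<And>z. \<bar>u z\<bar> \<le> B"
  shows "\<bar>expconv s u x - expconv s u y\<bar> \<le> 2 * B * \<bar>x - y\<bar>"
proof -
  have B0: "0 \<le> B" using B[of 0] by linarith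
  have *: "\<bar>expconv s u y - expconv s u x\<bar> \<le> 2 * B * (y - x)" if "x \<le> y" for x y
  proof -
    have "norm (\<integral>w. indicator {x..y} w * (exp (- s * (y - w)) * u w) \<partial>lborel)
        \<le> (\<integral>w. indicator {x..y} w * B \<partial>lborel)"
    proof (rule norm_integral_le_integral[OF expconv_shift(2)[OF assms that]])
      show "norm (indicator {x..y} w * (exp (- s * (y - w)) * u w)) \<le> indicator {x..y} w * B" for w
        using B[of w] B0 \<open>s > 0\<close> mult_mono[of "exp (- s * (y - w))" 1 "\<bar>u w\<bar>" B]
        by (auto simp: abs_mult split: split_indicator)
    qed (auto intro!: integrable_mult_left integrable_real_indicator simp: emeasure_lborel_Icc_eq)
    also have "\<dots> = (y - x) * B" using that by simp
    finally have 1: "\<bar>\<integral>w. indicator {x..y} w * (exp (- s * (y - w)) * u w) \<partial>lborel\<bar> \<le> (y - x) * B" by simp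
    have "1 - s * (y - x) \<le> exp (- s * (y - x))"
      using exp_ge_add_one_self[of "- s * (y - x)"] by simp
    moreover have "exp (- s * (y - x)) \<le> 1" using \<open>s > 0\<close> that by simp
    ultimately have "\<bar>exp (- s * (y - x)) - 1\<bar> * \<bar>expconv s u x\<bar> \<le> s * (y - x) * (B / s)"
      by (intro mult_mono expconv_abs_le[OF assms]) (use \<open>s > 0\<close> that in auto)
    then have "\<bar>(exp (- s * (y - x)) - 1) * expconv s u x\<bar> \<le> (y - x) * B"
      using \<open>s > 0\<close> by (simp add: abs_mult)
    moreover have "expconv s u y - expconv s u x = (exp (- s * (y - x)) - 1) * expconv s u x +
        (\<integral>w. indicator {x..y} w * (exp (- s * (y - w)) * u w) \<partial>lborel)"
      using expconv_shift(1)[OF assms that] by (simp add: algebra_simps)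
    ultimately show ?thesis using 1 by (simp add: algebra_simps)
  qed
  show ?thesis
    using *[of x y] *[of y x] by (cases "x \<le> y") (auto simp: abs_minus_commute)
qed

lemma indicator_integral_Icc:
  fixes f :: "real \<Rightarrow> real"
  assumes "integrable lborel (\<lambda>w. indicator {x..y} w * f w)"
  shows "(\<integral>w. indicator {x..y} w * f w \<partial>lborel) = integral {x..y} f"
  using set_borel_integral_eq_integral(2)[of "{x..y}" f] assms
  by (simp add: set_lebesgue_integral_def set_integrable_def)

lemma expconv_has_derivative:
  assumes s: "s > 0" and cont: "continuous_on UNIV u" and B: "\<And>z. \<bar>u z\<bar> \<le> B"
  shows "(expconv s u has_real_derivative u x - s * expconv s u x) (at x)"
proof -
  have [measurable]: "u \<in> borel_measurable borel"
    using cont by (rule borel_measurable_continuous_onI)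
  define a where "a = x - 1"
  define G where "G y = integral {a..y} (\<lambda>w. exp (s * (w - a)) * u w)" for y
  have eq: "expconv s u y = exp (- s * (y - a)) * (expconv s u a + G y)" if "a \<le> y" for y
  proof -
    have "expconv s u y = exp (- s * (y - a)) * expconv s u a + integral {a..y} (\<lambda>w. exp (- s * (y - w)) * u w)"
      using expconv_shift[OF s _ B that] by (simp add: indicator_integral_Icc)
    also have "integral {a..y} (\<lambda>w. exp (- s * (y - w)) * u w)
       = integral {a..y} (\<lambda>w. exp (- s * (y - a)) * (exp (s * (w - a)) * u w))"
      by (intro integral_cong) (simp add: exp_add[symmetric] algebra_simps)
    also have "\<dots> = exp (- s * (y - a)) * G y" unfolding G_def by (rule integral_mult_right)
    finally show ?thesis by (simp add: algebra_simps)
  qed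
  have "(G has_real_derivative exp (s * (x - a)) * u x) (at x within {a..x+1})"
    unfolding G_def
    by (rule integral_has_real_derivative)
       (auto simp: a_def intro!: continuous_intros continuous_on_subset[OF cont])
  then have G': "(G has_real_derivative exp (s * (x - a)) * u x) (at x)"
    by (simp add: at_within_Icc_at a_def)
  have "((\<lambda>y. exp (- s * (y - a)) * (expconv s u a + G y)) has_real_derivative
          exp (- s * (x - a)) * (exp (s * (x - a)) * u x)
          + (- s * exp (- s * (x - a))) * (expconv s u a + G x)) (at x)"
    by (rule derivative_eq_intros G' refl | simp)+
  also have "exp (- s * (x - a)) * (exp (s * (x - a)) * u x)
          + (- s * exp (- s * (x - a))) * (expconv s u a + G x) = u x - s * expconv s u x"
    using eq[of x] by (simp add: a_def exp_minus field_simps)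
  finally show ?thesis
  proof (rule has_field_derivative_transform_within_open)
    show "open {a<..}" "x \<in> {a<..}" by (auto simp: a_def)
    show "exp (- s * (y - a)) * (expconv s u a + G y) = expconv s u y" if "y \<in> {a<..}" for y
      using eq[of y] that by simp
  qed
qed

section \<open>Even periodic functions increasing on a half period\<close>

definition circ_dist :: "real \<Rightarrow> real" where
  "circ_dist x = \<bar>x - 2 * pi * round (x / (2 * pi))\<bar>"

lemma circ_dist_range: "0 \<le> circ_dist x" "circ_dist x \<le> pi"
proof -
  have "\<bar>x - 2 * pi * round (x / (2 * pi))\<bar> = 2 * pi * \<bar>of_int (round (x / (2 * pi))) - x / (2 * pi)\<bar>"
    by (subst abs_minus_commute) (simp add: abs_mult_pos[symmetric] field_simps flip: abs_mult)
  also have "\<dots> \<le> 2 * pi * (1 / 2)"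
    by (intro mult_left_mono of_int_round_abs_le) auto
  finally show "circ_dist x \<le> pi" by (simp add: circ_dist_def)
qed (simp add: circ_dist_def)

lemma circ_dist_le: "circ_dist x \<le> \<bar>x - 2 * pi * of_int k\<bar>"
proof -
  have "2 * pi * \<bar>x / (2 * pi) - of_int (round (x / (2 * pi)))\<bar> \<le> 2 * pi * \<bar>x / (2 * pi) - of_int k\<bar>"
    by (intro mult_left_mono round_diff_minimal) auto
  moreover have "2 * pi * \<bar>x / (2 * pi) - a\<bar> = \<bar>x - 2 * pi * a\<bar>" for a
    by (simp add: abs_mult_pos[symmetric] field_simps flip: abs_mult)
  ultimately show ?thesis by (simp add: circ_dist_def)
qed

lemma circ_dist_lipschitz: "\<bar>circ_dist x - circ_dist y\<bar> \<le> \<bar>x - y\<bar>"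
proof -
  have "circ_dist x \<le> \<bar>x - y\<bar> + circ_dist y" for x y
    using circ_dist_le[of x "round (y / (2 * pi))"] unfolding circ_dist_def by linarith
  from this[of x y] this[of y x] show ?thesis by linarith
qed

lemma periodic_int:
  fixes u :: "real \<Rightarrow> 'a"
  assumes "\<And>x. u (x + 2 * pi) = u x"
  shows "u (x + 2 * pi * of_int k) = u x"
proof -
  have *: "u (x + 2 * pi * real n) = u x" for x n
  proof (induction n)
    case (Suc n)
    then show ?case using assms[of "x + 2 * pi * real n"] by (simp add: algebra_simps)
  qed simp
  show ?thesis
  proof (cases k)
    case (nonneg n) then show ?thesis using * by simp
  next
    case (neg n)
    have "x + 2 * pi * of_int k + 2 * pi * real (Suc n) = x"
      unfolding neg by (simp add: algebra_simps)
    then show ?thesis using *[of "x + 2 * pi * of_int k" "Suc n"] by metis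
  qed
qed

lemma circ_dist_fold:
  fixes u :: "real \<Rightarrow> 'a"
  assumes "\<And>x. u (x + 2 * pi) = u x" "\<And>x. u (- x) = u x"
  shows "u (circ_dist x) = u x"
proof -
  have "u (x - 2 * pi * of_int (round (x / (2 * pi)))) = u x"
    using periodic_int[of u x "- round (x / (2 * pi))", OF assms(1)] by simp
  then show ?thesis
    using assms(2)[of "x - 2 * pi * of_int (round (x / (2 * pi)))"]
    by (cases "0 \<le> x - 2 * pi * of_int (round (x / (2 * pi)))") (auto simp: circ_dist_def abs_if)
qed

definition wave :: "(real \<Rightarrow> real) \<Rightarrow> bool" where
  "wave u \<longleftrightarrow> continuous_on UNIV u \<and> (\<forall>x. u (x + 2 * pi) = u x) \<and> (\<forall>x. u (- x) = u x) \<and> mono_on {0..pi} u"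

lemma waveD:
  assumes "wave u"
  shows "continuous_on UNIV u" "u (x + 2 * pi) = u x" "u (- x) = u x"
    "0 \<le> x \<Longrightarrow> x \<le> y \<Longrightarrow> y \<le> pi \<Longrightarrow> u x \<le> u y" "u (circ_dist x) = u x"
    "u \<in> borel_measurable borel" "u 0 \<le> u x" "u x \<le> u pi" "\<bar>u x\<bar> \<le> \<bar>u 0\<bar> + \<bar>u pi\<bar>"
proof -
  show cont: "continuous_on UNIV u" and "u (x + 2 * pi) = u x" and "u (- x) = u x"
    using assms by (auto simp: wave_def)
  show mono: "0 \<le> x \<Longrightarrow> x \<le> y \<Longrightarrow> y \<le> pi \<Longrightarrow> u x \<le> u y" for x y
    using assms by (auto simp: wave_def mono_on_def)
  show fold: "u (circ_dist x) = u x"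
    using assms by (intro circ_dist_fold) (auto simp: wave_def)
  show "u \<in> borel_measurable borel"
    using cont by (rule borel_measurable_continuous_onI)
  show "u 0 \<le> u x" "u x \<le> u pi"
    using mono[of 0 "circ_dist x"] mono[of "circ_dist x" pi] circ_dist_range[of x] fold by auto
  then show "\<bar>u x\<bar> \<le> \<bar>u 0\<bar> + \<bar>u pi\<bar>" by linarith
qed

definition expsum :: "real \<Rightarrow> (real \<Rightarrow> real) \<Rightarrow> real \<Rightarrow> real" where
  "expsum s u x = expconv s u x + expconv s (\<lambda>y. u (- y)) (- x)"

definition expdiff :: "real \<Rightarrow> (real \<Rightarrow> real) \<Rightarrow> real \<Rightarrow> real" where
  "expdiff s u x = s * (expconv s (\<lambda>y. u (- y)) (- x) - expconv s u x)"

lemma expsum_has_derivative: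
  assumes s: "s > 0" and cont: "continuous_on UNIV u" and B: "\<And>z. \<bar>u z\<bar> \<le> B"
  shows "(expsum s u has_real_derivative expdiff s u x) (at x)"
proof -
  have c: "continuous_on UNIV (\<lambda>y. u (- y))"
    using cont by (intro continuous_on_compose2[OF cont] continuous_intros) auto
  show ?thesis unfolding expsum_def[abs_def] expdiff_def
    by (rule DERIV_cong, rule DERIV_add[OF expconv_has_derivative[OF assms]
          DERIV_chain2[OF expconv_has_derivative[OF s c B] DERIV_minus[OF DERIV_ident]]])
       (simp add: algebra_simps)
qed

lemma expdiff_abs_le:
  assumes "s > 0" and [measurable]: "u \<in> borel_measurable borel" and "\<And>z. \<bar>u z\<bar> \<le> B"
  shows "\<bar>expdiff s u x\<bar> \<le> 2 * B"
proof -
  have "\<bar>expconv s u x\<bar> \<le> B / s" by (intro expconv_abs_le assms)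
  moreover have "\<bar>expconv s (\<lambda>y. u (- y)) (- x)\<bar> \<le> B / s" by (intro expconv_abs_le) (use assms in auto)
  ultimately have "\<bar>expconv s (\<lambda>y. u (- y)) (- x) - expconv s u x\<bar> \<le> 2 * B / s" by linarith
  then have "s * \<bar>expconv s (\<lambda>y. u (- y)) (- x) - expconv s u x\<bar> \<le> s * (2 * B / s)"
    using \<open>s > 0\<close> by (intro mult_left_mono) auto
  then show ?thesis using \<open>s > 0\<close> by (simp add: expdiff_def abs_mult)
qed

lemma expconv_const: "s > 0 \<Longrightarrow> expconv s (\<lambda>y. c) x = c / s"
  using integral_expker[of s] integrable_expker[of s] by (simp add: expconv_def)

lemma expdiff_growth:
  assumes s: "s \<ge> 1" and [measurable]: "u \<in> borel_measurable borel" and B: "\<And>z. \<bar>u z\<bar> \<le> B"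
    and even: "\<And>z. u (- z) = u z" and M: "0 \<le> M" "0 \<le> \<epsilon>" "\<And>y. \<bar>u y\<bar> \<le> M * (\<bar>y\<bar> + \<epsilon>)" and x: "0 \<le> x"
  shows "\<bar>expdiff s u x\<bar> \<le> 4 * M * (x + \<epsilon>)"
proof -
  have s0: "s > 0" using s by simp
  define q where "q = exp (- s * (2 * x))"
  define Q where "Q = expconv s u (- x)"
  define R where "R = (\<integral>w. indicator {-x..x} w * (exp (- s * (x - w)) * u w) \<partial>lborel)"
  have P: "expconv s u x = q * Q + R"
    using expconv_shift(1)[where u = u and x = "- x" and y = x, OF s0 _ B] x by (simp add: q_def Q_def R_def)
  have "1 - s * (2 * x) \<le> q" using exp_ge_add_one_self[of "- s * (2 * x)"] by (simp add: q_def)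
  moreover have q01: "q \<le> 1" "q > 0" using s0 x by (simp_all add: q_def)
  ultimately have q: "\<bar>1 - q\<bar> \<le> s * (2 * x)" "\<bar>1 - q\<bar> \<le> 1" by linarith+
  have "norm (\<integral>z. expker s z * u (- x - z) \<partial>lborel)
      \<le> (\<integral>z. M * (x + \<epsilon>) * expker s z + M * (expker s z * z) \<partial>lborel)"
  proof (rule norm_integral_le_integral)
    show "integrable lborel (\<lambda>z. expker s z * u (- x - z))"
      by (rule expker_mult_bounded_integrable[OF s0 _ , of _ B]) (use B in auto)
    fix z :: real
    show "norm (expker s z * u (- x - z)) \<le> M * (x + \<epsilon>) * expker s z + M * (expker s z * z)"
    proof (cases "z \<ge> 0")
      case True
      have "\<bar>u (- x - z)\<bar> \<le> M * (x + z + \<epsilon>)" using M(3)[of "- x - z"] x True by (simp add: add.commute)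
      then have "expker s z * \<bar>u (- x - z)\<bar> \<le> expker s z * (M * (x + z + \<epsilon>))"
        by (intro mult_left_mono) auto
      then show ?thesis by (simp add: abs_mult algebra_simps)
    qed (simp add: expker_def)
  qed (use integrable_expker[OF s0] integrable_expker_times[OF s0] in auto)
  also have "\<dots> = M * (x + \<epsilon>) * (1 / s) + M * (1 / s\<^sup>2)"
    using integrable_expker[OF s0] integrable_expker_times[OF s0] integral_expker[OF s0] integral_expker_times[OF s0]
    by (subst Bochner_Integration.integral_add) auto
  finally have Q: "\<bar>Q\<bar> \<le> M * (x + \<epsilon>) * (1 / s) + M * (1 / s\<^sup>2)"
    by (simp add: Q_def expconv_def)
  have R1: "(\<integral>w. indicator {-x..x} w * exp (- s * (x - w)) \<partial>lborel) = (1 - q) / s"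
    using expconv_shift(1)[OF s0, of "\<lambda>_. 1" 1 "- x" x, simplified] x s0
    by (simp add: q_def expconv_const field_simps)
  have "norm R \<le> (\<integral>w. M * (x + \<epsilon>) * (indicator {-x..x} w * exp (- s * (x - w))) \<partial>lborel)"
    unfolding R_def
  proof (rule norm_integral_le_integral)
    show "integrable lborel (\<lambda>w. indicator {-x..x} w * (exp (- s * (x - w)) * u w))"
      by (rule expconv_shift(2)[OF s0 _ B]) (use x in auto)
    show "integrable lborel (\<lambda>w. M * (x + \<epsilon>) * (indicator {-x..x} w * exp (- s * (x - w))))"
      using expconv_shift(2)[OF s0, of "\<lambda>_. 1" 1 "-x" x, simplified] x by auto
    fix w :: real
    have "\<bar>u w\<bar> \<le> M * (x + \<epsilon>)" if "w \<in> {-x..x}"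
    proof -
      have "\<bar>u w\<bar> \<le> M * (\<bar>w\<bar> + \<epsilon>)" by (rule M(3))
      also have "\<dots> \<le> M * (x + \<epsilon>)" using M(1) that by (intro mult_left_mono) auto
      finally show ?thesis .
    qed
    then show "norm (indicator {-x..x} w * (exp (- s * (x - w)) * u w))
        \<le> M * (x + \<epsilon>) * (indicator {-x..x} w * exp (- s * (x - w)))"
      by (auto simp: abs_mult mult.commute split: split_indicator)
  qed
  also have "\<dots> = M * (x + \<epsilon>) * ((1 - q) / s)" by (simp only: integral_mult_right_zero R1)
  also have "\<dots> \<le> M * (x + \<epsilon>) * (1 / s)"
    using q01 s0 M x by (intro mult_left_mono divide_right_mono) auto
  finally have R: "\<bar>R\<bar> \<le> M * (x + \<epsilon>) * (1 / s)" by simp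
  have "\<bar>(1 - q) * Q\<bar> \<le> \<bar>1 - q\<bar> * (M * (x + \<epsilon>) * (1 / s)) + \<bar>1 - q\<bar> * (M * (1 / s\<^sup>2))"
    using mult_left_mono[OF Q, of "\<bar>1 - q\<bar>"] unfolding abs_mult by (simp add: algebra_simps)
  also have "\<dots> \<le> 1 * (M * (x + \<epsilon>) * (1 / s)) + (s * (2 * x)) * (M * (1 / s\<^sup>2))"
    using q M x s0 by (intro add_mono mult_right_mono) auto
  also have "\<dots> = (M * (x + \<epsilon>) + 2 * M * x) / s"
    using s0 by (simp add: field_simps power2_eq_square)
  finally have "\<bar>(1 - q) * Q - R\<bar> \<le> (M * (x + \<epsilon>) + 2 * M * x) / s + M * (x + \<epsilon>) / s"
    using R by simp
  also have "\<dots> = (4 * M * x + 2 * M * \<epsilon>) / s"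
    by (simp add: add_divide_distrib[symmetric] algebra_simps)
  finally have "s * \<bar>(1 - q) * Q - R\<bar> \<le> 4 * M * x + 2 * M * \<epsilon>"
    using s0 by (simp add: field_simps)
  moreover have "expdiff s u x = s * ((1 - q) * Q - R)"
    by (simp add: expdiff_def even P Q_def[symmetric]) (simp add: algebra_simps)
  moreover have "0 \<le> M * \<epsilon>" using M by simp
  ultimately have "\<bar>expdiff s u x\<bar> \<le> 4 * M * x + 2 * M * \<epsilon>" using s0 by (simp add: abs_mult)
  also have "\<dots> \<le> 4 * M * (x + \<epsilon>)" using \<open>0 \<le> M * \<epsilon>\<close> by (simp add: algebra_simps)
  finally show ?thesis .
qed

lemma integral_reflect_about:
  fixes f :: "real \<Rightarrow> real"
  shows "integral {a..b} (\<lambda>z. f (c - z)) = integral {c - b..c - a} f"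
proof -
  have "integral {a..b} (\<lambda>z. f (c - z)) = integral {-b..-a} (\<lambda>z. f (z + c))"
    using Henstock_Kurzweil_Integration.integral_reflect_real[of "- a" "- b" "\<lambda>z. f (z + c)"] by (simp add: algebra_simps)
  also have "\<dots> = integral {c - b..c - a} f"
    using integral_shift_real_ivl[of "c - b" c "c - a" f] by simp
  finally show ?thesis .
qed

definition wave_diff :: "(real \<Rightarrow> real) \<Rightarrow> real \<Rightarrow> real \<Rightarrow> real" where
  "wave_diff u x z = u (x + z) - u (x - z)"

lemma wave_diff_nonneg:
  assumes "wave u" "0 \<le> x" "x \<le> pi" "0 \<le> z" "z \<le> pi"
  shows "0 \<le> wave_diff u x z"
proof -
  have 1: "u (x - z) = u \<bar>x - z\<bar>" using waveD(3)[OF assms(1), of "x - z"] by (auto simp: abs_if)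
  show ?thesis
  proof (cases "x + z \<le> pi")
    case True
    then show ?thesis using waveD(4)[OF assms(1), of "\<bar>x - z\<bar>" "x + z"] 1 assms by (auto simp: wave_diff_def)
  next
    case False
    have "u (x + z) = u (2 * pi - (x + z))"
      using waveD(2)[OF assms(1), of "- (x + z)"] waveD(3)[OF assms(1), of "x + z"] by (simp add: algebra_simps)
    then show ?thesis using waveD(4)[OF assms(1), of "\<bar>x - z\<bar>" "2 * pi - (x + z)"] 1 assms False
      by (auto simp: wave_diff_def abs_if split: if_splits)
  qed
qed

lemma wave_diff_continuous:
  "wave u \<Longrightarrow> continuous_on A (wave_diff u x)"
  unfolding wave_diff_def
  by (intro continuous_intros continuous_on_compose2[OF waveD(1), of u A]) auto

lemma wave_diff_reflect:
  "wave u \<Longrightarrow> wave_diff u x (2 * pi - z) = - wave_diff u x z"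
  using waveD(2)[of u "x - z"] waveD(2)[of u "x + z - 2 * pi"]
  by (simp add: wave_diff_def algebra_simps)

definition wave_weight :: "real \<Rightarrow> real \<Rightarrow> real" where
  "wave_weight s z = exp (- s * z) - exp (- s * (2 * pi - z))"

text \<open>
  Since \<open>z \<mapsto> u (x + z) - u (x - z)\<close> is odd and \<open>2\<pi>\<close>-periodic, its Laplace transform is the integral
  over one period divided by \<open>1 - exp (- 2 \<pi> s)\<close>, and the two halves of the period are
  reflections of each other.
\<close>

lemma expdiff_ge:
  assumes s: "s > 0" and u: "wave u" and x: "0 \<le> x" "x \<le> pi"
  shows "expdiff s u x \<ge> s * integral {0..pi} (\<lambda>z. wave_weight s z * wave_diff u x z)"
    and "0 \<le> integral {0..pi} (\<lambda>z. wave_weight s z * wave_diff u x z)"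
proof -
  let ?d = "wave_diff u x"
  define v where "v w = ?d (- w)" for w
  define J where "J = integral {0..pi} (\<lambda>z. wave_weight s z * ?d z)"
  define B where "B = \<bar>u 0\<bar> + \<bar>u pi\<bar>"
  have cd: "continuous_on A ?d" for A by (rule wave_diff_continuous[OF u])
  then have [measurable]: "?d \<in> borel_measurable borel" by (rule borel_measurable_continuous_onI)
  have [measurable]: "u \<in> borel_measurable borel" by (rule waveD(6)[OF u])
  have uB: "\<bar>u z\<bar> \<le> B" for z unfolding B_def by (rule waveD(9)[OF u])
  have vB: "\<bar>v z\<bar> \<le> 2 * B" for z using uB[of "x - z"] uB[of "x + z"] by (simp add: v_def wave_diff_def)
  have [measurable]: "v \<in> borel_measurable borel" unfolding v_def by measurable
  define I where "I = expconv s v 0"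
  have "v (- 2 * pi - z) = v (- z)" for z
    using waveD(2)[OF u, of "x + z"] waveD(2)[OF u, of "x - z - 2 * pi"]
    by (simp add: v_def wave_diff_def algebra_simps)
  then have per: "expconv s v (- 2 * pi) = I" by (simp add: I_def expconv_def)
  have int1: "expdiff s u x = s * I"
  proof -
    have "I = (\<integral>z. expker s z * u (x + z) - expker s z * u (x - z) \<partial>lborel)"
      by (simp add: I_def expconv_def v_def wave_diff_def algebra_simps)
    also have "\<dots> = (\<integral>z. expker s z * u (x + z) \<partial>lborel) - (\<integral>z. expker s z * u (x - z) \<partial>lborel)"
      by (intro Bochner_Integration.integral_diff expker_mult_bounded_integrable[OF s, of _ B]) (use uB in auto)
    finally show ?thesis by (simp add: expdiff_def expconv_def add.commute)
  qed
  have "I = exp (- s * (2 * pi)) * I + integral {-2 * pi..0} (\<lambda>w. exp (- s * (0 - w)) * v w)"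
    using expconv_shift[where u = v and x = "-2 * pi" and y = 0, OF s _ vB] unfolding I_def[symmetric] per
    by (simp add: indicator_integral_Icc)
  also have "integral {-2 * pi..0} (\<lambda>w. exp (- s * (0 - w)) * v w) = integral {0..2 * pi} (\<lambda>z. exp (- s * z) * ?d z)"
    using Henstock_Kurzweil_Integration.integral_reflect_real[of "2 * pi" 0 "\<lambda>z. exp (- s * z) * ?d z"] by (simp add: v_def)
  also have "\<dots> = integral {0..pi} (\<lambda>z. exp (- s * z) * ?d z) + integral {pi..2 * pi} (\<lambda>z. exp (- s * z) * ?d z)"
    by (rule Henstock_Kurzweil_Integration.integral_combine[symmetric])
       (auto intro!: integrable_continuous_real continuous_intros cd)
  also have "integral {pi..2 * pi} (\<lambda>z. exp (- s * z) * ?d z)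
      = integral {0..pi} (\<lambda>z. exp (- s * (2 * pi - z)) * ?d (2 * pi - z))"
    using integral_reflect_about[of 0 pi "\<lambda>z. exp (- s * z) * ?d z" "2 * pi"] by simp
  also have "\<dots> = - integral {0..pi} (\<lambda>z. exp (- s * (2 * pi - z)) * ?d z)"
    by (simp add: wave_diff_reflect[OF u])
  also have "integral {0..pi} (\<lambda>z. exp (- s * z) * ?d z) + - integral {0..pi} (\<lambda>z. exp (- s * (2 * pi - z)) * ?d z) = J"
    unfolding J_def wave_weight_def left_diff_distrib
    by (subst Henstock_Kurzweil_Integration.integral_diff) (auto intro!: integrable_continuous_real continuous_intros cd)
  finally have IJ: "I = exp (- s * (2 * pi)) * I + J" .
  show J0: "0 \<le> integral {0..pi} (\<lambda>z. wave_weight s z * ?d z)"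
  proof (rule Henstock_Kurzweil_Integration.integral_nonneg)
    show "(\<lambda>z. wave_weight s z * ?d z) integrable_on {0..pi}"
      unfolding wave_weight_def by (intro integrable_continuous_real continuous_intros cd)
    show "0 \<le> wave_weight s z * ?d z" if "z \<in> {0..pi}" for z
      using wave_diff_nonneg[OF u x, of z] that s by (auto simp: wave_weight_def)
  qed
  have "exp (- s * (2 * pi)) < 1" using s by simp
  moreover have "(1 - exp (- s * (2 * pi))) * I = J" using IJ by (simp add: algebra_simps)
  ultimately have "I \<ge> 0" using J0 by (smt (verit) J_def mult_pos_neg)
  then have "I \<ge> J" using IJ by (smt (verit) exp_gt_zero mult_nonneg_nonneg)
  then show "expdiff s u x \<ge> s * integral {0..pi} (\<lambda>z. wave_weight s z * ?d z)"
    using s unfolding int1 J_def by simp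
qed

lemma wave_diff_pos_somewhere:
  assumes u: "wave u" and ne: "u 0 \<noteq> u pi" and x: "0 < x" "x < pi"
  shows "\<exists>z\<in>{0<..<pi}. 0 < wave_diff u x z"
proof (rule ccontr)
  assume neg: "\<not> ?thesis"
  have d0: "u (x + z) = u \<bar>x - z\<bar>" if "0 < z" "z < pi" for z
  proof -
    have "wave_diff u x z = 0"
    proof (rule antisym)
      show "wave_diff u x z \<le> 0" using neg that by (meson greaterThanLessThan_iff not_less)
    qed (use wave_diff_nonneg[OF u, of x z] x that in auto)
    then show ?thesis using waveD(3)[OF u, of "x - z"] by (auto simp: wave_diff_def abs_if)
  qed
  define E where "E = {0..pi} \<inter> u -` {u 0}"
  have "compact E"
    unfolding E_def
    by (intro compact_Int_closed compact_Icc continuous_closed_vimage)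
       (use waveD(1)[OF u] in \<open>auto simp: continuous_on_eq_continuous_at\<close>)
  moreover have "0 \<in> E" by (simp add: E_def)
  ultimately obtain p where p: "p \<in> E" "\<And>y. y \<in> E \<Longrightarrow> y \<le> p"
    using compact_attains_sup[of E] by blast
  have low: "u y = u 0" if "0 \<le> y" "y \<le> p" for y
    using waveD(4)[OF u, of 0 y] waveD(4)[OF u, of y p] p(1) that by (auto simp: E_def)
  have p_lt: "p < pi" using p(1) ne by (auto simp: E_def order_less_le)
  have high: "u y \<noteq> u 0" if "p < y" "y \<le> pi" for y
    using p(2)[of y] p(1) that by (auto simp: E_def)
  have p0: "0 \<le> p" using p(1) by (simp add: E_def)
  show False
  proof (cases "p < x")
    case True
    have "u (2 * x - p) = u 0" using d0[of "x - p"] True x p0 low[of p] by simp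
    moreover have "u (2 * x - p) = u (2 * pi - (2 * x - p))"
      using waveD(2)[OF u, of "- (2 * x - p)"] waveD(3)[OF u, of "2 * x - p"] by (simp add: algebra_simps)
    ultimately show False
      using high[of "2 * x - p"] high[of "2 * pi - (2 * x - p)"] True x p_lt by (cases "2 * x - p \<le> pi") auto
  next
    case False
    define e where "e = min (2 * x) (pi - p)"
    have e: "0 < e" "e \<le> 2 * x" "e \<le> pi - p" using x p_lt by (auto simp: e_def)
    have "u (p + e) = u \<bar>2 * x - p - e\<bar>"
      using d0[of "p - x + e"] e x False by (simp add: algebra_simps)
    also have "\<dots> = u 0" by (rule low) (use e x False p0 in auto)
    finally show False using high[of "p + e"] e by simp
  qed
qed

lemma expdiff_pos:
  assumes s: "s > 0" and u: "wave u" and ne: "u 0 \<noteq> u pi" and x: "0 < x" "x < pi"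
  shows "0 < expdiff s u x"
proof -
  let ?g = "\<lambda>z. wave_weight s z * wave_diff u x z"
  have cont: "continuous_on {0..pi} ?g"
    unfolding wave_weight_def by (intro continuous_intros wave_diff_continuous u)
  have nn: "0 \<le> ?g z" if "z \<in> {0..pi}" for z
    using wave_diff_nonneg[OF u, of x z] that s x by (auto simp: wave_weight_def)
  obtain z where z: "z \<in> {0<..<pi}" "0 < wave_diff u x z"
    using wave_diff_pos_somewhere[OF u ne x] by blast
  have "0 < ?g z" using z s by (intro mult_pos_pos) (auto simp: wave_weight_def)
  have "integral {0..pi} ?g \<noteq> 0"
  proof
    assume "integral {0..pi} ?g = 0"
    then have "(?g has_integral 0) (cbox 0 pi)"
      using integrable_integral[OF integrable_continuous_real[OF cont]] by simp
    then have "?g z = 0"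
      by (rule has_integral_0_cbox_imp_0[rotated 2]) (use cont nn z in auto)
    with \<open>0 < ?g z\<close> show False by simp
  qed
  with expdiff_ge[OF s u, of x] x s show ?thesis
    by (smt (verit) mult_pos_pos)
qed

lemma expdiff_lower_bound:
  assumes s: "s > 0" and u: "wave u" and \<eta>: "0 < \<eta>" "\<eta> \<le> pi / 4" and x: "0 \<le> x" "x \<le> \<eta>"
  shows "expdiff s u x \<ge> s * wave_weight s (pi - \<eta>) * (2 * (u (pi - 2 * \<eta>) - u (2 * \<eta>)) * x)"
proof -
  let ?d = "wave_diff u x" and ?k = "wave_weight s (pi - \<eta>)"
  have cu: "continuous_on A u" for A using waveD(1)[OF u] by (rule continuous_on_subset) auto
  have cd: "continuous_on A ?d" for A by (rule wave_diff_continuous[OF u])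
  have cg: "continuous_on A (\<lambda>z. wave_weight s z * ?d z)" for A
    unfolding wave_weight_def by (intro continuous_intros cd)
  have iu: "u integrable_on {a..b}" for a b by (intro integrable_continuous_real cu)
  have k0: "0 \<le> ?k" using s \<eta> by (auto simp: wave_weight_def)
  have iux: "(\<lambda>z. u (z + c)) integrable_on {a..b}" for a b c
    by (intro integrable_continuous_real continuous_on_compose2[OF cu[of UNIV]] continuous_intros) auto
  have "integral {\<eta>..pi - \<eta>} ?d = integral {\<eta>..pi - \<eta>} (\<lambda>z. u (z + x) - u (z + - x))"
    using waveD(3)[OF u, of "x - z" for z] by (intro integral_cong) (simp add: wave_diff_def add.commute)
  also have "\<dots> = integral {\<eta>..pi - \<eta>} (\<lambda>z. u (z + x)) - integral {\<eta>..pi - \<eta>} (\<lambda>z. u (z + - x))"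
    by (rule Henstock_Kurzweil_Integration.integral_diff[OF iux iux])
  also have "\<dots> = integral {\<eta> + x..pi - \<eta> + x} u - integral {\<eta> - x..pi - \<eta> - x} u"
    using integral_shift_real_ivl[of "\<eta> + x" x "pi - \<eta> + x" u] integral_shift_real_ivl[of "\<eta> - x" "-x" "pi - \<eta> - x" u]
    by simp
  also have "\<dots> = integral {pi - \<eta> - x..pi - \<eta> + x} u - integral {\<eta> - x..\<eta> + x} u"
  proof -
    have "integral {\<eta> - x..\<eta> + x} u + integral {\<eta> + x..pi - \<eta> + x} u = integral {\<eta> - x..pi - \<eta> + x} u"
      by (rule Henstock_Kurzweil_Integration.integral_combine) (use x \<eta> iu in auto)
    moreover have "integral {\<eta> - x..pi - \<eta> - x} u + integral {pi - \<eta> - x..pi - \<eta> + x} u = integral {\<eta> - x..pi - \<eta> + x} u"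
      by (rule Henstock_Kurzweil_Integration.integral_combine) (use x \<eta> iu in auto)
    ultimately show ?thesis by linarith
  qed
  finally have eq: "integral {\<eta>..pi - \<eta>} ?d = integral {pi - \<eta> - x..pi - \<eta> + x} u - integral {\<eta> - x..\<eta> + x} u" .
  have d: "integral {\<eta>..pi - \<eta>} ?d \<ge> 2 * (u (pi - 2 * \<eta>) - u (2 * \<eta>)) * x"
  proof -
    have "integral {pi - \<eta> - x..pi - \<eta> + x} (\<lambda>_. u (pi - 2 * \<eta>)) \<le> integral {pi - \<eta> - x..pi - \<eta> + x} u"
      by (rule integral_le) (use x \<eta> iu in \<open>auto intro!: waveD(4)[OF u]\<close>)
    moreover have "integral {\<eta> - x..\<eta> + x} u \<le> integral {\<eta> - x..\<eta> + x} (\<lambda>_. u (2 * \<eta>))"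
      by (rule integral_le) (use x \<eta> iu in \<open>auto intro!: waveD(4)[OF u]\<close>)
    ultimately show ?thesis using x unfolding eq by (simp add: algebra_simps)
  qed
  have "?k * (2 * (u (pi - 2 * \<eta>) - u (2 * \<eta>)) * x) \<le> ?k * integral {\<eta>..pi - \<eta>} ?d"
    by (rule mult_left_mono[OF d k0])
  also have "\<dots> = integral {\<eta>..pi - \<eta>} (\<lambda>z. ?k * ?d z)" by (rule integral_mult_right[symmetric])
  also have "\<dots> \<le> integral {\<eta>..pi - \<eta>} (\<lambda>z. wave_weight s z * ?d z)"
  proof (rule integral_le)
    fix z assume z: "z \<in> {\<eta>..pi - \<eta>}"
    have "exp (- s * (pi - \<eta>)) \<le> exp (- s * z)" "exp (- s * (2 * pi - z)) \<le> exp (- s * (pi + \<eta>))"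
      using z s by auto
    moreover have "2 * pi - (pi - \<eta>) = pi + \<eta>" by simp
    ultimately have "?k \<le> wave_weight s z" unfolding wave_weight_def by argo
    then show "?k * ?d z \<le> wave_weight s z * ?d z"
      by (rule mult_right_mono) (use wave_diff_nonneg[OF u, of x z] x z \<eta> in auto)
  qed (intro integrable_continuous_real cg continuous_intros cd)+
  also have "\<dots> \<le> integral {0..pi} (\<lambda>z. wave_weight s z * ?d z)"
  proof (rule integral_subset_le)
    show "\<forall>z\<in>{0..pi}. 0 \<le> wave_weight s z * ?d z"
      using wave_diff_nonneg[OF u, of x] s x \<eta> by (auto simp: wave_weight_def)
  qed (use \<eta> in \<open>auto intro!: integrable_continuous_real cg\<close>)
  finally have "s * (?k * (2 * (u (pi - 2 * \<eta>) - u (2 * \<eta>)) * x)) \<le> s * integral {0..pi} (\<lambda>z. wave_weight s z * ?d z)"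
    using s by (intro mult_left_mono) auto
  also have "\<dots> \<le> expdiff s u x"
    by (rule expdiff_ge(1)[OF s u]) (use x \<eta> in auto)
  finally show ?thesis by (simp add: mult.assoc)
qed

section \<open>Smoothing operators and solutions\<close>

definition bdd_borel :: "(real \<Rightarrow> real) \<Rightarrow> real \<Rightarrow> bool" where
  "bdd_borel u B \<longleftrightarrow> u \<in> borel_measurable borel \<and> (\<forall>x. \<bar>u x\<bar> \<le> B)"

lemma bdd_borelD:
  assumes "bdd_borel u B"
  shows "u \<in> borel_measurable borel" "\<bar>u x\<bar> \<le> B" "0 \<le> B"
  using assms unfolding bdd_borel_def by (force intro: order_trans[OF abs_ge_zero])+

lemma wave_bdd_borel: "wave u \<Longrightarrow> bdd_borel u (\<bar>u 0\<bar> + \<bar>u pi\<bar>)"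
  by (simp add: bdd_borel_def waveD)

lemma bdd_borel_const: "bdd_borel (\<lambda>x. c) \<bar>c\<bar>"
  by (simp add: bdd_borel_def)

lemma bdd_borel_lincomb:
  "bdd_borel u B \<Longrightarrow> bdd_borel v B' \<Longrightarrow> bdd_borel (\<lambda>x. a * u x + b * v x) (\<bar>a\<bar> * B + \<bar>b\<bar> * B')"
  unfolding bdd_borel_def
  by (auto intro!: order_trans[OF abs_triangle_ineq] add_mono mult_left_mono simp: abs_mult)

lemma bdd_borel_reflect: "bdd_borel u B \<Longrightarrow> bdd_borel (\<lambda>y. u (- y)) B"
  by (auto simp: bdd_borel_def)

text \<open>
  In \<open>growth\<close> the constant \<open>D\<close> may depend on \<open>u\<close>; this makes the class closed under composition.
\<close>

locale smoothing_operator =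
  fixes T :: "(real \<Rightarrow> real) \<Rightarrow> real \<Rightarrow> real" and C :: real
  assumes C_nonneg: "0 \<le> C"
    and linear: "bdd_borel u B \<Longrightarrow> bdd_borel v B' \<Longrightarrow> T (\<lambda>x. a * u x + b * v x) x = a * T u x + b * T v x"
    and translation: "bdd_borel u B \<Longrightarrow> T (\<lambda>x. u (x + d)) x = T u (x + d)"
    and reflection: "bdd_borel u B \<Longrightarrow> T (\<lambda>x. u (- x)) x = T u (- x)"
    and bound: "bdd_borel u B \<Longrightarrow> \<bar>T u x\<bar> \<le> C * B"
    and lipschitz: "bdd_borel u B \<Longrightarrow> \<bar>T u x - T u y\<bar> \<le> C * B * \<bar>x - y\<bar>"
    and monotone: "wave u \<Longrightarrow> u 0 \<noteq> u pi \<Longrightarrow> strict_mono_on {0..pi} (T u)"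
    and lower: "wave u \<Longrightarrow> u 0 \<noteq> u pi \<Longrightarrow> \<exists>c>0. \<exists>\<eta>>0. \<forall>x\<in>{0..\<eta>}. c * x\<^sup>2 \<le> T u x - T u 0"
    and growth: "bdd_borel u B \<Longrightarrow> continuous_on UNIV u \<Longrightarrow> (\<And>x. u (- x) = u x) \<Longrightarrow>
      \<exists>D\<ge>0. \<forall>M\<ge>0. \<forall>\<epsilon>\<ge>0. (\<forall>y. \<bar>u y\<bar> \<le> M * (\<bar>y\<bar> + \<epsilon>)) \<longrightarrow>
        (\<forall>z x. 0 \<le> z \<and> z \<le> x \<longrightarrow> \<bar>T u x - T u z\<bar> \<le> D * (1 + M) * (x - z) * (x + \<epsilon>))"
    and smooth: "bdd_borel u B \<Longrightarrow> continuous_on UNIV u \<Longrightarrow> Ck k {a<..<b} u \<Longrightarrow> Ck (Suc k) {a<..<b} (T u)"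
begin

lemma continuous: assumes "bdd_borel u B" shows "continuous_on A (T u)"
proof (rule lipschitz_on_continuous_on[of "C * B"])
  show "(C * B)-lipschitz_on A (T u)"
    using lipschitz[OF assms] C_nonneg bdd_borelD(3)[OF assms]
    by (intro lipschitz_onI) (auto simp: dist_real_def)
qed

lemma bdd_borel_T: "bdd_borel u B \<Longrightarrow> bdd_borel (T u) (C * B)"
  using bound continuous[of u B UNIV] by (auto simp: bdd_borel_def borel_measurable_continuous_onI)

lemma T_const: "\<exists>d. \<forall>x. T (\<lambda>_. c) x = d"
proof -
  have "T (\<lambda>_. c) x = T (\<lambda>_. c) 0" for x
    using translation[where u = "\<lambda>_. c" and d = x and x = 0, OF bdd_borel_const] by simp
  then show ?thesis by blast
qed

lemma wave_T:
  assumes u: "wave u" and ne: "u 0 \<noteq> u pi"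
  shows "wave (T u)" "T u 0 \<noteq> T u pi"
proof -
  note b = wave_bdd_borel[OF u]
  have "T u (x + 2 * pi) = T u x" for x
    using translation[OF b, of "2 * pi" x] waveD(2)[OF u] by simp
  moreover have "T u (- x) = T u x" for x
    using reflection[OF b, of x] waveD(3)[OF u] by simp
  ultimately show "wave (T u)"
    using continuous[OF b] strict_mono_on_imp_mono_on[OF monotone[OF u ne]] by (auto simp: wave_def)
  show "T u 0 \<noteq> T u pi"
    using strict_mono_onD[OF monotone[OF u ne], of 0 pi] by simp
qed

end

lemma smoothing_operator_compose:
  assumes "smoothing_operator T1 C1" "smoothing_operator T2 C2"
  shows "smoothing_operator (\<lambda>u. T1 (T2 u)) (C1 * C2)"
proof -
  interpret T1: smoothing_operator T1 C1 by fact
  interpret T2: smoothing_operator T2 C2 by fact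
  show ?thesis
  proof
    show "0 \<le> C1 * C2" using T1.C_nonneg T2.C_nonneg by simp
  next
    fix u v :: "real \<Rightarrow> real" and B B' a b x :: real
    assume u: "bdd_borel u B" and v: "bdd_borel v B'"
    have "T2 (\<lambda>x. a * u x + b * v x) = (\<lambda>x. a * T2 u x + b * T2 v x)"
      using T2.linear[OF u v] by auto
    then show "T1 (T2 (\<lambda>x. a * u x + b * v x)) x = a * T1 (T2 u) x + b * T1 (T2 v) x"
      using T1.linear[OF T2.bdd_borel_T[OF u] T2.bdd_borel_T[OF v]] by simp
  next
    fix u :: "real \<Rightarrow> real" and B d x :: real assume u: "bdd_borel u B"
    have "T2 (\<lambda>x. u (x + d)) = (\<lambda>x. T2 u (x + d))" using T2.translation[OF u] by auto
    then show "T1 (T2 (\<lambda>x. u (x + d))) x = T1 (T2 u) (x + d)"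
      using T1.translation[OF T2.bdd_borel_T[OF u]] by simp
  next
    fix u :: "real \<Rightarrow> real" and B x :: real assume u: "bdd_borel u B"
    have "T2 (\<lambda>x. u (- x)) = (\<lambda>x. T2 u (- x))" using T2.reflection[OF u] by auto
    then show "T1 (T2 (\<lambda>x. u (- x))) x = T1 (T2 u) (- x)"
      using T1.reflection[OF T2.bdd_borel_T[OF u]] by simp
  next
    fix u :: "real \<Rightarrow> real" and B x y :: real assume u: "bdd_borel u B"
    show "\<bar>T1 (T2 u) x\<bar> \<le> C1 * C2 * B"
      using T1.bound[OF T2.bdd_borel_T[OF u]] by (simp add: mult.assoc)
    show "\<bar>T1 (T2 u) x - T1 (T2 u) y\<bar> \<le> C1 * C2 * B * \<bar>x - y\<bar>"
      using T1.lipschitz[OF T2.bdd_borel_T[OF u]] by (simp add: mult.assoc)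
  next
    fix u :: "real \<Rightarrow> real" assume u: "wave u" "u 0 \<noteq> u pi"
    show "strict_mono_on {0..pi} (T1 (T2 u))"
      by (rule T1.monotone[OF T2.wave_T[OF u]])
    show "\<exists>c>0. \<exists>\<eta>>0. \<forall>x\<in>{0..\<eta>}. c * x\<^sup>2 \<le> T1 (T2 u) x - T1 (T2 u) 0"
      by (rule T1.lower[OF T2.wave_T[OF u]])
  next
    fix u :: "real \<Rightarrow> real" and B :: real
    assume u: "bdd_borel u B" and even: "\<And>x. u (- x) = u x"
    define v where "v = (\<lambda>x. 1 * T2 u x + (-1) * T2 u 0)"
    obtain B' where v: "bdd_borel v B'"
      unfolding v_def using bdd_borel_lincomb[OF T2.bdd_borel_T[OF u] bdd_borel_const] by blast
    have vcont: "continuous_on UNIV v"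
      unfolding v_def by (intro continuous_intros T2.continuous[OF u])
    have veven: "v (- x) = v x" for x
      using T2.reflection[OF u, of x] even by (simp add: v_def)
    obtain D where D: "0 \<le> D" "\<And>M \<epsilon> z x. 0 \<le> M \<Longrightarrow> 0 \<le> \<epsilon> \<Longrightarrow> (\<forall>y. \<bar>v y\<bar> \<le> M * (\<bar>y\<bar> + \<epsilon>)) \<Longrightarrow>
        0 \<le> z \<Longrightarrow> z \<le> x \<Longrightarrow> \<bar>T1 v x - T1 v z\<bar> \<le> D * (1 + M) * (x - z) * (x + \<epsilon>)"
      using T1.growth[OF v vcont veven] by metis
    obtain d where d: "\<And>x. T1 (\<lambda>_. T2 u 0) x = d" using T1.T_const by blast
    have T1v: "T1 v x = T1 (T2 u) x - d" for x
      unfolding v_def using T1.linear[OF T2.bdd_borel_T[OF u] bdd_borel_const[of "T2 u 0"], of 1 "-1" x] d by simp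
    have v_lip: "\<bar>v y\<bar> \<le> C2 * B * (\<bar>y\<bar> + 0)" for y
      using T2.lipschitz[OF u, of y 0] by (simp add: v_def)
    have CB: "0 \<le> C2 * B" using T2.C_nonneg bdd_borelD(3)[OF u] by simp
    have est: "\<bar>T1 (T2 u) x - T1 (T2 u) z\<bar> \<le> D * (1 + C2 * B) * (1 + M) * (x - z) * (x + \<epsilon>)"
      if "0 \<le> M" "0 \<le> \<epsilon>" "0 \<le> z" "z \<le> x" for M \<epsilon> z x
    proof -
      have "\<bar>T1 (T2 u) x - T1 (T2 u) z\<bar> \<le> D * (1 + C2 * B) * (x - z) * (x + 0)"
        using D(2)[OF CB _ _ that(3,4), of 0] v_lip by (simp add: T1v)
      also have "\<dots> \<le> D * (1 + C2 * B) * (x - z) * ((1 + M) * (x + \<epsilon>))"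
      proof (intro mult_left_mono)
        show "x + 0 \<le> (1 + M) * (x + \<epsilon>)"
          using that mult_mono[of 1 "1 + M" x "x + \<epsilon>"] by simp
      qed (use D(1) CB that in auto)
      finally show ?thesis by (simp add: mult_ac)
    qed
    show "\<exists>D\<ge>0. \<forall>M\<ge>0. \<forall>\<epsilon>\<ge>0. (\<forall>y. \<bar>u y\<bar> \<le> M * (\<bar>y\<bar> + \<epsilon>)) \<longrightarrow>
        (\<forall>z x. 0 \<le> z \<and> z \<le> x \<longrightarrow> \<bar>T1 (T2 u) x - T1 (T2 u) z\<bar> \<le> D * (1 + M) * (x - z) * (x + \<epsilon>))"
      by (rule exI[of _ "D * (1 + C2 * B)"]) (use D(1) CB est in auto)
  next
    fix u :: "real \<Rightarrow> real" and B a b :: real and k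
    assume u: "bdd_borel u B" "continuous_on UNIV u" "Ck k {a<..<b} u"
    have "Ck (Suc k) {a<..<b} (T2 u)" by (rule T2.smooth[OF u])
    then have "Ck (Suc (Suc k)) {a<..<b} (T1 (T2 u))"
      by (rule T1.smooth[OF T2.bdd_borel_T[OF u(1)] T2.continuous[OF u(1)]])
    then show "Ck (Suc k) {a<..<b} (T1 (T2 u))" by (rule Ck_Suc_imp)
  qed
qed

context smoothing_operator
begin

context
  fixes u :: "real \<Rightarrow> real" and B :: real
  assumes nonneg: "\<And>x. 0 \<le> u x" and u0: "u 0 = 0" and bdd: "bdd_borel u B"
    and periodic: "\<And>x. u (x + 2 * pi) = u x" and even: "\<And>x. u (- x) = u x"
    and mono: "mono_on {0..pi} u" and nonconst: "u pi \<noteq> 0"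
    and eq: "\<And>x. (u x)\<^sup>2 = 2 * (T u x - T u 0)"
begin

lemma sol_sqrt: "u x = sqrt (2 * (T u x - T u 0))"
  using eq[of x] nonneg[of x] by (metis abs_of_nonneg real_sqrt_abs)

lemma sol_wave: "wave u" "u 0 \<noteq> u pi"
proof -
  have "continuous_on UNIV (\<lambda>x. sqrt (2 * (T u x - T u 0)))"
    by (intro continuous_intros continuous[OF bdd])
  also have "(\<lambda>x. sqrt (2 * (T u x - T u 0))) = u" by (rule ext) (rule sol_sqrt[symmetric])
  finally have "continuous_on UNIV u" .
  with periodic even mono show "wave u" by (simp add: wave_def)
  show "u 0 \<noteq> u pi" using u0 nonconst by simp
qed

lemma sol_strict_mono: "strict_mono_on {0..pi} u"
proof (rule strict_mono_onI)
  fix x y assume "x \<in> {0..pi}" "y \<in> {0..pi}" "x < y"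
  then have "T u x < T u y" using strict_mono_onD[OF monotone[OF sol_wave]] by simp
  then have "(u x)\<^sup>2 < (u y)\<^sup>2" by (simp add: eq)
  then show "u x < u y" using nonneg[of y] by (rule power2_less_imp_less)
qed

lemma sol_pos: "circ_dist x \<noteq> 0 \<Longrightarrow> 0 < u x"
  using strict_mono_onD[OF sol_strict_mono, of 0 "circ_dist x"] circ_dist_range[of x]
    circ_dist_fold[of u x, OF periodic even] u0 by simp

lemma sol_lower: "\<exists>c>0. \<forall>x\<in>{0..pi}. c * x \<le> u x"
proof -
  obtain c \<eta> where c: "0 < c" "0 < \<eta>" "\<And>x. 0 \<le> x \<Longrightarrow> x \<le> \<eta> \<Longrightarrow> c * x\<^sup>2 \<le> T u x - T u 0"
    using lower[OF sol_wave] by auto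
  define \<delta> where "\<delta> = min \<eta> pi"
  have \<delta>: "0 < \<delta>" "\<delta> \<le> \<eta>" "\<delta> \<le> pi" using c by (auto simp: \<delta>_def)
  define d where "d = sqrt (2 * c)"
  have d0: "0 < d" using c by (simp add: d_def)
  have near: "d * x \<le> u x" if "0 \<le> x" "x \<le> \<delta>" for x
  proof -
    have "(d * x)\<^sup>2 = 2 * (c * x\<^sup>2)" using c by (simp add: d_def power_mult_distrib)
    also have "\<dots> \<le> (u x)\<^sup>2" using c(3)[of x] that \<delta> by (simp add: eq)
    finally show ?thesis using nonneg by (rule power2_le_imp_le)
  qed
  have "d * (\<delta> / pi) * x \<le> u x" if "x \<in> {0..pi}" for x
  proof (cases "x \<le> \<delta>")
    case True
    have "d * (\<delta> / pi) * x \<le> d * 1 * x" using d0 \<delta> that by (intro mult_right_mono mult_left_mono) auto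
    then show ?thesis using near[of x] True that by simp
  next
    case False
    have "d * (\<delta> / pi) * x \<le> d * (\<delta> / pi) * pi" using d0 \<delta> that by (intro mult_left_mono) auto
    also have "\<dots> = d * \<delta>" by simp
    also have "\<dots> \<le> u \<delta>" using near[of \<delta>] \<delta> by simp
    also have "\<dots> \<le> u x" using waveD(4)[OF sol_wave(1), of \<delta> x] False that \<delta> by simp
    finally show ?thesis .
  qed
  moreover have "0 < d * (\<delta> / pi)" using d0 \<delta> by simp
  ultimately show ?thesis by blast
qed

text \<open>
  With \<open>M\<close> the supremum of \<open>u y / (\<bar>y\<bar> + \<epsilon>)\<close>, the growth estimate gives \<open>M\<^sup>2 \<le> D (1 + M)\<close>, so \<open>M\<close> is
  bounded independently of \<open>\<epsilon>\<close>.
\<close>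

lemma sol_upper: "\<exists>M\<ge>0. \<forall>x. u x \<le> M * \<bar>x\<bar>"
proof -
  obtain D where D: "0 \<le> D" "\<And>M \<epsilon> z x. 0 \<le> M \<Longrightarrow> 0 \<le> \<epsilon> \<Longrightarrow> (\<forall>y. \<bar>u y\<bar> \<le> M * (\<bar>y\<bar> + \<epsilon>)) \<Longrightarrow>
      0 \<le> z \<Longrightarrow> z \<le> x \<Longrightarrow> \<bar>T u x - T u z\<bar> \<le> D * (1 + M) * (x - z) * (x + \<epsilon>)"
    using growth[OF bdd waveD(1)[OF sol_wave(1)] even] by metis
  have step: "u x \<le> (1 + 4 * D) * (\<bar>x\<bar> + \<epsilon>)" if \<epsilon>: "0 < \<epsilon>" for x \<epsilon>
  proof -
    define M where "M = (SUP y. u y / (\<bar>y\<bar> + \<epsilon>))"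
    have "u y / (\<bar>y\<bar> + \<epsilon>) \<le> B / \<epsilon>" for y
      using bdd_borelD(2)[OF bdd, of y] bdd_borelD(3)[OF bdd] nonneg[of y] \<epsilon> by (intro frac_le) auto
    then have bdd_above: "bdd_above (range (\<lambda>y. u y / (\<bar>y\<bar> + \<epsilon>)))" by (auto simp: bdd_above_def)
    have le_M: "u y / (\<bar>y\<bar> + \<epsilon>) \<le> M" for y
      unfolding M_def by (rule cSUP_upper[OF _ bdd_above]) simp
    have M0: "0 \<le> M" using le_M[of 0] nonneg[of 0] \<epsilon> by (simp add: u0)
    have uM: "\<bar>u y\<bar> \<le> M * (\<bar>y\<bar> + \<epsilon>)" for y
      using le_M[of y] nonneg[of y] \<epsilon> by (simp add: pos_divide_le_eq)
    have sq: "(u y / (\<bar>y\<bar> + \<epsilon>))\<^sup>2 \<le> 2 * D * (1 + M)" for y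
    proof -
      have "(u y)\<^sup>2 = (u \<bar>y\<bar>)\<^sup>2" using even[of y] by (simp add: abs_if)
      also have "\<dots> \<le> 2 * (D * (1 + M) * (\<bar>y\<bar> - 0) * (\<bar>y\<bar> + \<epsilon>))"
        using D(2)[of M \<epsilon> 0 "\<bar>y\<bar>"] M0 \<epsilon> uM unfolding eq by (auto simp: abs_le_iff)
      also have "\<dots> = 2 * D * (1 + M) * (\<bar>y\<bar> * (\<bar>y\<bar> + \<epsilon>))" by (simp only: diff_0_right mult_ac)
      also have "\<dots> \<le> 2 * D * (1 + M) * ((\<bar>y\<bar> + \<epsilon>) * (\<bar>y\<bar> + \<epsilon>))"
        using D(1) M0 \<epsilon> by (intro mult_left_mono mult_right_mono) auto
      finally show ?thesis
        using \<epsilon> by (simp add: power_divide power2_eq_square[of "\<bar>y\<bar> + \<epsilon>"] pos_divide_le_eq)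
    qed
    have "M \<le> 1 + 4 * D"
    proof (rule ccontr)
      assume "\<not> M \<le> 1 + 4 * D"
      then have big: "1 + 4 * D < M" by simp
      have "M \<le> sqrt (2 * D * (1 + M))"
        unfolding M_def by (rule cSUP_least) (use sq in \<open>auto simp: M_def[symmetric] intro!: real_le_rsqrt\<close>)
      then have "M\<^sup>2 \<le> 2 * D * (1 + M)"
        using M0 D(1) by (metis abs_of_nonneg real_sqrt_abs real_sqrt_le_iff)
      also have "\<dots> \<le> 2 * D * (2 * M)" using big D(1) by (intro mult_left_mono) auto
      also have "\<dots> = (4 * D) * M" by simp
      also have "\<dots> < M * M" using big D(1) by (intro mult_strict_right_mono) auto
      finally show False by (simp add: power2_eq_square)
    qed
    then have "M * (\<bar>x\<bar> + \<epsilon>) \<le> (1 + 4 * D) * (\<bar>x\<bar> + \<epsilon>)" using \<epsilon> by (intro mult_right_mono) auto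
    then show ?thesis using uM[of x] by simp
  qed
  have "u x \<le> (1 + 4 * D) * \<bar>x\<bar>" for x
  proof (rule field_le_epsilon)
    fix e :: real assume e: "0 < e"
    have "u x \<le> (1 + 4 * D) * (\<bar>x\<bar> + e / (1 + 4 * D))"
      by (rule step) (use e D(1) in \<open>auto intro!: divide_pos_pos\<close>)
    also have "\<dots> = (1 + 4 * D) * \<bar>x\<bar> + e" using D(1) by (simp add: field_simps)
    finally show "u x \<le> (1 + 4 * D) * \<bar>x\<bar> + e" .
  qed
  with D(1) show ?thesis by (intro exI[of _ "1 + 4 * D"]) auto
qed

lemma sol_lipschitz: "\<exists>L. L-lipschitz_on UNIV u"
proof -
  obtain c where c: "0 < c" "\<And>x. 0 \<le> x \<Longrightarrow> x \<le> pi \<Longrightarrow> c * x \<le> u x" using sol_lower by auto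
  obtain M where M: "0 \<le> M" "\<And>x. u x \<le> M * \<bar>x\<bar>" using sol_upper by auto
  obtain D where D: "0 \<le> D" "\<And>M \<epsilon> z x. 0 \<le> M \<Longrightarrow> 0 \<le> \<epsilon> \<Longrightarrow> (\<forall>y. \<bar>u y\<bar> \<le> M * (\<bar>y\<bar> + \<epsilon>)) \<Longrightarrow>
      0 \<le> z \<Longrightarrow> z \<le> x \<Longrightarrow> \<bar>T u x - T u z\<bar> \<le> D * (1 + M) * (x - z) * (x + \<epsilon>)"
    using growth[OF bdd waveD(1)[OF sol_wave(1)] even] by metis
  define L where "L = 2 * D * (1 + M) / c"
  have L0: "0 \<le> L" using D M c by (simp add: L_def)
  have main: "u x - u z \<le> L * (x - z)" if "0 \<le> z" "z < x" "x \<le> pi" for x z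
  proof -
    have cx: "0 < c * x" using c that by simp
    have ux: "c * x \<le> u x + u z" using c(2)[of x] nonneg[of z] that by simp
    have mono: "u z \<le> u x" using waveD(4)[OF sol_wave(1), of z x] that by simp
    have "(u x - u z) * (c * x) \<le> (u x - u z) * (u x + u z)"
      using ux mono by (intro mult_left_mono) auto
    also have "\<dots> = 2 * (T u x - T u z)" using eq[of x] eq[of z] by (simp add: power2_eq_square algebra_simps)
    also have "\<dots> \<le> 2 * (D * (1 + M) * (x - z) * (x + 0))"
      using D(2)[of M 0 z x] M nonneg that by (auto simp: abs_le_iff)
    also have "\<dots> = L * (x - z) * (c * x)" using c by (simp add: L_def field_simps)
    finally show ?thesis using cx by (rule mult_right_le_imp_le)
  qed
  have "\<bar>u x - u y\<bar> \<le> L * \<bar>x - y\<bar>" for x y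
  proof -
    have fold: "u (circ_dist x) = u x" for x by (rule circ_dist_fold[OF periodic even])
    have "\<bar>u (circ_dist x) - u (circ_dist y)\<bar> \<le> L * \<bar>circ_dist x - circ_dist y\<bar>"
      using main[of "circ_dist y" "circ_dist x"] main[of "circ_dist x" "circ_dist y"]
        waveD(4)[OF sol_wave(1), of "circ_dist x" "circ_dist y"] waveD(4)[OF sol_wave(1), of "circ_dist y" "circ_dist x"]
        circ_dist_range[of x] circ_dist_range[of y]
      by (cases "circ_dist x" "circ_dist y" rule: linorder_cases) auto
    also have "\<dots> \<le> L * \<bar>x - y\<bar>" by (rule mult_left_mono[OF circ_dist_lipschitz L0])
    finally show ?thesis by (simp only: fold)
  qed
  then show ?thesis using L0 by (intro exI[of _ L] lipschitz_onI) (auto simp: dist_real_def)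
qed

lemma sol_smooth: "Ck k (UNIV - range (\<lambda>k::int. 2 * pi * of_int k)) u"
proof (induction k)
  case 0
  show ?case using waveD(1)[OF sol_wave(1)] by (auto intro: continuous_on_subset)
next
  case (Suc k)
  let ?S = "UNIV - range (\<lambda>k::int. 2 * pi * of_int k)"
  show ?case
  proof (rule Ck_local)
    fix x assume x: "x \<in> ?S"
    define j where "j = \<lfloor>x / (2 * pi)\<rfloor>"
    let ?U = "{2 * pi * of_int j<..<2 * pi * (of_int j + 1)}"
    have "of_int j \<le> x / (2 * pi)" "x / (2 * pi) < of_int j + 1"
      unfolding j_def by linarith+
    then have "2 * pi * of_int j \<le> x" "x < 2 * pi * (of_int j + 1)"
      by (simp_all add: field_simps)
    moreover have "x \<noteq> 2 * pi * of_int j" using x by auto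
    ultimately have xU: "x \<in> ?U" by simp
    have US: "?U \<subseteq> ?S"
    proof
      fix y assume y: "y \<in> ?U"
      have "y \<noteq> 2 * pi * of_int i" for i
      proof
        assume "y = 2 * pi * of_int i"
        with y have "real_of_int j < of_int i" "real_of_int i < of_int (j + 1)" by auto
        then show False unfolding of_int_less_iff by linarith
      qed
      then show "y \<in> ?S" by auto
    qed
    have pos: "0 < T u y - T u 0" if "y \<in> ?U" for y
    proof -
      have "circ_dist y \<noteq> 0" using US that by (auto simp: circ_dist_def)
      then have "0 < u y" by (rule sol_pos)
      then show ?thesis using eq[of y] by (metis zero_less_power zero_less_mult_pos zero_less_numeral)
    qed
    have "Ck (Suc k) ?U (T u)"
      by (rule smooth[OF bdd waveD(1)[OF sol_wave(1)] Ck_subset[OF Suc.IH US]])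
    then have "Ck (Suc k) ?U (\<lambda>y. sqrt (- 2 * T u 0 + 2 * T u y))"
      by (intro Ck_sqrt Ck_affine) (use pos in auto)
    then have "Ck (Suc k) ?U u"
      by (rule Ck_cong[THEN iffD1, rotated 2]) (use sol_sqrt in \<open>auto simp: algebra_simps\<close>)
    with xU show "\<exists>U. open U \<and> x \<in> U \<and> Ck (Suc k) U u" by (intro exI[of _ ?U]) auto
  qed
qed

end

end

section \<open>Superpositions of exponential kernels\<close>

lemma DERIV_integral_dominated:
  fixes f f' :: "'a \<Rightarrow> real \<Rightarrow> real"
  assumes x: "x \<in> {a<..<b}"
    and f': "\<And>w y. w \<in> space M \<Longrightarrow> y \<in> {a<..<b} \<Longrightarrow> (f w has_real_derivative f' w y) (at y)"
    and le: "\<And>w y. w \<in> space M \<Longrightarrow> y \<in> {a<..<b} \<Longrightarrow> \<bar>f' w y\<bar> \<le> K w"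
    and K: "integrable M K" and int: "\<And>y. y \<in> {a<..<b} \<Longrightarrow> integrable M (\<lambda>w. f w y)"
    and [measurable]: "(\<lambda>w. f' w x) \<in> borel_measurable M"
  shows "((\<lambda>y. \<integral>w. f w y \<partial>M) has_real_derivative (\<integral>w. f' w x \<partial>M)) (at x)"
proof -
  have "((\<lambda>y. ((\<integral>w. f w y \<partial>M) - (\<integral>w. f w x \<partial>M)) / (y - x)) \<longlongrightarrow> (\<integral>w. f' w x \<partial>M)) (at x within {a<..<b})"
    unfolding tendsto_at_iff_sequentially comp_def
  proof (intro allI impI)
    fix X assume X: "\<forall>i. X i \<in> {a<..<b} - {x}" "X \<longlonglongrightarrow> x"
    have "(\<lambda>i. \<integral>w. (f w (X i) - f w x) / (X i - x) \<partial>M) \<longlonglongrightarrow> (\<integral>w. f' w x \<partial>M)"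
    proof (rule integral_dominated_convergence)
      show "integrable M K" by (rule K)
      show "AE w in M. (\<lambda>i. (f w (X i) - f w x) / (X i - x)) \<longlonglongrightarrow> f' w x"
      proof (rule AE_I2)
        fix w assume "w \<in> space M"
        then have "((\<lambda>y. (f w y - f w x) / (y - x)) \<longlongrightarrow> f' w x) (at x within {a<..<b})"
          using f'[of w x] x has_field_derivative_iff has_field_derivative_at_within by blast
        then show "(\<lambda>i. (f w (X i) - f w x) / (X i - x)) \<longlonglongrightarrow> f' w x"
          using X unfolding tendsto_at_iff_sequentially comp_def by blast
      qed
      show "AE w in M. norm ((f w (X i) - f w x) / (X i - x)) \<le> K w" for i
      proof (rule AE_I2)
        fix w assume w: "w \<in> space M"
        have "norm (f w (X i) - f w x) \<le> K w * norm (X i - x)"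
        proof (rule field_differentiable_bound[where S = "{a<..<b}" and f' = "f' w"])
          show "(f w has_field_derivative f' w y) (at y within {a<..<b})" "norm (f' w y) \<le> K w"
            if "y \<in> {a<..<b}" for y
            using has_field_derivative_at_within[OF f'[OF w that]] le[OF w that] by simp_all
        qed (use X x in auto)
        moreover have "X i \<noteq> x" using X by auto
        ultimately show "norm ((f w (X i) - f w x) / (X i - x)) \<le> K w"
          by (simp add: field_simps)
      qed
      show "(\<lambda>w. (f w (X i) - f w x) / (X i - x)) \<in> borel_measurable M" for i
        using borel_measurable_integrable[OF int[of "X i"]] borel_measurable_integrable[OF int[OF x]] X by auto
    qed simp
    moreover have "(\<integral>w. (f w (X i) - f w x) / (X i - x) \<partial>M) = ((\<integral>w. f w (X i) \<partial>M) - (\<integral>w. f w x \<partial>M)) / (X i - x)" for i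
      using int[of "X i"] int[OF x] X by simp
    ultimately show "(\<lambda>i. ((\<integral>w. f w (X i) \<partial>M) - (\<integral>w. f w x \<partial>M)) / (X i - x)) \<longlonglongrightarrow> (\<integral>w. f' w x \<partial>M)"
      by (simp only:)
  qed
  then show ?thesis
    using x by (simp add: has_field_derivative_iff at_within_open[OF x])
qed

lemma
  assumes s: "s > 0" and u: "bdd_borel u B"
  shows integrable_exp_abs_conv: "integrable lborel (\<lambda>y. exp (- s * \<bar>x - y\<bar>) * u y)"
    and exp_abs_conv: "(\<integral>y. exp (- s * \<bar>x - y\<bar>) * u y \<partial>lborel) = expsum s u x"
proof -
  have [measurable]: "u \<in> borel_measurable borel" and B: "\<And>x. \<bar>u x\<bar> \<le> B" using u bdd_borelD by auto
  let ?f = "\<lambda>w. indicator {..x} w * exp (- s * (x - w)) * u w"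
  let ?g = "\<lambda>w. expker s (- x + 1 * w) * u (- (- x - (- x + 1 * w)))"
  have i1: "integrable lborel ?f"
    by (rule expconv_integrable_altdef[OF s _ B]) simp
  have i0: "integrable lborel (\<lambda>z. expker s z * u (- (- x - z)))"
    by (rule expker_mult_bounded_integrable[OF s _ , of _ B]) (use B in auto)
  have i2: "integrable lborel ?g"
    using lborel_integrable_real_affine[OF i0, of 1 "- x"] by simp
  have AE: "AE y in lborel. exp (- s * \<bar>x - y\<bar>) * u y = ?f y + ?g y"
    using AE_lborel_singleton[of x]
    by eventually_elim (auto simp: expker_def abs_if split: split_indicator)
  have "integrable lborel (\<lambda>y. ?f y + ?g y)" using i1 i2 by (rule Bochner_Integration.integrable_add)
  then show "integrable lborel (\<lambda>y. exp (- s * \<bar>x - y\<bar>) * u y)"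
    by (rule Bochner_Integration.integrable_cong_AE[THEN iffD1, rotated 3]) (use AE in auto)
  have "(\<integral>y. exp (- s * \<bar>x - y\<bar>) * u y \<partial>lborel) = (\<integral>y. ?f y + ?g y \<partial>lborel)"
    by (rule integral_cong_AE) (use AE in auto)
  also have "\<dots> = integral\<^sup>L lborel ?f + integral\<^sup>L lborel ?g" using i1 i2 by (rule Bochner_Integration.integral_add)
  also have "integral\<^sup>L lborel ?g = expconv s (\<lambda>y. u (- y)) (- x)"
    unfolding expconv_def
    by (subst lborel_integral_real_affine[of 1 "\<lambda>z. expker s z * u (- (- x - z))" "- x"]) simp_all
  finally show "(\<integral>y. exp (- s * \<bar>x - y\<bar>) * u y \<partial>lborel) = expsum s u x"
    by (simp add: expsum_def expconv_altdef)
qed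

locale laplace_mixture = finite_measure N for N :: "'a measure" +
  fixes \<sigma> :: "'a \<Rightarrow> real"
  assumes \<sigma>_measurable [measurable]: "\<sigma> \<in> borel_measurable N"
    and \<sigma>_ge: "w \<in> space N \<Longrightarrow> 1 \<le> \<sigma> w" and nonzero: "emeasure N (space N) \<noteq> 0"
begin

definition ker :: "real \<Rightarrow> real" where
  "ker x = (\<integral>w. exp (- \<sigma> w * \<bar>x\<bar>) \<partial>N)"

definition mix :: "(real \<Rightarrow> real) \<Rightarrow> real \<Rightarrow> real" where
  "mix u x = (\<integral>y. ker (x - y) * u y \<partial>lborel)"

lemma \<sigma>_pos: "w \<in> space N \<Longrightarrow> 0 < \<sigma> w"
  using \<sigma>_ge by force

lemma integrable_bounded: 
  fixes f :: "'a \<Rightarrow> real"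
  shows "f \<in> borel_measurable N \<Longrightarrow> (\<And>w. w \<in> space N \<Longrightarrow> \<bar>f w\<bar> \<le> K) \<Longrightarrow> integrable N f"
  by (rule integrable_const_bound[of _ K]) auto

lemma expconv_\<sigma>_measurable [measurable]:
  assumes [measurable]: "u \<in> borel_measurable borel"
  shows "(\<lambda>w. expconv (\<sigma> w) u x) \<in> borel_measurable N"
  unfolding expconv_def expker_def by measurable

lemma expsum_\<sigma>_measurable [measurable]:
  assumes [measurable]: "u \<in> borel_measurable borel"
  shows "(\<lambda>w. expsum (\<sigma> w) u x) \<in> borel_measurable N"
  unfolding expsum_def by measurable

lemma expdiff_\<sigma>_measurable [measurable]:
  assumes [measurable]: "u \<in> borel_measurable borel"
  shows "(\<lambda>w. expdiff (\<sigma> w) u x) \<in> borel_measurable N"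
  unfolding expdiff_def by measurable

lemma expconv_\<sigma>_abs_le:
  assumes "bdd_borel u B" "w \<in> space N" shows "\<bar>expconv (\<sigma> w) u x\<bar> \<le> B"
proof -
  have "\<bar>expconv (\<sigma> w) u x\<bar> \<le> B / \<sigma> w"
    by (intro expconv_abs_le \<sigma>_pos assms bdd_borelD[OF assms(1)])
  also have "\<dots> \<le> B / 1"
    using \<sigma>_ge[OF assms(2)] bdd_borelD(3)[OF assms(1)] by (intro divide_left_mono) auto
  finally show ?thesis by simp
qed

lemma expsum_\<sigma>_abs_le:
  assumes "bdd_borel u B" "w \<in> space N" shows "\<bar>expsum (\<sigma> w) u x\<bar> \<le> 2 * B"
  using expconv_\<sigma>_abs_le[OF assms, of x] expconv_\<sigma>_abs_le[OF bdd_borel_reflect[OF assms(1)] assms(2), of "- x"]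
  by (simp add: expsum_def)

lemma expconv_integrable: "bdd_borel u B \<Longrightarrow> integrable N (\<lambda>w. expconv (\<sigma> w) u x)"
  by (rule integrable_bounded[of _ B]) (auto intro: expconv_\<sigma>_abs_le expconv_\<sigma>_measurable bdd_borelD(1))

lemma expsum_integrable: "bdd_borel u B \<Longrightarrow> integrable N (\<lambda>w. expsum (\<sigma> w) u x)"
  by (rule integrable_bounded[of _ "2 * B"]) (auto intro: expsum_\<sigma>_abs_le expsum_\<sigma>_measurable bdd_borelD(1))

lemma expdiff_\<sigma>_abs_le:
  assumes "bdd_borel u B" "w \<in> space N" shows "\<bar>expdiff (\<sigma> w) u x\<bar> \<le> 2 * B"
  by (intro expdiff_abs_le \<sigma>_pos assms bdd_borelD[OF assms(1)])

lemma expdiff_integrable: "bdd_borel u B \<Longrightarrow> integrable N (\<lambda>w. expdiff (\<sigma> w) u x)"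
  by (rule integrable_bounded[of _ "2 * B"]) (auto intro: expdiff_\<sigma>_abs_le expdiff_\<sigma>_measurable bdd_borelD(1))

lemma pair_integrable:
  assumes u: "bdd_borel u B"
  shows "integrable (N \<Otimes>\<^sub>M lborel) (\<lambda>(w, y). exp (- \<sigma> w * \<bar>x - y\<bar>) * u y)"
proof -
  interpret P: pair_sigma_finite N lborel ..
  have [measurable]: "u \<in> borel_measurable borel" using u by (rule bdd_borelD)
  have au: "bdd_borel (\<lambda>y. \<bar>u y\<bar>) B" using u by (auto simp: bdd_borel_def)
  show ?thesis
  proof (rule P.Fubini_integrable)
    have "integrable N (\<lambda>w. expsum (\<sigma> w) (\<lambda>y. \<bar>u y\<bar>) x)" by (rule expsum_integrable[OF au])
    also have "?this \<longleftrightarrow> integrable N (\<lambda>w. \<integral>y. norm (case (w, y) of (w, y) \<Rightarrow> exp (- \<sigma> w * \<bar>x - y\<bar>) * u y) \<partial>lborel)"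
      by (intro Bochner_Integration.integrable_cong refl)
         (use exp_abs_conv[OF \<sigma>_pos au] in \<open>simp add: abs_mult\<close>)
    finally show "integrable N (\<lambda>w. \<integral>y. norm (case (w, y) of (w, y) \<Rightarrow> exp (- \<sigma> w * \<bar>x - y\<bar>) * u y) \<partial>lborel)" .
    show "AE w in N. integrable lborel (\<lambda>y. case (w, y) of (w, y) \<Rightarrow> exp (- \<sigma> w * \<bar>x - y\<bar>) * u y)"
      by (rule AE_I2) (use integrable_exp_abs_conv[OF \<sigma>_pos u] in simp)
  qed measurable
qed

lemma ker_mult: "(\<integral>w. exp (- \<sigma> w * \<bar>x - y\<bar>) * u y \<partial>N) = ker (x - y) * u y"
  by (simp add: ker_def)

lemma integrable_ker_mult:
  assumes u: "bdd_borel u B" shows "integrable lborel (\<lambda>y. ker (x - y) * u y)"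
proof -
  interpret P: pair_sigma_finite N lborel ..
  show ?thesis using P.integrable_snd[OF pair_integrable[OF u, of x]] by (simp only: ker_mult)
qed

lemma mix_eq:
  assumes u: "bdd_borel u B" shows "mix u x = (\<integral>w. expsum (\<sigma> w) u x \<partial>N)"
proof -
  interpret P: pair_sigma_finite N lborel ..
  have "mix u x = (\<integral>w. (\<integral>y. exp (- \<sigma> w * \<bar>x - y\<bar>) * u y \<partial>lborel) \<partial>N)"
    using P.Fubini_integral[OF pair_integrable[OF u, of x]] by (simp only: ker_mult mix_def)
  also have "\<dots> = (\<integral>w. expsum (\<sigma> w) u x \<partial>N)"
    by (intro Bochner_Integration.integral_cong refl exp_abs_conv[OF \<sigma>_pos u])
  finally show ?thesis .
qed

lemma ker_measurable [measurable]: "ker \<in> borel_measurable borel"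
  unfolding ker_def by measurable

lemma ker_even: "ker (- x) = ker x" by (simp add: ker_def)

lemma ker_nonneg: "0 \<le> ker x" by (simp add: ker_def)

lemma ker_integrable: "integrable lborel ker"
  using integrable_ker_mult[OF bdd_borel_const[of 1], of 0] by (simp add: ker_even)

lemma ker_le: "ker x \<le> measure N (space N)"
proof -
  have "ker x \<le> (\<integral>w. 1 \<partial>N)"
    unfolding ker_def using \<sigma>_pos by (intro integral_mono integrable_bounded[of _ 1]) (auto simp: less_imp_le)
  then show ?thesis by simp
qed

lemma ker_continuous: "continuous_on UNIV ker"
proof -
  have "isCont ker x" for x
    unfolding continuous_at_sequentially comp_def
  proof (intro allI impI)
    fix X assume X: "X \<longlonglongrightarrow> x"
    show "(\<lambda>n. ker (X n)) \<longlonglongrightarrow> ker x"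
      unfolding ker_def
    proof (rule integral_dominated_convergence[where w = "\<lambda>_. 1"])
      show "AE w in N. (\<lambda>i. exp (- \<sigma> w * \<bar>X i\<bar>)) \<longlonglongrightarrow> exp (- \<sigma> w * \<bar>x\<bar>)"
        by (intro AE_I2 tendsto_intros X)
      show "AE w in N. norm (exp (- \<sigma> w * \<bar>X i\<bar>)) \<le> 1" for i
        by (rule AE_I2) (use \<sigma>_pos in \<open>auto simp: less_imp_le\<close>)
    qed auto
  qed
  then show ?thesis by (simp add: continuous_on_eq_continuous_at)
qed

definition mixdiff :: "(real \<Rightarrow> real) \<Rightarrow> real \<Rightarrow> real" where
  "mixdiff u x = (\<integral>w. expdiff (\<sigma> w) u x \<partial>N)"

lemma mix_has_derivative:
  assumes u: "bdd_borel u B" and cont: "continuous_on UNIV u"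
  shows "(mix u has_real_derivative mixdiff u x) (at x)"
proof -
  have "((\<lambda>x. \<integral>w. expsum (\<sigma> w) u x \<partial>N) has_real_derivative mixdiff u x) (at x)"
    unfolding mixdiff_def
  proof (rule DERIV_integral_dominated[of x "x - 1" "x + 1" _ _ _ "\<lambda>_. 2 * B"])
    show "(expsum (\<sigma> w) u has_real_derivative expdiff (\<sigma> w) u y) (at y)" if "w \<in> space N" for w y
      by (rule expsum_has_derivative[OF \<sigma>_pos[OF that] cont bdd_borelD(2)[OF u]])
  qed (use u bdd_borelD[OF u] expdiff_\<sigma>_abs_le expsum_integrable in auto)
  also have "(\<lambda>x. \<integral>w. expsum (\<sigma> w) u x \<partial>N) = mix u" using mix_eq[OF u] by (intro ext) simp
  finally show ?thesis .
qed

lemma mixdiff_continuous: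
  assumes u: "bdd_borel u B" and cont: "continuous_on UNIV u"
  shows "continuous_on UNIV (mixdiff u)"
proof -
  have [measurable]: "u \<in> borel_measurable borel" using u by (rule bdd_borelD)
  have cu: "continuous_on UNIV (\<lambda>y. u (- y))"
    by (intro continuous_on_compose2[OF cont] continuous_intros) auto
  have "isCont (mixdiff u) x" for x
    unfolding continuous_at_sequentially comp_def
  proof (intro allI impI)
    fix X assume X: "X \<longlonglongrightarrow> x"
    show "(\<lambda>n. mixdiff u (X n)) \<longlonglongrightarrow> mixdiff u x"
      unfolding mixdiff_def
    proof (rule integral_dominated_convergence[where w = "\<lambda>_. 2 * B"])
      show "AE w in N. (\<lambda>i. expdiff (\<sigma> w) u (X i)) \<longlonglongrightarrow> expdiff (\<sigma> w) u x"
      proof (rule AE_I2)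
        fix w assume w: "w \<in> space N"
        have "isCont (expconv (\<sigma> w) u) y" "isCont (expconv (\<sigma> w) (\<lambda>y. u (- y))) y" for y
          using expconv_has_derivative[OF \<sigma>_pos[OF w] cont bdd_borelD(2)[OF u]]
            expconv_has_derivative[OF \<sigma>_pos[OF w] cu bdd_borelD(2)[OF bdd_borel_reflect[OF u]]]
          by (blast intro: DERIV_isCont)+
        then show "(\<lambda>i. expdiff (\<sigma> w) u (X i)) \<longlonglongrightarrow> expdiff (\<sigma> w) u x"
          unfolding expdiff_def
          by (intro tendsto_intros isCont_tendsto_compose[of _ "expconv (\<sigma> w) u"]
              isCont_tendsto_compose[of _ "expconv (\<sigma> w) (\<lambda>y. u (- y))"] X)
      qed
      show "AE w in N. norm (expdiff (\<sigma> w) u (X i)) \<le> 2 * B" for i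
        by (rule AE_I2) (use expdiff_\<sigma>_abs_le[OF u] in auto)
    qed auto
  qed
  then show ?thesis by (simp add: continuous_on_eq_continuous_at)
qed

end

definition laplace_int :: "'a measure \<Rightarrow> ('a \<Rightarrow> real) \<Rightarrow> ('a \<Rightarrow> real) \<Rightarrow> real \<Rightarrow> nat \<Rightarrow> real \<Rightarrow> real" where
  "laplace_int N \<sigma> \<psi> a j x = (\<integral>w. (- \<sigma> w) ^ j * exp (- \<sigma> w * (x - a)) * \<psi> w \<partial>N)"

lemma power_mult_exp_le:
  fixes s d :: real
  assumes "0 \<le> s" "0 < d" shows "s ^ n * exp (- s * d) \<le> (real n / d) ^ n"
proof (cases "n = 0")
  case False
  have "s * d / n \<le> exp (s * d / n)" using exp_ge_add_one_self[of "s * d / n"] by linarith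
  then have "(s * d / n) ^ n \<le> exp (s * d / n) ^ n" using assms by (intro power_mono) auto
  also have "\<dots> = exp (s * d)" using False by (simp flip: exp_of_nat_mult)
  finally have "(s * d / n) ^ n * exp (- s * d) \<le> exp (s * d) * exp (- s * d)" by (rule mult_right_mono) simp
  also have "\<dots> = 1" by (simp flip: exp_add)
  finally have le1: "(s * d / n) ^ n * exp (- s * d) \<le> 1" .
  have "(real n / d) ^ n * ((s * d / n) ^ n * exp (- s * d)) \<le> (real n / d) ^ n * 1"
    using assms by (intro mult_left_mono le1) auto
  moreover have "(real n / d) ^ n * (s * d / n) ^ n = s ^ n"
    using False assms by (simp flip: power_mult_distrib)
  ultimately show ?thesis by (simp flip: mult.assoc)
qed (use assms in auto)

lemma clamp_lipschitz: "\<bar>max a (min b x) - max a (min b y)\<bar> \<le> \<bar>x - y\<bar>" for a b x y :: real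
  by (auto simp: max_def min_def)

context laplace_mixture
begin

lemma laplace_int_bound:
  assumes "w \<in> space N" "\<bar>\<psi> w\<bar> \<le> B" "a + d \<le> x" "0 < d"
  shows "\<bar>(- \<sigma> w) ^ j * exp (- \<sigma> w * (x - a)) * \<psi> w\<bar> \<le> (real j / d) ^ j * B"
proof -
  have s: "0 < \<sigma> w" using \<sigma>_pos assms by blast
  have "\<sigma> w ^ j * exp (- \<sigma> w * (x - a)) \<le> \<sigma> w ^ j * exp (- \<sigma> w * d)"
    using s assms by (intro mult_left_mono) auto
  also have "\<dots> \<le> (real j / d) ^ j" using s assms by (intro power_mult_exp_le) auto
  finally have "\<sigma> w ^ j * exp (- \<sigma> w * (x - a)) * \<bar>\<psi> w\<bar> \<le> (real j / d) ^ j * B"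
    using assms s by (intro mult_mono) auto
  then show ?thesis using s by (simp add: abs_mult power_abs)
qed

lemma laplace_int_Ck:
  assumes [measurable]: "\<psi> \<in> borel_measurable N" and B: "\<And>w. w \<in> space N \<Longrightarrow> \<bar>\<psi> w\<bar> \<le> B"
  shows "Ck k {a<..} (laplace_int N \<sigma> \<psi> a j)"
proof -
  have D: "(laplace_int N \<sigma> \<psi> a j has_real_derivative laplace_int N \<sigma> \<psi> a (Suc j) x) (at x)"
    if x: "x \<in> {a<..}" for x j
  proof -
    define d where "d = (x - a) / 2"
    have d: "0 < d" "a + d < x" using x by (auto simp: d_def field_simps)
    have int: "integrable N (\<lambda>w. (- \<sigma> w) ^ j * exp (- \<sigma> w * (y - a)) * \<psi> w)" if "a + d < y" for y j
      by (rule integrable_bounded[of _ "(real j / d) ^ j * B"]) (use laplace_int_bound B d that in auto)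
    show ?thesis
      unfolding laplace_int_def
    proof (rule DERIV_integral_dominated[of x "a + d" "x + 1" _ _ _ "\<lambda>_. (real (Suc j) / d) ^ Suc j * B"])
      show "\<bar>(- \<sigma> w) ^ Suc j * exp (- \<sigma> w * (y - a)) * \<psi> w\<bar> \<le> (real (Suc j) / d) ^ Suc j * B"
        if "w \<in> space N" "y \<in> {a + d<..<x + 1}" for w y
        by (rule laplace_int_bound) (use that d B in auto)
    qed (use d int in \<open>auto intro!: derivative_eq_intros\<close>)
  qed
  show ?thesis
  proof (induction k arbitrary: j)
    case 0
    show ?case using DERIV_isCont[OF D] by (auto intro: continuous_at_imp_continuous_on)
  next
    case (Suc k)
    show ?case by (rule Ck_SucI[OF _ D Suc.IH]) auto
  qed
qed

lemma expconv_mix_smooth: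
  assumes u: "bdd_borel u B" and zero: "\<And>y. y \<in> {a<..<b} \<Longrightarrow> u y = 0"
  shows "Ck k {a<..<b} (\<lambda>x. \<integral>w. expconv (\<sigma> w) u x \<partial>N)"
proof -
  have [measurable]: "u \<in> borel_measurable borel" using u by (rule bdd_borelD)
  let ?\<psi> = "\<lambda>w. expconv (\<sigma> w) u a"
  have "Ck k {a<..} (laplace_int N \<sigma> ?\<psi> a 0)"
    by (rule laplace_int_Ck) (use expconv_\<sigma>_abs_le[OF u] in auto)
  then have "Ck k {a<..<b} (laplace_int N \<sigma> ?\<psi> a 0)" by (rule Ck_subset) auto
  also have "?this \<longleftrightarrow> Ck k {a<..<b} (\<lambda>x. \<integral>w. expconv (\<sigma> w) u x \<partial>N)"
  proof (rule Ck_cong)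
    fix x assume x: "x \<in> {a<..<b}"
    have "expconv (\<sigma> w) u x = exp (- \<sigma> w * (x - a)) * ?\<psi> w" if w: "w \<in> space N" for w
    proof -
      have "(\<integral>y. indicator {a..x} y * (exp (- \<sigma> w * (x - y)) * u y) \<partial>lborel) = (\<integral>y. 0 \<partial>(lborel :: real measure))"
      proof (rule integral_cong_AE)
        show "AE y in lborel. indicator {a..x} y * (exp (- \<sigma> w * (x - y)) * u y) = 0"
          using AE_lborel_singleton[of a]
          by eventually_elim (use x zero in \<open>auto split: split_indicator\<close>)
      qed measurable
      then show ?thesis
        using expconv_shift(1)[where u = u and x = a and y = x, OF \<sigma>_pos[OF w] _ bdd_borelD(2)[OF u]] x by simp
    qed
    then show "laplace_int N \<sigma> ?\<psi> a 0 x = (\<integral>w. expconv (\<sigma> w) u x \<partial>N)"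
      unfolding laplace_int_def by (intro Bochner_Integration.integral_cong) auto
  qed auto
  finally show ?thesis .
qed

lemma mix_smooth_off_support:
  assumes u: "bdd_borel u B" and zero: "\<And>y. y \<in> {a<..<b} \<Longrightarrow> u y = 0"
  shows "Ck k {a<..<b} (mix u)"
proof -
  let ?v = "\<lambda>y. u (- y)"
  have "Ck k {- b<..<- a} (\<lambda>x. \<integral>w. expconv (\<sigma> w) ?v x \<partial>N)"
    by (rule expconv_mix_smooth[OF bdd_borel_reflect[OF u]]) (use zero in auto)
  then have "Ck k (uminus ` {- b<..<- a}) (\<lambda>x. \<integral>w. expconv (\<sigma> w) ?v (- x) \<partial>N)"
    by (rule Ck_uminus_arg[rotated]) auto
  moreover have "uminus ` {- b<..<- a} = {a<..<b}" by simp
  ultimately have "Ck k {a<..<b} (\<lambda>x. (\<integral>w. expconv (\<sigma> w) u x \<partial>N) + (\<integral>w. expconv (\<sigma> w) ?v (- x) \<partial>N))"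
    using expconv_mix_smooth[OF u zero, where k = k] by (intro Ck_add) auto
  also have "(\<lambda>x. (\<integral>w. expconv (\<sigma> w) u x \<partial>N) + (\<integral>w. expconv (\<sigma> w) ?v (- x) \<partial>N)) = mix u"
    using expconv_integrable[OF u] expconv_integrable[OF bdd_borel_reflect[OF u]]
    by (intro ext) (simp add: mix_eq[OF u] expsum_def)
  finally show ?thesis .
qed

lemma mix_linear:
  assumes "bdd_borel u B" "bdd_borel v B'"
  shows "mix (\<lambda>x. a * u x + b * v x) x = a * mix u x + b * mix v x"
proof -
  have "mix (\<lambda>x. a * u x + b * v x) x = (\<integral>y. a * (ker (x - y) * u y) + b * (ker (x - y) * v y) \<partial>lborel)"
    by (simp add: mix_def algebra_simps)
  also have "\<dots> = a * mix u x + b * mix v x"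
    using integrable_ker_mult[OF assms(1), of x] integrable_ker_mult[OF assms(2), of x] by (simp add: mix_def)
  finally show ?thesis .
qed

lemma mix_translation: "mix (\<lambda>x. u (x + d)) x = mix u (x + d)"
  unfolding mix_def
  by (subst (2) lborel_integral_real_affine[of 1 _ d]) (simp_all add: algebra_simps)

lemma mix_reflection: "mix (\<lambda>x. u (- x)) x = mix u (- x)"
proof -
  have "mix u (- x) = (\<integral>y. ker (- x - (0 + (-1) * y)) * u (0 + (-1) * y) \<partial>lborel)"
    unfolding mix_def by (subst lborel_integral_real_affine[of "-1" _ 0]) simp_all
  also have "(\<lambda>y. ker (- x - (0 + (-1) * y)) * u (0 + (-1) * y)) = (\<lambda>y. ker (x - y) * u (- y))"
    using ker_even[of "x - y" for y] by (intro ext) (simp add: minus_diff_commute)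
  finally show ?thesis by (simp add: mix_def)
qed

lemma mix_bound:
  assumes "bdd_borel u B" shows "\<bar>mix u x\<bar> \<le> 4 * measure N (space N) * B"
proof -
  have "norm (mix u x) \<le> (\<integral>w. 2 * B \<partial>N)"
    unfolding mix_eq[OF assms]
    by (rule norm_integral_le_integral[OF expsum_integrable[OF assms]])
       (use expsum_\<sigma>_abs_le[OF assms] in auto)
  also have "\<dots> = 2 * measure N (space N) * B" by simp
  also have "\<dots> \<le> 4 * measure N (space N) * B"
    using bdd_borelD(3)[OF assms] by (intro mult_right_mono) auto
  finally show ?thesis by simp
qed

lemma mix_lipschitz:
  assumes u: "bdd_borel u B" shows "\<bar>mix u x - mix u y\<bar> \<le> 4 * measure N (space N) * B * \<bar>x - y\<bar>"
proof -
  have "mix u x - mix u y = (\<integral>w. expsum (\<sigma> w) u x - expsum (\<sigma> w) u y \<partial>N)"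
    using expsum_integrable[OF u] by (simp add: mix_eq[OF u])
  also have "norm \<dots> \<le> (\<integral>w. 4 * B * \<bar>x - y\<bar> \<partial>N)"
  proof (rule norm_integral_le_integral)
    fix w assume w: "w \<in> space N"
    have "\<bar>expconv (\<sigma> w) u x - expconv (\<sigma> w) u y\<bar> \<le> 2 * B * \<bar>x - y\<bar>"
      by (intro expconv_lipschitz \<sigma>_pos w bdd_borelD[OF u])
    moreover have "\<bar>expconv (\<sigma> w) (\<lambda>y. u (- y)) (- x) - expconv (\<sigma> w) (\<lambda>y. u (- y)) (- y)\<bar> \<le> 2 * B * \<bar>- x - - y\<bar>"
      by (intro expconv_lipschitz \<sigma>_pos w bdd_borelD[OF bdd_borel_reflect[OF u]])
    ultimately show "norm (expsum (\<sigma> w) u x - expsum (\<sigma> w) u y) \<le> 4 * B * \<bar>x - y\<bar>"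
      by (simp add: expsum_def abs_minus_commute)
  qed (use expsum_integrable[OF u] in auto)
  also have "\<dots> = 4 * measure N (space N) * B * \<bar>x - y\<bar>" by simp
  finally show ?thesis by simp
qed

lemma mix_continuous: "bdd_borel u B \<Longrightarrow> continuous_on UNIV u \<Longrightarrow> continuous_on A (mix u)"
  by (intro continuous_at_imp_continuous_on ballI) (rule DERIV_isCont, rule mix_has_derivative)

lemma mix_monotone:
  assumes u: "wave u" and ne: "u 0 \<noteq> u pi"
  shows "strict_mono_on {0..pi} (mix u)"
proof (rule strict_mono_onI)
  fix x y assume xy: "x \<in> {0..pi}" "y \<in> {0..pi}" "x < y"
  note b = wave_bdd_borel[OF u]
  show "mix u x < mix u y"
  proof (rule DERIV_pos_imp_increasing_open[OF \<open>x < y\<close>])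
    fix z assume z: "x < z" "z < y"
    have "(\<integral>w. 0 \<partial>N) < (\<integral>w. expdiff (\<sigma> w) u z \<partial>N)"
      by (rule integral_less_AE_space)
         (use expdiff_integrable[OF b] nonzero expdiff_pos[OF \<sigma>_pos u ne, of _ z] xy z in auto)
    then show "\<exists>d. (mix u has_real_derivative d) (at z) \<and> 0 < d"
      using mix_has_derivative[OF b waveD(1)[OF u]] by (auto simp: mixdiff_def)
  qed (rule mix_continuous[OF b waveD(1)[OF u]])
qed

lemma mix_lower:
  assumes u: "wave u" and ne: "u 0 \<noteq> u pi"
  shows "\<exists>c>0. \<exists>\<eta>>0. \<forall>x\<in>{0..\<eta>}. c * x\<^sup>2 \<le> mix u x - mix u 0"
proof -
  note b = wave_bdd_borel[OF u]
  have isC: "isCont u x" for x using waveD(1)[OF u] by (simp add: continuous_on_eq_continuous_at)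
  have "((\<lambda>t. u (pi - 2 * t) - u (2 * t)) \<longlongrightarrow> u (pi - 2 * 0) - u (2 * 0)) (at_right 0)"
    by (intro tendsto_diff isCont_tendsto_compose[OF isC] tendsto_intros)
  moreover have "0 < u (pi - 2 * 0) - u (2 * 0)" using waveD(7)[OF u, of pi] ne by simp
  ultimately have "\<forall>\<^sub>F t in at_right 0. 0 < u (pi - 2 * t) - u (2 * t)"
    by (rule order_tendstoD)
  moreover have "\<forall>\<^sub>F t in at_right 0. t \<in> {0<..<pi / 4}"
    by (rule eventually_at_right_real) simp
  ultimately have "\<forall>\<^sub>F t in at_right (0::real). 0 < u (pi - 2 * t) - u (2 * t) \<and> t \<in> {0<..<pi / 4}"
    by (rule eventually_conj)
  from eventually_happens'[OF trivial_limit_at_right_real this]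
  obtain \<eta> where "0 < u (pi - 2 * \<eta>) - u (2 * \<eta>) \<and> \<eta> \<in> {0<..<pi / 4}" ..
  then have \<eta>: "0 < \<eta>" "\<eta> \<le> pi / 4" and g: "0 < u (pi - 2 * \<eta>) - u (2 * \<eta>)" by auto
  define g where "g = u (pi - 2 * \<eta>) - u (2 * \<eta>)"
  define K where "K w = \<sigma> w * wave_weight (\<sigma> w) (pi - \<eta>)" for w
  have Kpos: "0 < K w" if "w \<in> space N" for w
    using \<sigma>_pos[OF that] \<eta> by (auto simp: K_def wave_weight_def)
  have Kint: "integrable N K"
  proof (rule integrable_bounded)
    show "K \<in> borel_measurable N" unfolding K_def wave_weight_def by measurable
    fix w assume w: "w \<in> space N"
    have "K w \<le> \<sigma> w ^ 1 * exp (- \<sigma> w * (pi - \<eta>))"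
      unfolding K_def wave_weight_def using \<sigma>_pos[OF w] by (simp add: algebra_simps)
    also have "\<dots> \<le> (real 1 / (pi - \<eta>)) ^ 1"
      using \<sigma>_pos[OF w] \<eta> by (intro power_mult_exp_le) auto
    finally show "\<bar>K w\<bar> \<le> 1 / (pi - \<eta>)" using Kpos[OF w] by simp
  qed
  define c where "c = (\<integral>w. K w \<partial>N) * g"
  have "(\<integral>w. 0 \<partial>N) < (\<integral>w. K w \<partial>N)"
    by (rule integral_less_AE_space) (use Kint nonzero Kpos in auto)
  then have c0: "0 < c" using g by (simp add: c_def g_def)
  have deriv: "2 * c * x \<le> mixdiff u x" if x: "0 \<le> x" "x \<le> \<eta>" for x
  proof -
    have "2 * c * x = (\<integral>w. K w * (2 * g * x) \<partial>N)" by (simp add: c_def)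
    also have "\<dots> \<le> mixdiff u x"
      unfolding mixdiff_def
    proof (rule integral_mono)
      show "K w * (2 * g * x) \<le> expdiff (\<sigma> w) u x" if "w \<in> space N" for w
        unfolding K_def g_def by (rule expdiff_lower_bound[OF \<sigma>_pos[OF that] u \<eta> x])
    qed (use Kint expdiff_integrable[OF b] in auto)
    finally show ?thesis .
  qed
  have "c * x\<^sup>2 \<le> mix u x - mix u 0" if x: "x \<in> {0..\<eta>}" for x
  proof -
    have "mix u 0 - c * 0\<^sup>2 \<le> mix u x - c * x\<^sup>2"
    proof (rule DERIV_nonneg_imp_nondecreasing[of 0 x "\<lambda>x. mix u x - c * x\<^sup>2"])
      fix y assume "0 \<le> y" "y \<le> x"
      then show "\<exists>d. ((\<lambda>x. mix u x - c * x\<^sup>2) has_real_derivative d) (at y) \<and> 0 \<le> d"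
        using deriv[of y] x
        by (intro exI[of _ "mixdiff u y - c * (2 * y)"])
           (auto intro!: derivative_eq_intros mix_has_derivative[OF b waveD(1)[OF u]])
    qed (use x in auto)
    then show ?thesis by simp
  qed
  with c0 \<eta> show ?thesis by blast
qed

lemma mix_growth:
  assumes u: "bdd_borel u B" and cont: "continuous_on UNIV u" and even: "\<And>x. u (- x) = u x"
    and M: "0 \<le> M" "0 \<le> \<epsilon>" "\<And>y. \<bar>u y\<bar> \<le> M * (\<bar>y\<bar> + \<epsilon>)" and x: "0 \<le> z" "z \<le> x"
  shows "\<bar>mix u x - mix u z\<bar> \<le> 4 * measure N (space N) * M * (x - z) * (x + \<epsilon>)"
proof -
  have "norm (mix u x - mix u z) \<le> 4 * measure N (space N) * M * (x + \<epsilon>) * norm (x - z)"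
  proof (rule field_differentiable_bound[where S = "{z..x}" and f' = "mixdiff u"])
    fix y assume y: "y \<in> {z..x}"
    show "(mix u has_field_derivative mixdiff u y) (at y within {z..x})"
      by (rule has_field_derivative_at_within[OF mix_has_derivative[OF u cont]])
    have "norm (mixdiff u y) \<le> (\<integral>w. 4 * M * (x + \<epsilon>) \<partial>N)"
      unfolding mixdiff_def
    proof (rule norm_integral_le_integral)
      fix w assume w: "w \<in> space N"
      have "\<bar>expdiff (\<sigma> w) u y\<bar> \<le> 4 * M * (y + \<epsilon>)"
        by (rule expdiff_growth[OF \<sigma>_ge[OF w] bdd_borelD(1,2)[OF u] even M]) (use x y in auto)
      also have "\<dots> \<le> 4 * M * (x + \<epsilon>)" using M y by (intro mult_left_mono) auto
      finally show "norm (expdiff (\<sigma> w) u y) \<le> 4 * M * (x + \<epsilon>)" by simp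
    qed (use expdiff_integrable[OF u] in auto)
    also have "\<dots> = 4 * measure N (space N) * M * (x + \<epsilon>)" by simp
    finally show "norm (mixdiff u y) \<le> 4 * measure N (space N) * M * (x + \<epsilon>)" .
  qed (use x in auto)
  then show ?thesis using x by (simp add: mult_ac)
qed

lemma mix_altdef: "mix u x = (\<integral>z. ker z * u (x - z) \<partial>lborel)"
proof -
  have "mix u x = (\<integral>z. ker (x - (x + (-1) * z)) * u (x + (-1) * z) \<partial>lborel)"
    unfolding mix_def by (subst lborel_integral_real_affine[of "-1" _ x]) simp_all
  then show ?thesis by simp
qed

lemma integrable_ker_mult':
  assumes u: "bdd_borel u B" shows "integrable lborel (\<lambda>z. ker z * u (x - z))"
proof -
  have [measurable]: "u \<in> borel_measurable borel" using u by (rule bdd_borelD)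
  show ?thesis
    by (rule integrable_mult_bounded_right[OF ker_integrable, of _ B]) (use bdd_borelD(2)[OF u] in auto)
qed

lemma mix_deriv_of_lipschitz:
  assumes v: "bdd_borel v B" and g: "bdd_borel g B'" and L: "\<And>y z. \<bar>v y - v z\<bar> \<le> L * \<bar>y - z\<bar>"
    and deriv: "\<And>y. y \<noteq> p \<Longrightarrow> y \<noteq> q \<Longrightarrow> (v has_real_derivative g y) (at y)"
  shows "(mix v has_real_derivative mix g x) (at x)"
proof -
  have [measurable]: "v \<in> borel_measurable borel" "g \<in> borel_measurable borel"
    using v g by (auto dest: bdd_borelD)
  have "((\<lambda>y. (mix v y - mix v x) / (y - x)) \<longlongrightarrow> mix g x) (at x)"
    unfolding tendsto_at_iff_sequentially comp_def
  proof (intro allI impI)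
    fix X assume X: "\<forall>i. X i \<in> UNIV - {x}" "X \<longlonglongrightarrow> x"
    have "(\<lambda>i. \<integral>z. ker z * ((v (X i - z) - v (x - z)) / (X i - x)) \<partial>lborel) \<longlonglongrightarrow> (\<integral>z. ker z * g (x - z) \<partial>lborel)"
    proof (rule integral_dominated_convergence[where w = "\<lambda>z. ker z * L"])
      show "integrable lborel (\<lambda>z. ker z * L)" using ker_integrable by simp
      show "AE z in lborel. (\<lambda>i. ker z * ((v (X i - z) - v (x - z)) / (X i - x))) \<longlonglongrightarrow> ker z * g (x - z)"
        using AE_lborel_singleton[of "x - p"] AE_lborel_singleton[of "x - q"]
      proof eventually_elim
        fix z assume "z \<noteq> x - p" "z \<noteq> x - q"
        then have "((\<lambda>y. v (y - z)) has_real_derivative g (x - z) * 1) (at x)"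
          by (intro DERIV_chain2[OF deriv]) (auto intro!: derivative_eq_intros)
        then have "((\<lambda>y. (v (y - z) - v (x - z)) / (y - x)) \<longlongrightarrow> g (x - z)) (at x)"
          by (simp add: has_field_derivative_iff)
        then have "(\<lambda>i. (v (X i - z) - v (x - z)) / (X i - x)) \<longlonglongrightarrow> g (x - z)"
          using X unfolding tendsto_at_iff_sequentially comp_def by blast
        then show "(\<lambda>i. ker z * ((v (X i - z) - v (x - z)) / (X i - x))) \<longlonglongrightarrow> ker z * g (x - z)"
          by (rule tendsto_mult_left)
      qed
      show "AE z in lborel. norm (ker z * ((v (X i - z) - v (x - z)) / (X i - x))) \<le> ker z * L" for i
      proof (rule AE_I2)
        fix z
        have "X i \<noteq> x" using X by auto
        then have "\<bar>(v (X i - z) - v (x - z)) / (X i - x)\<bar> \<le> L"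
          using L[of "X i - z" "x - z"] by (simp add: pos_divide_le_eq)
        then have "ker z * \<bar>(v (X i - z) - v (x - z)) / (X i - x)\<bar> \<le> ker z * L"
          by (rule mult_left_mono[OF _ ker_nonneg])
        then show "norm (ker z * ((v (X i - z) - v (x - z)) / (X i - x))) \<le> ker z * L"
          by (simp only: real_norm_def abs_mult abs_of_nonneg[OF ker_nonneg])
      qed
    qed measurable
    moreover have "(\<integral>z. ker z * ((v (X i - z) - v (x - z)) / (X i - x)) \<partial>lborel) = (mix v (X i) - mix v x) / (X i - x)" for i
    proof -
      have "(\<integral>z. ker z * ((v (X i - z) - v (x - z)) / (X i - x)) \<partial>lborel)
          = (\<integral>z. (ker z * v (X i - z) - ker z * v (x - z)) / (X i - x) \<partial>lborel)"
        by (simp add: algebra_simps)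
      also have "\<dots> = ((\<integral>z. ker z * v (X i - z) \<partial>lborel) - (\<integral>z. ker z * v (x - z) \<partial>lborel)) / (X i - x)"
        by (simp only: integral_divide_zero Bochner_Integration.integral_diff[OF integrable_ker_mult'[OF v] integrable_ker_mult'[OF v]])
      finally show ?thesis by (simp only: mix_altdef)
    qed
    ultimately show "(\<lambda>i. (mix v (X i) - mix v x) / (X i - x)) \<longlonglongrightarrow> mix g x"
      by (simp only: mix_altdef)
  qed
  then show ?thesis by (simp add: has_field_derivative_iff)
qed

text \<open>
  Localisation: near \<open>x\<close> the function \<open>u\<close> is replaced by its constant extension from a compact interval,
  whose derivative is bounded; everything discarded vanishes near \<open>x\<close> and contributes a smooth function.
\<close>

lemma mix_smooth:
  assumes "bdd_borel u B" "continuous_on UNIV u" "Ck k {a<..<b} u"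
  shows "Ck (Suc k) {a<..<b} (mix u)"
  using assms
proof (induction k arbitrary: u B a b)
  case 0
  show ?case
    by (rule Ck_SucI[OF _ mix_has_derivative[OF 0(1,2)]])
       (auto intro: continuous_on_subset[OF mixdiff_continuous[OF 0(1,2)]])
next
  case (Suc k)
  show ?case
  proof (rule Ck_local)
    fix x assume x: "x \<in> {a<..<b}"
    obtain p where p: "a < p" "p < x" using dense x by auto
    obtain q where q: "x < q" "q < b" using dense x by auto
    define cl where "cl = (\<lambda>y. max p (min q y))"
    define v where "v = (\<lambda>y. u (cl y))"
    define g where "g = (\<lambda>y. deriv u (cl y))"
    define gi where "gi = (\<lambda>y. indicator {p<..<q} y * g y)"
    note u = Suc.prems
    have [measurable]: "u \<in> borel_measurable borel" using u(1) by (rule bdd_borelD)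
    have clI: "cl y \<in> {p..q}" for y using p q by (auto simp: cl_def)
    have clab: "cl y \<in> {a<..<b}" for y using clI[of y] p q by auto
    have cl_id: "y \<in> {p..q} \<Longrightarrow> cl y = y" for y by (auto simp: cl_def)
    have cl_cont: "continuous_on A cl" for A unfolding cl_def by (intro continuous_intros)
    have Cd: "Ck k {a<..<b} (deriv u)" using u(3) by simp
    have g_cont: "continuous_on UNIV g" unfolding g_def
      by (rule continuous_on_compose2[OF Ck_continuous_on[OF Cd] cl_cont]) (use clab in auto)
    have v_cont: "continuous_on UNIV v" unfolding v_def
      by (rule continuous_on_compose2[OF u(2) cl_cont]) auto
    have [measurable]: "g \<in> borel_measurable borel" "v \<in> borel_measurable borel"
      using g_cont v_cont by (auto intro: borel_measurable_continuous_onI)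
    have "compact (deriv u ` {p..q})"
      by (intro compact_continuous_image compact_Icc continuous_on_subset[OF Ck_continuous_on[OF Cd]]) (use p q in auto)
    then obtain L where L: "\<And>y. y \<in> {p..q} \<Longrightarrow> \<bar>deriv u y\<bar> \<le> L"
      using compact_imp_bounded bounded_real by (metis imageI)
    have g_bdd: "bdd_borel g L" unfolding bdd_borel_def
      using L[OF clI] \<open>g \<in> borel_measurable borel\<close> by (simp add: g_def)
    have L0: "0 \<le> L" using g_bdd by (rule bdd_borelD)
    have gi_bdd: "bdd_borel gi L"
      using bdd_borelD(2)[OF g_bdd] L0 by (auto simp: bdd_borel_def gi_def split: split_indicator)
    have v_bdd: "bdd_borel v B" unfolding bdd_borel_def
      using bdd_borelD(2)[OF u(1)] \<open>v \<in> borel_measurable borel\<close> by (simp add: v_def)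
    have v_lip: "\<bar>v y - v z\<bar> \<le> L * \<bar>y - z\<bar>" for y z
    proof -
      have "norm (u (cl y) - u (cl z)) \<le> L * norm (cl y - cl z)"
      proof (rule field_differentiable_bound[where S = "{p..q}" and f' = "deriv u"])
        fix w assume w: "w \<in> {p..q}"
        then show "(u has_field_derivative deriv u w) (at w within {p..q})"
          using p q by (intro has_field_derivative_at_within[OF DERIV_deriv_of_Ck[OF u(3)]]) auto
        show "norm (deriv u w) \<le> L" using L[OF w] by simp
      qed (use clI in auto)
      also have "\<dots> \<le> L * \<bar>y - z\<bar>"
        using clamp_lipschitz[of p q y z] L0 by (auto simp: cl_def intro!: mult_left_mono)
      finally show ?thesis by (simp add: v_def)
    qed
    have v_deriv: "(v has_real_derivative gi y) (at y)" if "y \<noteq> p" "y \<noteq> q" for y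
    proof -
      consider "y < p" | "p < y" "y < q" | "q < y" using \<open>y \<noteq> p\<close> \<open>y \<noteq> q\<close> by linarith
      then show ?thesis
      proof cases
        case 1
        have "((\<lambda>_. u p) has_real_derivative gi y) (at y)" using 1 by (simp add: gi_def)
        then show ?thesis
          by (rule has_field_derivative_transform_within_open[where S = "{..<p}"])
             (use 1 p q in \<open>auto simp: v_def cl_def\<close>)
      next
        case 2
        have "(u has_real_derivative gi y) (at y)"
          using DERIV_deriv_of_Ck[OF u(3), of y] 2 p q by (simp add: gi_def g_def cl_id)
        then show ?thesis
          by (rule has_field_derivative_transform_within_open[where S = "{p<..<q}"])
             (use 2 in \<open>auto simp: v_def cl_id\<close>)
      next
        case 3
        have "((\<lambda>_. u q) has_real_derivative gi y) (at y)" using 3 by (simp add: gi_def)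
        then show ?thesis
          by (rule has_field_derivative_transform_within_open[where S = "{q<..}"])
             (use 3 p q in \<open>auto simp: v_def cl_def\<close>)
      qed
    qed
    define r where "r = (\<lambda>y. 1 * u y + (-1) * v y)"
    define e where "e = (\<lambda>y. 1 * gi y + (-1) * g y)"
    have r_bdd: "\<exists>B. bdd_borel r B" unfolding r_def using bdd_borel_lincomb[OF u(1) v_bdd] by blast
    have e_bdd: "\<exists>B. bdd_borel e B" unfolding e_def using bdd_borel_lincomb[OF gi_bdd g_bdd] by blast
    have r_smooth: "Ck j {p<..<q} (mix r)" for j
      using r_bdd by (elim exE) (rule mix_smooth_off_support, auto simp: r_def v_def cl_id)
    have e_smooth: "Ck j {p<..<q} (mix e)" for j
      using e_bdd by (elim exE) (rule mix_smooth_off_support, auto simp: e_def gi_def)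
    have mix_u: "mix u = (\<lambda>y. mix v y + mix r y)"
      using mix_linear[OF u(1) v_bdd, of 1 "-1"] by (intro ext) (simp add: r_def)
    have mix_gi: "mix gi = (\<lambda>y. mix g y + mix e y)"
      using mix_linear[OF gi_bdd g_bdd, of 1 "-1"] by (intro ext) (simp add: e_def)
    have "Ck k {p<..<q} g"
    proof (rule Ck_cong[THEN iffD1, OF _ _ Ck_subset[OF Cd]])
      show "deriv u y = g y" if "y \<in> {p<..<q}" for y using that by (simp add: g_def cl_id)
    qed (use p q in auto)
    then have "Ck (Suc k) {p<..<q} (mix g)" by (rule Suc.IH[OF g_bdd g_cont])
    then have "Ck (Suc k) {p<..<q} (mix gi)"
      unfolding mix_gi by (intro Ck_add e_smooth open_greaterThanLessThan)
    then have "Ck (Suc k) {p<..<q} (\<lambda>y. mix gi y + deriv (mix r) y)"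
      using r_smooth[of "Suc (Suc k)"] unfolding Ck.simps(2)[of "Suc k"]
      by (intro Ck_add open_greaterThanLessThan) auto
    then have "Ck (Suc (Suc k)) {p<..<q} (mix u)"
    proof (rule Ck_SucI[OF open_greaterThanLessThan, rotated])
      fix y assume y: "y \<in> {p<..<q}"
      show "(mix u has_real_derivative mix gi y + deriv (mix r) y) (at y)"
        unfolding mix_u
        by (intro DERIV_add mix_deriv_of_lipschitz[OF v_bdd gi_bdd v_lip v_deriv]
              DERIV_deriv_of_Ck[OF r_smooth[of "Suc 0"] y])
    qed
    then show "\<exists>U. open U \<and> x \<in> U \<and> Ck (Suc (Suc k)) U (mix u)"
      using p q by (intro exI[of _ "{p<..<q}"]) auto
  qed
qed

lemma mix_smoothing_operator: "smoothing_operator mix (4 * measure N (space N))"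
proof
  fix u :: "real \<Rightarrow> real" and B :: real
  assume u: "bdd_borel u B" "continuous_on UNIV u" "\<And>x. u (- x) = u x"
  let ?D = "4 * measure N (space N)"
  have "\<bar>mix u x - mix u z\<bar> \<le> ?D * (1 + M) * (x - z) * (x + \<epsilon>)"
    if "0 \<le> M" "0 \<le> \<epsilon>" "\<forall>y. \<bar>u y\<bar> \<le> M * (\<bar>y\<bar> + \<epsilon>)" "0 \<le> z" "z \<le> x" for M \<epsilon> z x
  proof -
    have "\<bar>mix u x - mix u z\<bar> \<le> ?D * M * (x - z) * (x + \<epsilon>)"
      by (rule mix_growth[OF u]) (use that in auto)
    also have "\<dots> \<le> ?D * (1 + M) * (x - z) * (x + \<epsilon>)"
      using that by (intro mult_right_mono mult_left_mono) auto
    finally show ?thesis .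
  qed
  then show "\<exists>D\<ge>0. \<forall>M\<ge>0. \<forall>\<epsilon>\<ge>0. (\<forall>y. \<bar>u y\<bar> \<le> M * (\<bar>y\<bar> + \<epsilon>)) \<longrightarrow>
        (\<forall>z x. 0 \<le> z \<and> z \<le> x \<longrightarrow> \<bar>mix u x - mix u z\<bar> \<le> D * (1 + M) * (x - z) * (x + \<epsilon>))"
    by (intro exI[of _ ?D]) auto
qed ((rule mix_linear mix_bound mix_lipschitz mix_monotone mix_lower mix_smooth; assumption)
      | rule mix_translation mix_reflection | simp)+

end

section \<open>Fourier inversion\<close>

lemma norm_iexp_real [simp]: "norm (exp (\<i> * complex_of_real t)) = 1"
  by (simp add: norm_exp_i_times)

lemma gaussian_fourier:
  assumes e: "0 < e"
  shows "(\<integral>\<xi>. exp (\<i> * complex_of_real (t * \<xi>)) * of_real (exp (- (e * \<xi>)\<^sup>2 / 2)) \<partial>lborel)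
       = of_real (2 * pi / e * std_normal_density (t / e))"
proof -
  have "complex_of_real (exp (- (t / e)\<^sup>2 / 2)) = char std_normal_distribution (t / e)"
    by (simp add: char_std_normal_distribution)
  also have "\<dots> = (\<integral>z. std_normal_density z *\<^sub>R exp (\<i> * complex_of_real (t / e * z)) \<partial>lborel)"
    unfolding char_def by (subst integral_density) auto
  also have "\<dots> = \<bar>e\<bar> *\<^sub>R (\<integral>\<xi>. std_normal_density (0 + e * \<xi>) *\<^sub>R exp (\<i> * complex_of_real (t / e * (0 + e * \<xi>))) \<partial>lborel)"
    using e by (subst lborel_integral_real_affine[of e _ 0]) auto
  also have "(\<lambda>\<xi>. std_normal_density (0 + e * \<xi>) *\<^sub>R exp (\<i> * complex_of_real (t / e * (0 + e * \<xi>))))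
      = (\<lambda>\<xi>. of_real (1 / sqrt (2 * pi)) * (exp (\<i> * complex_of_real (t * \<xi>)) * of_real (exp (- (e * \<xi>)\<^sup>2 / 2))))"
    using e by (auto simp: std_normal_density_def scaleR_conv_of_real)
  finally have "complex_of_real (exp (- (t / e)\<^sup>2 / 2)) =
      of_real (e / sqrt (2 * pi)) * (\<integral>\<xi>. exp (\<i> * complex_of_real (t * \<xi>)) * of_real (exp (- (e * \<xi>)\<^sup>2 / 2)) \<partial>lborel)"
    using e by (simp add: scaleR_conv_of_real)
  then have "(\<integral>\<xi>. exp (\<i> * complex_of_real (t * \<xi>)) * of_real (exp (- (e * \<xi>)\<^sup>2 / 2)) \<partial>lborel)
      = complex_of_real (exp (- (t / e)\<^sup>2 / 2)) / of_real (e / sqrt (2 * pi))"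
    using e by (simp add: field_simps)
  also have "\<dots> = of_real (exp (- (t / e)\<^sup>2 / 2) / (e / sqrt (2 * pi)))" by simp
  also have "exp (- (t / e)\<^sup>2 / 2) / (e / sqrt (2 * pi)) = 2 * pi / e * std_normal_density (t / e)"
    using e by (simp add: std_normal_density_def field_simps)
  finally show ?thesis .
qed

lemma gaussian_integrable: "0 < e \<Longrightarrow> integrable lborel (\<lambda>\<xi>. exp (- (e * \<xi>)\<^sup>2 / 2) :: real)"
proof -
  assume e: "0 < e"
  have "integrable lborel (\<lambda>z. sqrt (2 * pi) * std_normal_density z)" by simp
  then have "integrable lborel (\<lambda>\<xi>. sqrt (2 * pi) * std_normal_density (0 + e * \<xi>))"
    using e by (intro lborel_integrable_real_affine[of "\<lambda>z. sqrt (2 * pi) * std_normal_density z"]) auto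
  then show ?thesis by (simp add: std_normal_density_def)
qed

text \<open>
  Inversion by Gaussian regularisation: with the factor \<open>exp (- (e \<xi>)\<^sup>2 / 2)\<close> both sides are equal by Fubini,
  and \<open>e \<rightarrow> 0\<close>.
\<close>

theorem fourier_inversion:
  fixes h m :: "real \<Rightarrow> real"
  assumes h: "integrable lborel h" "continuous_on UNIV h" "\<And>x. \<bar>h x\<bar> \<le> B" and m: "integrable lborel m"
    and ft: "\<And>\<xi>. (\<integral>y. of_real (h y) * exp (- (\<i> * complex_of_real (\<xi> * y))) \<partial>lborel) = of_real (m \<xi>)"
  shows "inv_fourier m x = of_real (h x)"
proof -
  have [measurable]: "h \<in> borel_measurable borel" "m \<in> borel_measurable borel"
    using h(1) m by (auto dest: borel_measurable_integrable)
  let ?g = "\<lambda>e \<xi>. exp (- (e * \<xi>)\<^sup>2 / 2) :: real"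
  have reg: "(\<integral>\<xi>. of_real (m \<xi>) * exp (\<i> * of_real (x * \<xi>)) * of_real (?g e \<xi>) \<partial>lborel)
      = complex_of_real (2 * pi * (\<integral>z. h (x + e * z) * std_normal_density z \<partial>lborel))" if e: "0 < e" for e
  proof -
    let ?F = "\<lambda>\<xi> y. of_real (h y) * (exp (\<i> * complex_of_real ((x - y) * \<xi>)) * of_real (?g e \<xi>))"
    have int: "integrable (lborel \<Otimes>\<^sub>M lborel) (\<lambda>(\<xi>, y). ?F \<xi> y)"
    proof (rule lborel_pair.Fubini_integrable)
      have "integrable lborel (\<lambda>\<xi>. ?g e \<xi> * (\<integral>y. \<bar>h y\<bar> \<partial>lborel))"
        using gaussian_integrable[OF e] by simp
      then show "integrable lborel (\<lambda>\<xi>. \<integral>y. norm (case (\<xi>, y) of (\<xi>, y) \<Rightarrow> ?F \<xi> y) \<partial>lborel)"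
        by (simp add: norm_mult mult.commute)
      show "AE \<xi> in lborel. integrable lborel (\<lambda>y. case (\<xi>, y) of (\<xi>, y) \<Rightarrow> ?F \<xi> y)"
        by (rule AE_I2, simp, rule integrable_mult_bounded_right[of _ _ _ 1])
           (use h in \<open>auto simp: norm_mult\<close>)
    qed measurable
    have "(\<integral>\<xi>. of_real (m \<xi>) * exp (\<i> * of_real (x * \<xi>)) * of_real (?g e \<xi>) \<partial>lborel)
        = (\<integral>\<xi>. (\<integral>y. ?F \<xi> y \<partial>lborel) \<partial>lborel)"
    proof (intro Bochner_Integration.integral_cong refl)
      fix \<xi> :: real
      have "of_real (m \<xi>) * exp (\<i> * of_real (x * \<xi>)) * of_real (?g e \<xi>)
          = (\<integral>y. of_real (h y) * exp (- (\<i> * complex_of_real (\<xi> * y))) * (exp (\<i> * of_real (x * \<xi>)) * of_real (?g e \<xi>)) \<partial>lborel)"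
        unfolding ft[symmetric] integral_mult_left_zero by (rule mult.assoc)
      also have "\<dots> = (\<integral>y. ?F \<xi> y \<partial>lborel)"
        by (intro Bochner_Integration.integral_cong refl)
           (simp add: exp_diff exp_minus field_simps flip: exp_add)
      finally show "of_real (m \<xi>) * exp (\<i> * of_real (x * \<xi>)) * of_real (?g e \<xi>) = (\<integral>y. ?F \<xi> y \<partial>lborel)" .
    qed
    also have "\<dots> = (\<integral>y. (\<integral>\<xi>. ?F \<xi> y \<partial>lborel) \<partial>lborel)" by (rule lborel_pair.Fubini_integral[OF int, symmetric])
    also have "\<dots> = (\<integral>y. of_real (h y * (2 * pi / e * std_normal_density ((x - y) / e))) \<partial>lborel)"
      unfolding integral_mult_right_zero gaussian_fourier[OF e] by (simp only: of_real_mult)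
    also have "\<dots> = of_real (\<integral>y. h y * (2 * pi / e * std_normal_density ((x - y) / e)) \<partial>lborel)"
      by (rule integral_complex_of_real)
    also have "(\<integral>y. h y * (2 * pi / e * std_normal_density ((x - y) / e)) \<partial>lborel)
        = \<bar>e\<bar> *\<^sub>R (\<integral>z. h (x + e * z) * (2 * pi / e * std_normal_density ((x - (x + e * z)) / e)) \<partial>lborel)"
      using e by (subst lborel_integral_real_affine[of e _ x]) auto
    also have "\<dots> = \<bar>e\<bar> *\<^sub>R (\<integral>z. (2 * pi / e) * (h (x + e * z) * std_normal_density z) \<partial>lborel)"
      using e by (simp add: std_normal_density_def mult_ac)
    also have "\<dots> = 2 * pi * (\<integral>z. h (x + e * z) * std_normal_density z \<partial>lborel)"
      unfolding integral_mult_right_zero using e by simp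
    finally show ?thesis .
  qed
  define e where "e n = inverse (real (Suc n))" for n
  have e: "0 < e n" "e \<longlonglongrightarrow> 0" for n
    unfolding e_def using LIMSEQ_inverse_real_of_nat by auto
  have "(\<lambda>n. \<integral>\<xi>. of_real (m \<xi>) * exp (\<i> * of_real (x * \<xi>)) * of_real (?g (e n) \<xi>) \<partial>lborel)
      \<longlonglongrightarrow> (\<integral>\<xi>. of_real (m \<xi>) * exp (\<i> * complex_of_real (x * \<xi>)) \<partial>lborel)"
  proof (rule integral_dominated_convergence[where w = "\<lambda>\<xi>. \<bar>m \<xi>\<bar>"])
    show "integrable lborel (\<lambda>\<xi>. \<bar>m \<xi>\<bar>)" using m by simp
    show "AE \<xi> in lborel. norm (of_real (m \<xi>) * exp (\<i> * complex_of_real (x * \<xi>)) * of_real (?g (e n) \<xi>)) \<le> \<bar>m \<xi>\<bar>" for n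
      by (rule AE_I2) (simp add: norm_mult mult_left_le)
    show "AE \<xi> in lborel. (\<lambda>n. of_real (m \<xi>) * exp (\<i> * of_real (x * \<xi>)) * of_real (?g (e n) \<xi>))
        \<longlonglongrightarrow> of_real (m \<xi>) * exp (\<i> * complex_of_real (x * \<xi>))"
    proof (rule AE_I2)
      fix \<xi> :: real
      have "(\<lambda>n. of_real (m \<xi>) * exp (\<i> * of_real (x * \<xi>)) * of_real (?g (e n) \<xi>))
          \<longlonglongrightarrow> of_real (m \<xi>) * exp (\<i> * complex_of_real (x * \<xi>)) * of_real (?g 0 \<xi>)"
        by (intro tendsto_intros e(2)) simp
      then show "(\<lambda>n. of_real (m \<xi>) * exp (\<i> * of_real (x * \<xi>)) * of_real (?g (e n) \<xi>))
        \<longlonglongrightarrow> of_real (m \<xi>) * exp (\<i> * complex_of_real (x * \<xi>))" by simp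
    qed
  qed measurable
  moreover have "(\<lambda>n. \<integral>z. h (x + e n * z) * std_normal_density z \<partial>lborel) \<longlonglongrightarrow> (\<integral>z. h x * std_normal_density z \<partial>lborel)"
  proof (rule integral_dominated_convergence[where w = "\<lambda>z. B * std_normal_density z"])
    show "AE z in lborel. norm (h (x + e n * z) * std_normal_density z) \<le> B * std_normal_density z" for n
      using h(3) by (intro AE_I2) (auto simp: abs_mult intro!: mult_right_mono)
    show "AE z in lborel. (\<lambda>n. h (x + e n * z) * std_normal_density z) \<longlonglongrightarrow> h x * std_normal_density z"
    proof (rule AE_I2)
      fix z :: real
      have "isCont h (x + 0 * z)" using h(2) by (simp add: continuous_on_eq_continuous_at)
      then have "(\<lambda>n. h (x + e n * z)) \<longlonglongrightarrow> h (x + 0 * z)"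
        by (rule isCont_tendsto_compose) (intro tendsto_intros e(2))
      then show "(\<lambda>n. h (x + e n * z) * std_normal_density z) \<longlonglongrightarrow> h x * std_normal_density z"
        by (intro tendsto_mult_right) simp
    qed
  qed auto
  then have "(\<lambda>n. complex_of_real (2 * pi * (\<integral>z. h (x + e n * z) * std_normal_density z \<partial>lborel)))
      \<longlonglongrightarrow> complex_of_real (2 * pi * (\<integral>z. h x * std_normal_density z \<partial>lborel))"
    by (intro tendsto_intros)
  ultimately have "(\<integral>\<xi>. of_real (m \<xi>) * exp (\<i> * complex_of_real (x * \<xi>)) \<partial>lborel)
      = complex_of_real (2 * pi * (\<integral>z. h x * std_normal_density z \<partial>lborel))"
    unfolding reg[OF e(1)] by (rule LIMSEQ_unique)
  then show ?thesis by (simp add: inv_fourier_def)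
qed

lemma expker_cos:
  assumes s: "0 < s"
  shows "(\<integral>z. expker s z * cos (\<xi> * z) \<partial>lborel) = s / (s\<^sup>2 + \<xi>\<^sup>2)"
proof -
  define A where "A = (\<integral>z. expker s z * cos (\<xi> * z) \<partial>lborel)"
  define D where "D = (\<integral>z. expker s z * sin (\<xi> * z) \<partial>lborel)"
  have int: "integrable lborel (\<lambda>z. expker s z * cos (\<xi> * z))" "integrable lborel (\<lambda>z. expker s z * sin (\<xi> * z))"
    by (rule expker_mult_bounded_integrable[OF s, of _ 1]; simp)+
  have c: "expconv s (\<lambda>y. cos (\<xi> * y)) = (\<lambda>x. cos (\<xi> * x) * A + sin (\<xi> * x) * D)"
  proof
    fix x
    have "expconv s (\<lambda>y. cos (\<xi> * y)) x
        = (\<integral>z. cos (\<xi> * x) * (expker s z * cos (\<xi> * z)) + sin (\<xi> * x) * (expker s z * sin (\<xi> * z)) \<partial>lborel)"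
      by (simp add: expconv_def right_diff_distrib cos_diff algebra_simps)
    then show "expconv s (\<lambda>y. cos (\<xi> * y)) x = cos (\<xi> * x) * A + sin (\<xi> * x) * D"
      using int by (simp add: A_def D_def)
  qed
  have d: "expconv s (\<lambda>y. sin (\<xi> * y)) = (\<lambda>x. sin (\<xi> * x) * A - cos (\<xi> * x) * D)"
  proof
    fix x
    have "expconv s (\<lambda>y. sin (\<xi> * y)) x
        = (\<integral>z. sin (\<xi> * x) * (expker s z * cos (\<xi> * z)) - cos (\<xi> * x) * (expker s z * sin (\<xi> * z)) \<partial>lborel)"
      by (simp add: expconv_def right_diff_distrib sin_diff algebra_simps)
    then show "expconv s (\<lambda>y. sin (\<xi> * y)) x = sin (\<xi> * x) * A - cos (\<xi> * x) * D"
      using int by (simp add: A_def D_def)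
  qed
  have "(expconv s (\<lambda>y. cos (\<xi> * y)) has_real_derivative cos (\<xi> * 0) - s * expconv s (\<lambda>y. cos (\<xi> * y)) 0) (at 0)"
    by (rule expconv_has_derivative[OF s, where B = 1]) (auto intro!: continuous_intros)
  then have "((\<lambda>x. cos (\<xi> * x) * A + sin (\<xi> * x) * D) has_real_derivative 1 - s * A) (at 0)"
    unfolding c by simp
  moreover have "((\<lambda>x. cos (\<xi> * x) * A + sin (\<xi> * x) * D) has_real_derivative \<xi> * D) (at 0)"
    by (auto intro!: derivative_eq_intros)
  ultimately have 1: "\<xi> * D = 1 - s * A" using DERIV_unique by fastforce
  have "(expconv s (\<lambda>y. sin (\<xi> * y)) has_real_derivative sin (\<xi> * 0) - s * expconv s (\<lambda>y. sin (\<xi> * y)) 0) (at 0)"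
    by (rule expconv_has_derivative[OF s, where B = 1]) (auto intro!: continuous_intros)
  then have "((\<lambda>x. sin (\<xi> * x) * A - cos (\<xi> * x) * D) has_real_derivative s * D) (at 0)"
    unfolding d by simp
  moreover have "((\<lambda>x. sin (\<xi> * x) * A - cos (\<xi> * x) * D) has_real_derivative \<xi> * A) (at 0)"
    by (auto intro!: derivative_eq_intros)
  ultimately have 2: "\<xi> * A = s * D" using DERIV_unique by fastforce
  have "A * (s\<^sup>2 + \<xi>\<^sup>2) = s * (s * A) + \<xi> * (\<xi> * A)" by (simp add: power2_eq_square algebra_simps)
  also have "\<dots> = s * (s * A + \<xi> * D)" unfolding 2 by (simp add: algebra_simps)
  also have "\<dots> = s" unfolding 1 by simp
  finally have "A * (s\<^sup>2 + \<xi>\<^sup>2) = s" .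
  moreover have "s\<^sup>2 + \<xi>\<^sup>2 \<noteq> 0" using s by (simp add: add_pos_nonneg pos_add_strict less_imp_neq[symmetric])
  ultimately show ?thesis unfolding A_def[symmetric] by (simp add: eq_divide_eq)
qed

context laplace_mixture
begin

lemma ker_fourier:
  "(\<integral>y. of_real (ker y) * exp (- (\<i> * complex_of_real (\<xi> * y))) \<partial>lborel)
     = of_real (\<integral>w. 2 * \<sigma> w / ((\<sigma> w)\<^sup>2 + \<xi>\<^sup>2) \<partial>N)"
proof -
  have bc: "bdd_borel (\<lambda>y. cos (\<xi> * y)) 1" and bs: "bdd_borel (\<lambda>y. sin (\<xi> * y)) 1"
    by (auto simp: bdd_borel_def)
  have mc: "(\<integral>y. ker y * cos (\<xi> * y) \<partial>lborel) = (\<integral>w. 2 * \<sigma> w / ((\<sigma> w)\<^sup>2 + \<xi>\<^sup>2) \<partial>N)"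
  proof -
    have "(\<integral>y. ker y * cos (\<xi> * y) \<partial>lborel) = mix (\<lambda>y. cos (\<xi> * y)) 0"
      by (simp add: mix_def ker_even)
    also have "\<dots> = (\<integral>w. 2 * \<sigma> w / ((\<sigma> w)\<^sup>2 + \<xi>\<^sup>2) \<partial>N)"
      unfolding mix_eq[OF bc]
      by (intro Bochner_Integration.integral_cong refl)
         (simp add: expsum_def expconv_def expker_cos[OF \<sigma>_pos])
    finally show ?thesis .
  qed
  have ms: "(\<integral>y. ker y * sin (\<xi> * y) \<partial>lborel) = 0"
  proof -
    have "mix (\<lambda>y. sin (\<xi> * y)) 0 = mix (\<lambda>y. sin (\<xi> * (- y))) 0"
      using mix_reflection[of "\<lambda>y. sin (\<xi> * y)" 0] by simp
    also have "\<dots> = - mix (\<lambda>y. sin (\<xi> * y)) 0" by (simp add: mix_def)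
    finally show ?thesis by (simp add: mix_def ker_even)
  qed
  have ic: "integrable lborel (\<lambda>y. ker y * cos (\<xi> * y))" "integrable lborel (\<lambda>y. ker y * sin (\<xi> * y))"
    using integrable_ker_mult[OF bc, of 0] integrable_ker_mult[OF bs, of 0] by (simp_all add: ker_even)
  have "(\<integral>y. of_real (ker y) * exp (- (\<i> * complex_of_real (\<xi> * y))) \<partial>lborel)
      = (\<integral>y. complex_of_real (ker y * cos (\<xi> * y)) - \<i> * complex_of_real (ker y * sin (\<xi> * y)) \<partial>lborel)"
    by (intro Bochner_Integration.integral_cong refl)
       (simp add: complex_eq_iff Re_exp Im_exp)
  also have "\<dots> = (\<integral>y. complex_of_real (ker y * cos (\<xi> * y)) \<partial>lborel) - (\<integral>y. \<i> * complex_of_real (ker y * sin (\<xi> * y)) \<partial>lborel)"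
    by (intro Bochner_Integration.integral_diff integrable_mult_right integrable_of_real ic)
  also have "\<dots> = of_real (\<integral>w. 2 * \<sigma> w / ((\<sigma> w)\<^sup>2 + \<xi>\<^sup>2) \<partial>N)"
    unfolding integral_mult_right_zero integral_complex_of_real mc ms by simp
  finally show ?thesis .
qed

end

section \<open>The Bessel kernel\<close>

lemma integrable_powr_on_Icc_0_1:
  assumes "-1 < (e :: real)" shows "integrable lborel (\<lambda>x. indicator {0..1} x * x powr e)"
proof -
  have "((\<lambda>x. x powr e) has_integral (1 powr (e + 1) / (e + 1))) {0..1}"
    using assms by (intro has_integral_powr_from_0) auto
  then have "(\<integral>\<^sup>+x. ennreal (indicator {0..1} x * x powr e) \<partial>lborel) = ennreal (1 powr (e + 1) / (e + 1))"
    by (rule nn_integral_has_integral_lebesgue[rotated]) simp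
  then show ?thesis by (intro integrableI_nonneg) auto
qed

lemma integrable_powr_on_Ici_1:
  assumes "(e :: real) < -1" shows "integrable lborel (\<lambda>x. indicator {1..} x * x powr e)"
proof -
  have "((\<lambda>x. x powr e) has_integral (- (1 powr (e + 1)) / (e + 1))) {1..}"
    using assms by (intro has_integral_powr_to_inf) auto
  then have "(\<integral>\<^sup>+x. ennreal (indicator {1..} x * x powr e) \<partial>lborel) = ennreal (- (1 powr (e + 1)) / (e + 1))"
    by (rule nn_integral_has_integral_lebesgue[rotated]) simp
  then show ?thesis by (intro integrableI_nonneg) auto
qed

lemma symbol_pos: "0 < symbol \<alpha> \<xi>"
proof -
  have "0 < 1 + \<xi>\<^sup>2" by (simp add: add_pos_nonneg)
  then show ?thesis by (simp add: symbol_def)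
qed

lemma symbol_add: "symbol (\<alpha> + \<beta>) \<xi> = symbol \<alpha> \<xi> * symbol \<beta> \<xi>"
  by (simp add: symbol_def powr_add[symmetric] add_divide_distrib diff_divide_distrib)

lemma symbol_measurable [measurable]: "symbol \<alpha> \<in> borel_measurable borel"
  unfolding symbol_def by measurable

lemma symbol_integrable:
  assumes "\<alpha> > 1" shows "integrable lborel (symbol \<alpha>)"
proof -
  let ?t = "\<lambda>x::real. indicator {1..} x * x powr (- \<alpha>)"
  have t: "integrable lborel ?t" using assms by (intro integrable_powr_on_Ici_1) simp
  then have t': "integrable lborel (\<lambda>x. ?t (0 + (-1) * x))" by (rule lborel_integrable_real_affine) simp
  show ?thesis
  proof (rule Bochner_Integration.integrable_bound)
    show "integrable lborel (\<lambda>x. indicator {-1..1} x + (?t x + ?t (0 + (-1) * x)))"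
      by (intro Bochner_Integration.integrable_add t t' integrable_real_indicator) (auto simp: emeasure_lborel_Icc_eq)
    show "AE x in lborel. norm (symbol \<alpha> x) \<le> norm (indicator {-1..1} x + (?t x + ?t (0 + (-1) * x)))"
    proof (rule AE_I2)
      fix x :: real
      have nn: "0 \<le> indicator {-1..1} x + (?t x + ?t (0 + (-1) * x))" by simp
      have "symbol \<alpha> x \<le> indicator {-1..1} x + (?t x + ?t (0 + (-1) * x))"
      proof (cases "\<bar>x\<bar> \<le> 1")
        case True
        have "1 powr (- (- \<alpha> / 2)) \<le> (1 + x\<^sup>2) powr (- (- \<alpha> / 2))" using assms by (intro powr_mono2) auto
        then have "symbol \<alpha> x \<le> 1" by (simp add: symbol_def powr_minus inverse_le_1_iff)
        then show ?thesis using True by (auto simp: indicator_def)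
      next
        case False
        have "symbol \<alpha> x \<le> (\<bar>x\<bar>\<^sup>2) powr (- \<alpha> / 2)"
          unfolding symbol_def using assms False by (intro powr_mono2') auto
        also have "\<bar>x\<bar>\<^sup>2 = \<bar>x\<bar> powr 2" using False by (subst powr_numeral) auto
        also have "(\<bar>x\<bar> powr 2) powr (- \<alpha> / 2) = \<bar>x\<bar> powr (- \<alpha>)" unfolding powr_powr by simp
        finally show ?thesis using False by (cases "0 \<le> x") (auto simp: indicator_def)
      qed
      then show "norm (symbol \<alpha> x) \<le> norm (indicator {-1..1} x + (?t x + ?t (0 + (-1) * x)))"
        using nn symbol_pos[of \<alpha> x] by (simp only: real_norm_def abs_of_nonneg less_imp_le)
    qed
  qed measurable
qed

definition kernel_rep :: "real \<Rightarrow> (real \<Rightarrow> real) \<Rightarrow> ((real \<Rightarrow> real) \<Rightarrow> real \<Rightarrow> real) \<Rightarrow> real \<Rightarrow> bool" where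
  "kernel_rep \<alpha> k T C \<longleftrightarrow> smoothing_operator T C \<and> integrable lborel k \<and>
     (\<forall>x. kernel \<alpha> x = of_real (k x)) \<and>
     (\<forall>u B x. bdd_borel u B \<longrightarrow> T u x = (\<integral>y. k (x - y) * u y \<partial>lborel))"

lemma (in laplace_mixture) mixture_kernel_rep:
  assumes "\<alpha> > 1" and "\<And>\<xi>. (\<integral>w. 2 * \<sigma> w / ((\<sigma> w)\<^sup>2 + \<xi>\<^sup>2) \<partial>N) = symbol \<alpha> \<xi>"
  shows "kernel_rep \<alpha> ker mix (4 * measure N (space N))"
    and "(\<integral>y. of_real (ker y) * exp (- (\<i> * complex_of_real (\<xi> * y))) \<partial>lborel) = of_real (symbol \<alpha> \<xi>)"
proof -
  show ft: "(\<integral>y. of_real (ker y) * exp (- (\<i> * complex_of_real (\<xi> * y))) \<partial>lborel) = of_real (symbol \<alpha> \<xi>)" for \<xi>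
    unfolding ker_fourier assms(2) ..
  have "kernel \<alpha> x = of_real (ker x)" for x
    unfolding kernel_def
    by (rule fourier_inversion[OF ker_integrable ker_continuous _ symbol_integrable[OF assms(1)] ft,
          of "measure N (space N)"]) (use ker_nonneg ker_le in auto)
  then show "kernel_rep \<alpha> ker mix (4 * measure N (space N))"
    using mix_smoothing_operator ker_integrable by (auto simp: kernel_rep_def mix_def)
qed

lemma emeasure_space_nonzero:
  fixes f :: "'a \<Rightarrow> real"
  assumes "(\<integral>w. f w \<partial>N) \<noteq> 0" shows "emeasure N (space N) \<noteq> 0"
proof
  assume "emeasure N (space N) = 0"
  then have "AE w in N. False" by (intro AE_I[of _ _ "space N"]) auto
  then have "AE w in N. f w = 0" by eventually_elim simp
  then have "(\<integral>w. f w \<partial>N) = 0" by (rule integral_eq_zero_AE)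
  with assms show False by simp
qed

lemma resolvent_mixture_lt_2:
  assumes "1 < \<alpha>" "\<alpha> < 2"
  shows "\<exists>(N :: real measure) \<sigma>. laplace_mixture N \<sigma> \<and> (\<forall>\<xi>. (\<integral>w. 2 * \<sigma> w / ((\<sigma> w)\<^sup>2 + \<xi>\<^sup>2) \<partial>N) = symbol \<alpha> \<xi>)"
proof -
  define a where "a = \<alpha> / 2"
  have a: "1 / 2 < a" "a < 1" using assms by (auto simp: a_def)
  define r where "r w = indicator {0<..} w * w powr (- a) / sqrt (1 + \<bar>w\<bar>)" for w :: real
  define \<Phi> where "\<Phi> A = (\<integral>w. indicator {0<..} w * w powr (- a) / (w + A) \<partial>lborel)" for A :: real
  have [measurable]: "r \<in> borel_measurable borel" unfolding r_def by measurable
  have r0: "0 \<le> r w" for w by (simp add: r_def)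
  have r_int: "integrable lborel r"
  proof (rule Bochner_Integration.integrable_bound)
    show "integrable lborel (\<lambda>w. indicator {0..1} w * w powr (- a) + indicator {1..} w * w powr (- a - 1 / 2))"
      using a by (intro Bochner_Integration.integrable_add integrable_powr_on_Icc_0_1 integrable_powr_on_Ici_1) auto
    show "AE w in lborel. norm (r w) \<le> norm (indicator {0..1} w * w powr (- a) + indicator {1..} w * w powr (- a - 1 / 2))"
    proof (rule AE_I2)
      fix w :: real
      have "r w \<le> indicator {0..1} w * w powr (- a) + indicator {1..} w * w powr (- a - 1 / 2)"
      proof (cases "w \<le> 0")
        case True
        then show ?thesis by (auto simp: r_def indicator_def)
      next
        case w: False
        show ?thesis
        proof (cases "w \<le> 1")
          case True
          have "w powr (- a) / sqrt (1 + \<bar>w\<bar>) \<le> w powr (- a) / 1"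
            using w by (intro divide_left_mono) auto
          also have "\<dots> \<le> indicator {0..1} w * w powr (- a) + indicator {1..} w * w powr (- a - 1 / 2)"
            using w True by simp
          finally show ?thesis using w by (simp add: r_def)
        next
          case False
          have "w powr (- a) / sqrt (1 + \<bar>w\<bar>) \<le> w powr (- a) / sqrt w"
            using w by (intro divide_left_mono) auto
          also have "\<dots> = w powr (- a - 1 / 2)"
            using w by (simp add: powr_diff powr_half_sqrt)
          finally show ?thesis using w False by (auto simp: r_def indicator_def)
        qed
      qed
      then show "norm (r w) \<le> norm (indicator {0..1} w * w powr (- a) + indicator {1..} w * w powr (- a - 1 / 2))"
        using r0[of w] by simp
    qed
  qed measurable
  have \<Phi>_scale: "\<Phi> A = A powr (- a) * \<Phi> 1" if "0 < A" for A
  proof -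
    have "\<Phi> A = \<bar>A\<bar> *\<^sub>R (\<integral>v. indicator {0<..} (0 + A * v) * (0 + A * v) powr (- a) / ((0 + A * v) + A) \<partial>lborel)"
      unfolding \<Phi>_def using that by (subst lborel_integral_real_affine[of A _ 0]) auto
    also have "(\<lambda>v. indicator {0<..} (0 + A * v) * (0 + A * v) powr (- a) / ((0 + A * v) + A))
        = (\<lambda>v. (A powr (- a) / A) * (indicator {0<..} v * v powr (- a) / (v + 1)))"
    proof
      fix v :: real
      have "A * v + A = A * (v + 1)" by (simp add: algebra_simps)
      then show "indicator {0<..} (0 + A * v) * (0 + A * v) powr (- a) / ((0 + A * v) + A)
        = (A powr (- a) / A) * (indicator {0<..} v * v powr (- a) / (v + 1))"
        using that by (auto simp: indicator_def powr_mult zero_less_mult_iff)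
    qed
    finally show ?thesis using that unfolding integral_mult_right_zero by (simp flip: \<Phi>_def)
  qed
  have \<Phi>_int: "integrable lborel (\<lambda>w. indicator {0<..} w * w powr (- a) / (w + 1))"
  proof (rule Bochner_Integration.integrable_bound[OF r_int])
    show "AE w in lborel. norm (indicator {0<..} w * w powr (- a) / (w + 1)) \<le> norm (r w)"
    proof (rule AE_I2)
      fix w :: real
      have "w powr (- a) / (w + 1) \<le> w powr (- a) / sqrt (1 + w)" if "0 < w"
      proof (rule divide_left_mono)
        show "sqrt (1 + w) \<le> w + 1"
          using that by (intro real_le_lsqrt) (auto simp: power2_eq_square algebra_simps)
      qed (use that in auto)
      then show "norm (indicator {0<..} w * w powr (- a) / (w + 1)) \<le> norm (r w)"
        by (auto simp: r_def indicator_def)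
    qed
  qed measurable
  have "(\<integral>w. indicator {1..2 :: real} w * (2 powr (- a) / 3) \<partial>lborel) \<le> \<Phi> 1"
    unfolding \<Phi>_def
  proof (rule integral_mono[OF _ \<Phi>_int])
    show "integrable lborel (\<lambda>w. indicator {1..2 :: real} w * (2 powr (- a) / 3))"
      by (auto intro!: integrable_mult_left integrable_real_indicator simp: emeasure_lborel_Icc_eq)
    fix w :: real
    have "2 powr (- a) / 3 \<le> w powr (- a) / (w + 1)" if "w \<in> {1..2}"
      using that a by (intro frac_le powr_mono2') auto
    then show "indicator {1..2} w * (2 powr (- a) / 3) \<le> indicator {0<..} w * w powr (- a) / (w + 1)"
      by (auto simp: indicator_def)
  qed
  moreover have "0 < (\<integral>w. indicator {1..2 :: real} w * (2 powr (- a) / 3) \<partial>lborel)" by simp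
  ultimately have \<Phi>1: "0 < \<Phi> 1" by linarith
  define N where "N = density lborel (\<lambda>w. ennreal (r w / (2 * \<Phi> 1)))"
  define \<sigma> where "\<sigma> w = sqrt (1 + \<bar>w\<bar>)" for w :: real
  have eq: "(\<integral>w. 2 * \<sigma> w / ((\<sigma> w)\<^sup>2 + \<xi>\<^sup>2) \<partial>N) = symbol \<alpha> \<xi>" for \<xi>
  proof -
    have A: "0 < 1 + \<xi>\<^sup>2" by (simp add: add_pos_nonneg)
    have "(\<integral>w. 2 * \<sigma> w / ((\<sigma> w)\<^sup>2 + \<xi>\<^sup>2) \<partial>N)
        = (\<integral>w. (r w / (2 * \<Phi> 1)) *\<^sub>R (2 * \<sigma> w / ((\<sigma> w)\<^sup>2 + \<xi>\<^sup>2)) \<partial>lborel)"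
      unfolding N_def by (rule integral_density) (use r0 \<Phi>1 in \<open>auto simp: \<sigma>_def\<close>)
    also have "\<dots> = (\<integral>w. (indicator {0<..} w * w powr (- a) / (w + (1 + \<xi>\<^sup>2))) / \<Phi> 1 \<partial>lborel)"
    proof (intro Bochner_Integration.integral_cong refl)
      fix w :: real
      have "sqrt (1 + w) / sqrt (1 + w) = 1" if "0 < w" using that by simp
      then show "(r w / (2 * \<Phi> 1)) *\<^sub>R (2 * \<sigma> w / ((\<sigma> w)\<^sup>2 + \<xi>\<^sup>2))
          = (indicator {0<..} w * w powr (- a) / (w + (1 + \<xi>\<^sup>2))) / \<Phi> 1"
        by (auto simp: r_def \<sigma>_def indicator_def add_ac)
    qed
    also have "\<dots> = \<Phi> (1 + \<xi>\<^sup>2) / \<Phi> 1" unfolding integral_divide_zero \<Phi>_def ..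
    also have "\<dots> = symbol \<alpha> \<xi>" using \<Phi>_scale[OF A] \<Phi>1 by (simp add: symbol_def a_def)
    finally show ?thesis .
  qed
  have "laplace_mixture N \<sigma>"
  proof (intro laplace_mixture.intro laplace_mixture_axioms.intro finite_measureI)
    have "integrable lborel (\<lambda>w. r w / (2 * \<Phi> 1))" using r_int by simp
    then have "(\<integral>\<^sup>+w. ennreal (r w / (2 * \<Phi> 1)) \<partial>lborel) \<noteq> \<infinity>"
      using r0 \<Phi>1 by (subst nn_integral_eq_integral) auto
    then show "emeasure N (space N) \<noteq> \<infinity>" by (simp add: N_def emeasure_density)
    show "\<sigma> \<in> borel_measurable N" unfolding N_def \<sigma>_def by measurable
    show "1 \<le> \<sigma> w" for w by (simp add: \<sigma>_def)
    show "emeasure N (space N) \<noteq> 0"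
      by (rule emeasure_space_nonzero[of N "\<lambda>w. 2 * \<sigma> w / ((\<sigma> w)\<^sup>2 + 0\<^sup>2)"])
         (unfold eq, use symbol_pos[of \<alpha> 0] in simp)
  qed
  with eq show ?thesis by blast
qed

lemma resolvent_mixture_2:
  "\<exists>(N :: unit measure) \<sigma>. laplace_mixture N \<sigma> \<and> (\<forall>\<xi>. (\<integral>w. 2 * \<sigma> w / ((\<sigma> w)\<^sup>2 + \<xi>\<^sup>2) \<partial>N) = symbol 2 \<xi>)"
proof -
  define N where "N = density (count_space (UNIV :: unit set)) (\<lambda>_. ennreal (1 / 2))"
  define \<sigma> where "\<sigma> = (\<lambda>_ :: unit. 1 :: real)"
  have eq: "(\<integral>w. 2 * \<sigma> w / ((\<sigma> w)\<^sup>2 + \<xi>\<^sup>2) \<partial>N) = symbol 2 \<xi>" for \<xi>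
  proof -
    have "0 < 1 + \<xi>\<^sup>2" by (simp add: add_pos_nonneg)
    then show ?thesis
      unfolding N_def \<sigma>_def
      by (subst integral_density) (auto simp: lebesgue_integral_count_space_finite symbol_def powr_minus field_simps)
  qed
  have em: "emeasure N (space N) = ennreal (1 / 2)"
    by (simp add: N_def emeasure_density nn_integral_count_space_finite)
  have "laplace_mixture N \<sigma>"
    by (intro laplace_mixture.intro laplace_mixture_axioms.intro finite_measureI)
       (use em in \<open>auto simp: \<sigma>_def\<close>)
  with eq show ?thesis by blast
qed

lemma kernel_rep_base:
  assumes "1 < \<alpha>" "\<alpha> \<le> 2"
  shows "\<exists>k T C. kernel_rep \<alpha> k T C \<and>
    (\<forall>\<xi>. (\<integral>y. of_real (k y) * exp (- (\<i> * complex_of_real (\<xi> * y))) \<partial>lborel) = of_real (symbol \<alpha> \<xi>))"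
proof (cases "\<alpha> = 2")
  case True
  obtain N :: "unit measure" and \<sigma> where "laplace_mixture N \<sigma>"
    and eq: "\<And>\<xi>. (\<integral>w. 2 * \<sigma> w / ((\<sigma> w)\<^sup>2 + \<xi>\<^sup>2) \<partial>N) = symbol 2 \<xi>"
    using resolvent_mixture_2 by auto
  then interpret laplace_mixture N \<sigma> by simp
  from mixture_kernel_rep[OF assms(1), unfolded True, OF eq] True show ?thesis by blast
next
  case False
  obtain N :: "real measure" and \<sigma> where "laplace_mixture N \<sigma>"
    and eq: "\<And>\<xi>. (\<integral>w. 2 * \<sigma> w / ((\<sigma> w)\<^sup>2 + \<xi>\<^sup>2) \<partial>N) = symbol \<alpha> \<xi>"
    using resolvent_mixture_lt_2[of \<alpha>] assms False by auto
  then interpret laplace_mixture N \<sigma> by simp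
  from mixture_kernel_rep[OF assms(1) eq] show ?thesis by blast
qed

lemma integrable_shift_real:
  fixes f :: "real \<Rightarrow> real"
  assumes "integrable lborel f"
  shows "integrable lborel (\<lambda>x. f (x - a))" "(\<integral>x. f (x - a) \<partial>lborel) = (\<integral>x. f x \<partial>lborel)"
    "integrable lborel (\<lambda>x. f (a - x))" "(\<integral>x. f (a - x) \<partial>lborel) = (\<integral>x. f x \<partial>lborel)"
proof -
  show "integrable lborel (\<lambda>x. f (x - a))" "integrable lborel (\<lambda>x. f (a - x))"
    using lborel_integrable_real_affine[OF assms, of 1 "- a"] lborel_integrable_real_affine[OF assms, of "-1" a] by simp_all
  show "(\<integral>x. f (x - a) \<partial>lborel) = (\<integral>x. f x \<partial>lborel)" "(\<integral>x. f (a - x) \<partial>lborel) = (\<integral>x. f x \<partial>lborel)"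
    using lborel_integral_real_affine[of 1 f "- a"] lborel_integral_real_affine[of "-1" f a] by simp_all
qed

lemma integrable_convolution_pair:
  fixes f g :: "real \<Rightarrow> real"
  assumes f: "integrable lborel f" and g: "integrable lborel g"
  shows "integrable (lborel \<Otimes>\<^sub>M lborel) (\<lambda>(w, x). f w * g (x - w))"
proof (rule lborel_pair.Fubini_integrable)
  have [measurable]: "f \<in> borel_measurable borel" "g \<in> borel_measurable borel"
    using f g by (auto dest: borel_measurable_integrable)
  show "(\<lambda>(w, x). f w * g (x - w)) \<in> borel_measurable (lborel \<Otimes>\<^sub>M lborel)" by measurable
  have "integrable lborel (\<lambda>w. \<bar>f w\<bar> * (\<integral>x. \<bar>g x\<bar> \<partial>lborel))" using f by simp
  then show "integrable lborel (\<lambda>w. \<integral>x. norm (case (w, x) of (w, x) \<Rightarrow> f w * g (x - w)) \<partial>lborel)"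
    using integrable_shift_real(2)[of "\<lambda>x. \<bar>g x\<bar>"] g by (simp add: abs_mult)
  show "AE w in lborel. integrable lborel (\<lambda>x. case (w, x) of (w, x) \<Rightarrow> f w * g (x - w))"
    using integrable_shift_real(1)[OF g] by (intro AE_I2) simp
qed

lemma integrable_convolution:
  fixes f g :: "real \<Rightarrow> real"
  assumes "integrable lborel f" "integrable lborel g"
  shows "integrable lborel (\<lambda>x. \<integral>w. f w * g (x - w) \<partial>lborel)"
  using lborel_pair.integrable_snd[OF integrable_convolution_pair[OF assms]] by simp

lemma convolution_assoc:
  fixes f g u :: "real \<Rightarrow> real"
  assumes f: "integrable lborel f" and g: "integrable lborel g" and u: "bdd_borel u B"
  shows "(\<integral>y. (\<integral>w. f w * g (x - y - w) \<partial>lborel) * u y \<partial>lborel)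
       = (\<integral>z. f (x - z) * (\<integral>y. g (z - y) * u y \<partial>lborel) \<partial>lborel)"
proof -
  have [measurable]: "f \<in> borel_measurable borel" "g \<in> borel_measurable borel" "u \<in> borel_measurable borel"
    using f g u by (auto dest: borel_measurable_integrable bdd_borelD)
  have int: "integrable (lborel \<Otimes>\<^sub>M lborel) (\<lambda>(w, y). f w * (g (x - w - y) * u y))"
  proof (rule lborel_pair.Fubini_integrable)
    have gu: "integrable lborel (\<lambda>y. g (a - y) * u y)" for a
      by (rule integrable_mult_bounded_right[OF integrable_shift_real(3)[OF g], of _ B])
         (use bdd_borelD(2)[OF u] in auto)
    then show "AE w in lborel. integrable lborel (\<lambda>y. case (w, y) of (w, y) \<Rightarrow> f w * (g (x - w - y) * u y))"
      by (intro AE_I2) simp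
    have "\<bar>\<integral>y. \<bar>g (x - w - y) * u y\<bar> \<partial>lborel\<bar> \<le> (\<integral>y. \<bar>g y\<bar> \<partial>lborel) * B" for w
    proof -
      have "(\<integral>y. \<bar>g (x - w - y) * u y\<bar> \<partial>lborel) \<le> (\<integral>y. \<bar>g (x - w - y)\<bar> * B \<partial>lborel)"
      proof (rule integral_mono)
        show "integrable lborel (\<lambda>y. \<bar>g (x - w - y) * u y\<bar>)" using gu by (rule integrable_abs)
        show "integrable lborel (\<lambda>y. \<bar>g (x - w - y)\<bar> * B)"
          using integrable_shift_real(3)[OF g, of "x - w"] by simp
        show "\<bar>g (x - w - y) * u y\<bar> \<le> \<bar>g (x - w - y)\<bar> * B" for y
          using bdd_borelD(2)[OF u, of y] by (simp add: abs_mult mult_left_mono)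
      qed
      also have "\<dots> = (\<integral>y. \<bar>g y\<bar> \<partial>lborel) * B"
        using integrable_shift_real(4)[of "\<lambda>x. \<bar>g x\<bar>" "x - w"] g by simp
      finally show ?thesis by (simp add: abs_of_nonneg)
    qed
    then have "integrable lborel (\<lambda>w. \<bar>f w\<bar> * (\<integral>y. \<bar>g (x - w - y) * u y\<bar> \<partial>lborel))"
      using f by (intro integrable_mult_bounded_right[of _ _ _ "(\<integral>y. \<bar>g y\<bar> \<partial>lborel) * B"]) auto
    then show "integrable lborel (\<lambda>w. \<integral>y. norm (case (w, y) of (w, y) \<Rightarrow> f w * (g (x - w - y) * u y)) \<partial>lborel)"
      by (simp add: abs_mult)
  qed measurable
  have "(\<integral>y. (\<integral>w. f w * g (x - y - w) \<partial>lborel) * u y \<partial>lborel) = (\<integral>y. (\<integral>w. f w * (g (x - w - y) * u y) \<partial>lborel) \<partial>lborel)"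
    unfolding integral_mult_left_zero[symmetric]
    by (intro Bochner_Integration.integral_cong refl) (simp add: algebra_simps)
  also have "\<dots> = (\<integral>w. (\<integral>y. f w * (g (x - w - y) * u y) \<partial>lborel) \<partial>lborel)"
    by (rule lborel_pair.Fubini_integral[OF int])
  also have "\<dots> = (\<integral>w. f w * (\<integral>y. g (x - w - y) * u y \<partial>lborel) \<partial>lborel)"
    unfolding integral_mult_right_zero ..
  also have "\<dots> = (\<integral>z. f (x - z) * (\<integral>y. g (z - y) * u y \<partial>lborel) \<partial>lborel)"
    by (subst lborel_integral_real_affine[of "-1" _ x]) simp_all
  finally show ?thesis .
qed

lemma kernel_add:
  assumes \<gamma>: "1 < \<gamma>" and f: "integrable lborel f"
    and ft: "\<And>\<xi>. (\<integral>y. of_real (f y) * exp (- (\<i> * complex_of_real (\<xi> * y))) \<partial>lborel) = of_real (symbol \<beta> \<xi>)"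
    and g: "\<And>x. kernel \<gamma> x = of_real (g x)"
  shows "kernel (\<beta> + \<gamma>) x = of_real (\<integral>w. f w * g (x - w) \<partial>lborel)"
proof -
  have [measurable]: "f \<in> borel_measurable borel" using f by (auto dest: borel_measurable_integrable)
  let ?F = "\<lambda>\<xi> y. complex_of_real (f y) * (of_real (symbol \<gamma> \<xi>) * exp (\<i> * of_real ((x - y) * \<xi>)))"
  have int: "integrable (lborel \<Otimes>\<^sub>M lborel) (\<lambda>(\<xi>, y). ?F \<xi> y)"
  proof (rule lborel_pair.Fubini_integrable)
    have "integrable lborel (\<lambda>\<xi>. \<bar>symbol \<gamma> \<xi>\<bar> * (\<integral>y. \<bar>f y\<bar> \<partial>lborel))"
      using symbol_integrable[OF \<gamma>] by simp
    then show "integrable lborel (\<lambda>\<xi>. \<integral>y. norm (case (\<xi>, y) of (\<xi>, y) \<Rightarrow> ?F \<xi> y) \<partial>lborel)"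
      by (simp add: norm_mult mult.commute)
    show "AE \<xi> in lborel. integrable lborel (\<lambda>y. case (\<xi>, y) of (\<xi>, y) \<Rightarrow> ?F \<xi> y)"
    proof (rule AE_I2)
      fix \<xi> :: real
      show "integrable lborel (\<lambda>y. case (\<xi>, y) of (\<xi>, y) \<Rightarrow> ?F \<xi> y)"
        unfolding prod.case
        by (rule integrable_mult_bounded_right[of _ _ _ "\<bar>symbol \<gamma> \<xi>\<bar>"]) (use f in \<open>auto simp: norm_mult\<close>)
    qed
  qed measurable
  have "(\<integral>\<xi>. of_real (symbol (\<beta> + \<gamma>) \<xi>) * exp (\<i> * of_real (x * \<xi>)) \<partial>lborel) = (\<integral>\<xi>. (\<integral>y. ?F \<xi> y \<partial>lborel) \<partial>lborel)"
  proof (intro Bochner_Integration.integral_cong refl)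
    fix \<xi> :: real
    have "of_real (symbol (\<beta> + \<gamma>) \<xi>) * exp (\<i> * of_real (x * \<xi>))
        = (\<integral>y. of_real (f y) * exp (- (\<i> * complex_of_real (\<xi> * y))) * (of_real (symbol \<gamma> \<xi>) * exp (\<i> * of_real (x * \<xi>))) \<partial>lborel)"
      unfolding integral_mult_left_zero ft by (simp add: symbol_add)
    also have "\<dots> = (\<integral>y. ?F \<xi> y \<partial>lborel)"
      by (intro Bochner_Integration.integral_cong refl)
         (simp add: exp_diff exp_minus field_simps flip: exp_add)
    finally show "of_real (symbol (\<beta> + \<gamma>) \<xi>) * exp (\<i> * of_real (x * \<xi>)) = (\<integral>y. ?F \<xi> y \<partial>lborel)" .
  qed
  also have "\<dots> = (\<integral>y. (\<integral>\<xi>. ?F \<xi> y \<partial>lborel) \<partial>lborel)" by (rule lborel_pair.Fubini_integral[OF int, symmetric])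
  also have "\<dots> = (\<integral>y. of_real (f y) * (2 * of_real pi * kernel \<gamma> (x - y)) \<partial>lborel)"
    unfolding integral_mult_right_zero kernel_def inv_fourier_def
    by (intro Bochner_Integration.integral_cong refl) simp
  also have "\<dots> = (\<integral>y. (2 * of_real pi) * complex_of_real (f y * g (x - y)) \<partial>lborel)"
    by (simp add: g mult_ac)
  also have "\<dots> = 2 * of_real pi * of_real (\<integral>y. f y * g (x - y) \<partial>lborel)"
    unfolding integral_mult_right_zero integral_complex_of_real ..
  finally show ?thesis by (simp add: kernel_def inv_fourier_def)
qed

lemma kernel_rep_add:
  assumes \<gamma>: "1 < \<gamma>" and f: "kernel_rep \<beta> f T1 C1"
    and ft: "\<And>\<xi>. (\<integral>y. of_real (f y) * exp (- (\<i> * complex_of_real (\<xi> * y))) \<partial>lborel) = of_real (symbol \<beta> \<xi>)"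
    and g: "kernel_rep \<gamma> g T2 C2"
  shows "kernel_rep (\<beta> + \<gamma>) (\<lambda>x. \<integral>w. f w * g (x - w) \<partial>lborel) (\<lambda>u. T1 (T2 u)) (C1 * C2)"
  unfolding kernel_rep_def
proof (intro conjI allI impI)
  have f': "integrable lborel f" "smoothing_operator T1 C1"
      "\<And>u B x. bdd_borel u B \<Longrightarrow> T1 u x = (\<integral>y. f (x - y) * u y \<partial>lborel)"
    and g': "integrable lborel g" "smoothing_operator T2 C2" "\<And>x. kernel \<gamma> x = of_real (g x)"
      "\<And>u B x. bdd_borel u B \<Longrightarrow> T2 u x = (\<integral>y. g (x - y) * u y \<partial>lborel)"
    using f g by (auto simp: kernel_rep_def)
  show "smoothing_operator (\<lambda>u. T1 (T2 u)) (C1 * C2)"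
    by (rule smoothing_operator_compose[OF f'(2) g'(2)])
  show "integrable lborel (\<lambda>x. \<integral>w. f w * g (x - w) \<partial>lborel)"
    by (rule integrable_convolution[OF f'(1) g'(1)])
  show "kernel (\<beta> + \<gamma>) x = of_real (\<integral>w. f w * g (x - w) \<partial>lborel)" for x
    by (rule kernel_add[OF \<gamma> f'(1) ft g'(3)])
  fix u B x assume u: "bdd_borel u B"
  have "T1 (T2 u) x = (\<integral>z. f (x - z) * (\<integral>y. g (z - y) * u y \<partial>lborel) \<partial>lborel)"
    using f'(3)[OF smoothing_operator.bdd_borel_T[OF g'(2) u]] g'(4)[OF u] by simp
  then show "T1 (T2 u) x = (\<integral>y. (\<integral>w. f w * g (x - y - w) \<partial>lborel) * u y \<partial>lborel)"
    using convolution_assoc[OF f'(1) g'(1) u] by simp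
qed

lemma kernel_rep_exists:
  assumes "1 < \<alpha>" shows "\<exists>k T C. kernel_rep \<alpha> k T C"
proof -
  define n where "n = nat \<lceil>\<alpha> / 2\<rceil>"
  have n: "\<alpha> / 2 \<le> real n" "real n < \<alpha> / 2 + 1" "0 < n"
    unfolding n_def using assms by linarith+
  define \<beta> where "\<beta> = \<alpha> / real n"
  have "\<beta> \<le> 2" using n by (simp add: \<beta>_def field_simps)
  have "1 < \<beta>"
  proof (cases "n = 1")
    case False
    with n have "2 \<le> real n" by simp
    with n have "real n < \<alpha>" by linarith
    then show ?thesis using n by (simp add: \<beta>_def)
  qed (use assms in \<open>simp add: \<beta>_def\<close>)
  obtain f T1 C1 where f: "kernel_rep \<beta> f T1 C1"
    and ft: "\<And>\<xi>. (\<integral>y. of_real (f y) * exp (- (\<i> * complex_of_real (\<xi> * y))) \<partial>lborel) = of_real (symbol \<beta> \<xi>)"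
    using kernel_rep_base[OF \<open>1 < \<beta>\<close> \<open>\<beta> \<le> 2\<close>] by blast
  have "\<exists>k T C. kernel_rep (real (Suc m) * \<beta>) k T C" for m
  proof (induction m)
    case 0
    then show ?case using f by auto
  next
    case (Suc m)
    then obtain g T2 C2 where g: "kernel_rep (real (Suc m) * \<beta>) g T2 C2" by blast
    have "1 * 1 < real (Suc m) * \<beta>" using \<open>1 < \<beta>\<close> by (intro mult_le_less_imp_less) auto
    then have "kernel_rep (\<beta> + real (Suc m) * \<beta>) (\<lambda>x. \<integral>w. f w * g (x - w) \<partial>lborel) (\<lambda>u. T1 (T2 u)) (C1 * C2)"
      by (intro kernel_rep_add[OF _ f ft g]) simp
    moreover have "\<beta> + real (Suc m) * \<beta> = real (Suc (Suc m)) * \<beta>" by (simp add: algebra_simps)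
    ultimately show ?case by auto
  qed
  from this[of "n - 1"] show ?thesis using n by (simp add: \<beta>_def)
qed

lemma L_op_eq:
  assumes "kernel_rep \<alpha> k T C" "bdd_borel u B"
  shows "L_op \<alpha> u x = of_real (T u x)"
proof -
  have "L_op \<alpha> u x = (\<integral>y. complex_of_real (k (x - y) * u y) \<partial>lborel)"
    using assms(1) by (simp add: L_op_def convolve_def kernel_rep_def)
  also have "\<dots> = of_real (T u x)"
    using assms by (simp only: integral_complex_of_real kernel_rep_def)
  finally show ?thesis .
qed

lemma periodic_even_antimono_measurable:
  fixes u :: "real \<Rightarrow> real"
  assumes "\<And>x. u (x + 2 * pi) = u x" "\<And>x. u (- x) = u x" "antimono_on {0..pi} u"
  shows "u \<in> borel_measurable borel"
proof -
  define v where "v x = - u (max 0 (min pi x))" for x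
  have "mono v"
  proof (rule monoI)
    fix x y :: real assume "x \<le> y"
    then have "max 0 (min pi x) \<le> max 0 (min pi y)" by (intro max.mono min.mono) auto
    then show "v x \<le> v y"
      using assms(3) pi_ge_zero unfolding v_def by (auto intro!: monotone_onD[OF assms(3)])
  qed
  then have [measurable]: "v \<in> borel_measurable borel" by (rule borel_measurable_mono)
  have "continuous_on UNIV circ_dist"
    by (rule lipschitz_on_continuous_on[of 1], rule lipschitz_onI)
       (use circ_dist_lipschitz in \<open>auto simp: dist_real_def\<close>)
  then have [measurable]: "circ_dist \<in> borel_measurable borel" by (rule borel_measurable_continuous_onI)
  have "u = (\<lambda>x. - v (circ_dist x))"
  proof
    fix x
    have "- v (circ_dist x) = u (circ_dist x)" using circ_dist_range[of x] by (simp add: v_def)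
    then show "u x = - v (circ_dist x)" using circ_dist_fold[of u x, OF assms(1,2)] by simp
  qed
  moreover have "(\<lambda>x. - v (circ_dist x)) \<in> borel_measurable borel" by measurable
  ultimately show ?thesis by simp
qed

theorem theorem4p6:
  fixes \<alpha> \<mu> :: real and \<phi> :: "real \<Rightarrow> real"
  assumes "\<alpha> > 1"
    and "is_solution \<alpha> \<mu> \<phi>"
    and "\<And>x. \<phi> x \<le> \<mu>"
    and "\<not> \<phi> constant_on UNIV"
    and "\<And>x. \<phi> (x + 2 * pi) = \<phi> x"
    and "\<And>x. \<phi> (- x) = \<phi> x"
    and "antimono_on {0..pi} \<phi>"
    and "\<phi> 0 = \<mu>"
  shows "(C_infinity_on (UNIV - range (\<lambda>k::int. 2 * pi * of_int k)) \<phi> \<and>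
          strict_antimono_on {0<..<pi} \<phi>) \<and>
         (\<exists>C. C-lipschitz_on UNIV \<phi>) \<and>
         (\<exists>c\<^sub>1>0. \<exists>c\<^sub>2>0. \<exists>\<delta>>0. \<forall>x. \<bar>x\<bar> < \<delta> \<longrightarrow>
            c\<^sub>1 * \<bar>x\<bar> \<le> \<mu> - \<phi> x \<and> \<mu> - \<phi> x \<le> c\<^sub>2 * \<bar>x\<bar>)"
proof -
  obtain k T C where rep: "kernel_rep \<alpha> k T C" using kernel_rep_exists[OF assms(1)] by blast
  interpret smoothing_operator T C using rep by (simp add: kernel_rep_def)
  obtain B' where "\<And>x. \<bar>\<phi> x\<bar> \<le> B'"
    using assms(2) by (auto simp: is_solution_def bounded_iff)
  then have b\<phi>: "bdd_borel \<phi> B'"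
    using periodic_even_antimono_measurable[OF assms(5-7)] by (simp add: bdd_borel_def)
  have eq\<phi>: "(\<mu> - \<phi> x)\<^sup>2 = \<mu>\<^sup>2 - 2 * T \<phi> x" for x
  proof -
    have "complex_of_real (1 / 2 * (\<mu> - \<phi> x)\<^sup>2) = complex_of_real (1 / 2 * \<mu>\<^sup>2 - T \<phi> x)"
      using assms(2) L_op_eq[OF rep b\<phi>, of x] by (simp add: is_solution_def)
    then have "1 / 2 * (\<mu> - \<phi> x)\<^sup>2 = 1 / 2 * \<mu>\<^sup>2 - T \<phi> x" by (simp only: of_real_eq_iff)
    then show ?thesis by (simp add: field_simps)
  qed
  define u where "u = (\<lambda>x. 1 * \<mu> + (-1) * \<phi> x)"
  have u: "u x = \<mu> - \<phi> x" for x by (simp add: u_def)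
  obtain B where bu: "bdd_borel u B"
    unfolding u_def using bdd_borel_lincomb[OF bdd_borel_const b\<phi>] by blast
  obtain d where d: "\<And>x. T (\<lambda>_. \<mu>) x = d" using T_const by blast
  have Tu: "T u x = d - T \<phi> x" for x
    unfolding u_def using linear[OF bdd_borel_const[of \<mu>] b\<phi>, of 1 "-1" x] d by simp
  have nonneg: "0 \<le> u x" for x using assms(3)[of x] by (simp add: u)
  have u0: "u 0 = 0" using assms(8) by (simp add: u)
  have per: "u (x + 2 * pi) = u x" and even: "u (- x) = u x" for x using assms(5,6) by (simp_all add: u)
  have mono: "mono_on {0..pi} u"
    using assms(7) by (auto simp: u monotone_on_def)
  have equ: "(u x)\<^sup>2 = 2 * (T u x - T u 0)" for x
    using eq\<phi>[of x] eq\<phi>[of 0] assms(8) by (simp add: u Tu)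
  have nonconst: "u pi \<noteq> 0"
  proof
    assume "u pi = 0"
    have "\<phi> x = \<mu>" for x
    proof -
      have "u (circ_dist x) \<le> u pi"
        using circ_dist_range[of x] by (intro mono_onD[OF mono]) auto
      then show ?thesis
        using nonneg[of x] circ_dist_fold[of u x, OF per even] \<open>u pi = 0\<close> u[of x] by simp
    qed
    with assms(4) show False by (auto simp: constant_on_def)
  qed
  note sol = nonneg u0 bu per even mono nonconst equ
  have \<phi>: "\<phi> = (\<lambda>x. \<mu> + (-1) * u x)" by (auto simp: u)
  have "C_infinity_on (UNIV - range (\<lambda>k::int. 2 * pi * of_int k)) \<phi>"
  proof (rule C_infinity_onI)
    fix k
    have "closed ((\<lambda>x. (2 * pi) *\<^sub>R x) ` range (of_int :: int \<Rightarrow> real))"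
      by (intro closed_scaling closed_of_int_image)
    then have "open (UNIV - range (\<lambda>k::int. 2 * pi * of_int k))"
      by (intro open_Diff open_UNIV) (simp add: image_image)
    then show "Ck k (UNIV - range (\<lambda>k::int. 2 * pi * of_int k)) \<phi>"
      unfolding \<phi> by (intro Ck_affine sol_smooth[OF sol])
  qed
  moreover have "strict_antimono_on {0<..<pi} \<phi>"
    using strict_mono_onD[OF sol_strict_mono[OF sol]] by (auto simp: monotone_on_def \<phi>)
  moreover have "\<exists>C. C-lipschitz_on UNIV \<phi>"
  proof -
    obtain L where "L-lipschitz_on UNIV u" using sol_lipschitz[OF sol] by blast
    then have "L-lipschitz_on UNIV \<phi>" by (simp add: lipschitz_on_def dist_real_def u abs_minus_commute)
    then show ?thesis by blast
  qed
  moreover have "\<exists>c\<^sub>1>0. \<exists>c\<^sub>2>0. \<exists>\<delta>>0. \<forall>x. \<bar>x\<bar> < \<delta> \<longrightarrow> c\<^sub>1 * \<bar>x\<bar> \<le> \<mu> - \<phi> x \<and> \<mu> - \<phi> x \<le> c\<^sub>2 * \<bar>x\<bar>"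
  proof -
    obtain c where c: "0 < c" "\<And>x. x \<in> {0..pi} \<Longrightarrow> c * x \<le> u x" using sol_lower[OF sol] by blast
    obtain M where M: "0 \<le> M" "\<And>x. u x \<le> M * \<bar>x\<bar>" using sol_upper[OF sol] by blast
    have "c * \<bar>x\<bar> \<le> \<mu> - \<phi> x \<and> \<mu> - \<phi> x \<le> (M + 1) * \<bar>x\<bar>" if "\<bar>x\<bar> < pi" for x
      using c(2)[of "\<bar>x\<bar>"] M(2)[of x] even[of x] that by (auto simp: algebra_simps abs_if u split: if_splits)
    then show ?thesis
      using c(1) M(1) by (intro exI[of _ c] exI[of _ "M + 1"] exI[of _ pi] conjI) auto
  qed
  ultimately show ?thesis by blast
qed

end
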